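(* Let $(\Lambda_t)_{t\ge0}$ be a family of CPTP maps on $d\times d$ density matrices ($d\ge2$ finite), with $\Lambda_0=\mathrm{id}$ and $t\mapsto\Lambda_t$ differentiable, which is non-Markovian. Suppose either (i) every $\Lambda_t$ is invertible as a linear map on $d\times d$ matrices, or (ii) $d=2$ (in which case invertibility is not required). Then there exist finite-dimensional systems $B$ and $C$ and a state $\rho^{ABC}$ on $\mathbb{C}^d\otimes\mathcal H_B\otimes\mathcal H_C$ such that for some $t>0$ $$\frac{\mathrm d}{\mathrm dt}E^{AB|C}\big((\Lambda_t^A\otimes\mathrm{id}^{BC})[\rho^{ABC}]\big)>0$$ (understood as the right derivative), so that the negativity $E^{AB|C}$ of the evolved state strictly increases at some time.
   Context: Negativity of a bipartite operator $X$ on $\mathcal H_{X_1}\otimes\mathcal H_{X_2}$ with respect to the cut $X_1|X_2$ is $E^{X_1|X_2}(X)=\frac{\|X^{T_{X_2}}\|_1-1}{2}$, where $T_{X_2}$ is the partial transpose on $X_2$ and $\|M\|_1=\mathrm{Tr}\sqrt{M^\dagger M}$. Here $E^{AB|C}$ treats $AB$ as one party and $C$ as the other. An evolution $(\Lambda_t)$ is Markovian (CP-divisible) if for every $0\le s\le t$ there is a CPTP map $V_{t,s}$ with $\Lambda_t=V_{t,s}\circ\Lambda_s$; otherwise it is non-Markovian. $\Lambda_t^A\otimes\mathrm{id}^{BC}$ means $\Lambda_t$ acting on the system $A=\mathbb{C}^d$ only. *)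

theory Defs
  imports Complex_Main "Jordan_Normal_Form.Matrix"
begin

definition mtrace :: "complex mat \<Rightarrow> complex" where
  "mtrace A = (\<Sum>i<dim_row A. A $$ (i,i))"

definition adj :: "complex mat \<Rightarrow> complex mat" where
  "adj A = mat (dim_col A) (dim_row A) (\<lambda>(i,j). cnj (A $$ (j,i)))"

definition psd :: "nat \<Rightarrow> complex mat \<Rightarrow> bool" where
  "psd n A \<longleftrightarrow> A \<in> carrier_mat n n \<and> adj A = A \<and>
     (\<forall>v :: nat \<Rightarrow> complex. 0 \<le> Re (\<Sum>i<n. \<Sum>j<n. cnj (v i) * A $$ (i,j) * v j))"

definition density :: "nat \<Rightarrow> complex mat \<Rightarrow> bool" where
  "density n \<rho> \<longleftrightarrow> psd n \<rho> \<and> mtrace \<rho> = 1"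

definition trace_norm :: "complex mat \<Rightarrow> real" where
  "trace_norm X = Re (mtrace (THE S. psd (dim_col X) S \<and> S * S = adj X * X))"

(* partial transpose on the second factor of C^n1 (x) C^n2,
   basis index (i1,i2) |-> i1*n2 + i2 *)
definition partial_transpose2 :: "nat \<Rightarrow> nat \<Rightarrow> complex mat \<Rightarrow> complex mat" where
  "partial_transpose2 n1 n2 X = mat (n1*n2) (n1*n2)
     (\<lambda>(i,j). X $$ ((i div n2) * n2 + j mod n2, (j div n2) * n2 + i mod n2))"

definition negativity :: "nat \<Rightarrow> nat \<Rightarrow> complex mat \<Rightarrow> real" where
  "negativity n1 n2 X = (trace_norm (partial_transpose2 n1 n2 X) - 1) / 2"

(* (Phi (x) id_m) for a map Phi on d x d matrices acting on the first factor of
   C^d (x) C^m, basis index (a,k) |-> a*m + k *)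
definition ampl :: "(complex mat \<Rightarrow> complex mat) \<Rightarrow> nat \<Rightarrow> nat \<Rightarrow> complex mat \<Rightarrow> complex mat" where
  "ampl \<Phi> d m X = mat (d*m) (d*m)
     (\<lambda>(i,j). \<Phi> (mat d d (\<lambda>(x,y). X $$ (x*m + i mod m, y*m + j mod m))) $$ (i div m, j div m))"

definition linear_map_on :: "nat \<Rightarrow> (complex mat \<Rightarrow> complex mat) \<Rightarrow> bool" where
  "linear_map_on d \<Phi> \<longleftrightarrow>
     (\<forall>X \<in> carrier_mat d d. \<Phi> X \<in> carrier_mat d d) \<and>
     (\<forall>X \<in> carrier_mat d d. \<forall>Y \<in> carrier_mat d d. \<Phi> (X + Y) = \<Phi> X + \<Phi> Y) \<and>
     (\<forall>c. \<forall>X \<in> carrier_mat d d. \<Phi> (c \<cdot>\<^sub>m X) = c \<cdot>\<^sub>m \<Phi> X)"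

definition CPTP :: "nat \<Rightarrow> (complex mat \<Rightarrow> complex mat) \<Rightarrow> bool" where
  "CPTP d \<Phi> \<longleftrightarrow> linear_map_on d \<Phi> \<and>
     (\<forall>m>0. \<forall>X. psd (d*m) X \<longrightarrow> psd (d*m) (ampl \<Phi> d m X)) \<and>
     (\<forall>X \<in> carrier_mat d d. mtrace (\<Phi> X) = mtrace X)"

definition markovian :: "nat \<Rightarrow> (real \<Rightarrow> complex mat \<Rightarrow> complex mat) \<Rightarrow> bool" where
  "markovian d \<Lambda> \<longleftrightarrow> (\<forall>s t. 0 \<le> s \<and> s \<le> t \<longrightarrow>
     (\<exists>V. CPTP d V \<and> (\<forall>X \<in> carrier_mat d d. \<Lambda> t X = V (\<Lambda> s X))))"

end

theory Submission
  imports
    "HOL-Library.Quadratic_Discriminant"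
    "HOL-Analysis.Derivative"
    "Jordan_Normal_Form.Determinant"
    Defs
begin

text \<open>
  Mixing two positive operators \<open>P\<close>, \<open>N\<close> on \<open>A\<close> and an ancilla with the Bell states \<open>\<phi>\<^sub>+\<close>, \<open>\<phi>\<^sub>-\<close> shared
  by \<open>B\<close> and \<open>C\<close> gives a state whose negativity is, up to a positive factor, the trace norm of
  \<open>P - N\<close>, and \<open>P - N\<close> can be a positive multiple of any Hermitian \<open>X\<close>. Hence if the negativity
  never has a positive right derivative, \<open>\<parallel>(\<Lambda> t \<otimes> id) X\<parallel>\<close> is nonincreasing in \<open>t > 0\<close> for every
  Hermitian \<open>X\<close>: its right derivative always exists because the trace norm is convex and Lipschitz.

  If \<open>\<Lambda> s\<close> is invertible, \<open>V = \<Lambda> t \<circ> (\<Lambda> s)\<^sup>-\<^sup>1\<close> preserves the trace and is a trace norm contraction on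
  Hermitian operators at every level, so it is completely positive.

  For a qubit, let \<open>t\<close> be the first time at which \<open>\<Lambda> t\<close> is singular. The factors between times
  \<open>s < t\<close> and \<open>t\<close> accumulate at a singular channel fixing the range of \<open>\<Lambda> t\<close>; no such channel exists
  if that range is three-dimensional, so from \<open>t\<close> on the states are mapped into a line of the Bloch
  ball. For two qubit states the contraction property is sufficient for the existence of a channel
  (Alberti and Uhlmann).
\<close>

unbundle no vec_syntax

section \<open>Hermitian matrices and traces\<close>

definition hermitian :: "nat \<Rightarrow> complex mat \<Rightarrow> bool" where
  "hermitian n A \<longleftrightarrow> A \<in> carrier_mat n n \<and> adj A = A"

definition outer_prod :: "nat \<Rightarrow> (nat \<Rightarrow> complex) \<Rightarrow> (nat \<Rightarrow> complex) \<Rightarrow> complex mat" where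
  "outer_prod n v w = mat n n (\<lambda>(i,j). v i * cnj (w j))"

lemma outer_prod_carrier [simp]: "outer_prod n v w \<in> carrier_mat n n"
  by (simp add: outer_prod_def)

lemma outer_prod_dim [simp]: "dim_row (outer_prod n v w) = n" "dim_col (outer_prod n v w) = n"
  by (simp_all add: outer_prod_def)

lemma outer_prod_index [simp]: "i < n \<Longrightarrow> j < n \<Longrightarrow> outer_prod n v w $$ (i,j) = v i * cnj (w j)"
  by (simp add: outer_prod_def)

declare index_mult_mat(1) [simp del]

lemma mult_mat_index:
  "i < dim_row A \<Longrightarrow> j < dim_col B \<Longrightarrow> dim_col A = dim_row B \<Longrightarrow>
    (A * B) $$ (i,j) = (\<Sum>k<dim_row B. A $$ (i,k) * B $$ (k,j))"
  by (simp add: index_mult_mat(1) scalar_prod_def atLeast0LessThan)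

lemma mult_mat_assoc:
  "dim_col A = dim_row B \<Longrightarrow> dim_col B = dim_row C \<Longrightarrow> A * B * C = A * (B * C)"
  for A :: "'a::semiring_0 mat"
  by (rule assoc_mult_mat[of A "dim_row A" "dim_row B"]) auto

lemma mult_square_carrier [simp]:
  "A \<in> carrier_mat n n \<Longrightarrow> B \<in> carrier_mat n n \<Longrightarrow> A * B \<in> carrier_mat n n"
  by (rule mult_carrier_mat)

lemma eq_zero_matI:
  "A \<in> carrier_mat n m \<Longrightarrow> (\<And>i j. i < n \<Longrightarrow> j < m \<Longrightarrow> A $$ (i,j) = 0) \<Longrightarrow> A = 0\<^sub>m n m"
  by (intro eq_matI) auto

lemma eq_if_minus_mat_eq_zero:
  fixes A B :: "'a::group_add mat"
  assumes "A \<in> carrier_mat n m" "B \<in> carrier_mat n m" "A - B = 0\<^sub>m n m"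
  shows "A = B"
proof (rule eq_matI)
  fix i j assume "i < dim_row B" "j < dim_col B"
  then have "A $$ (i,j) - B $$ (i,j) = (A - B) $$ (i,j)" by simp
  then show "A $$ (i,j) = B $$ (i,j)"
    using assms \<open>i < dim_row B\<close> \<open>j < dim_col B\<close> by simp
qed (use assms in auto)

lemma smult_smult_mat: "c \<cdot>\<^sub>m (d \<cdot>\<^sub>m A) = (c * d) \<cdot>\<^sub>m A" for c d :: "'a::semigroup_mult"
  by (rule eq_matI) (auto simp: mult.assoc)

lemma smult_one_add_smult_zero:
  fixes A B :: "'a::semiring_1 mat"
  assumes "A \<in> carrier_mat n m" "B \<in> carrier_mat n m"
  shows "1 \<cdot>\<^sub>m A + 0 \<cdot>\<^sub>m B = A" and "0 \<cdot>\<^sub>m A + 1 \<cdot>\<^sub>m B = B"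
  using assms by (auto intro!: eq_matI)

lemma smult_mat_eq_zero_iff:
  fixes c :: "'a::semiring_no_zero_divisors"
  assumes "A \<in> carrier_mat n m"
  shows "c \<cdot>\<^sub>m A = 0\<^sub>m n m \<longleftrightarrow> c = 0 \<or> A = 0\<^sub>m n m"
proof
  assume zero: "c \<cdot>\<^sub>m A = 0\<^sub>m n m"
  have "c * A $$ (i,j) = 0" if "i < n" "j < m" for i j
    using arg_cong[OF zero, of "\<lambda>M. M $$ (i,j)"] assms that by simp
  then show "c = 0 \<or> A = 0\<^sub>m n m" using assms eq_zero_matI by (metis mult_eq_0_iff)
qed (use assms in \<open>auto intro!: eq_matI\<close>)

lemma adj_carrier [simp]: "A \<in> carrier_mat n m \<Longrightarrow> adj A \<in> carrier_mat m n"
  by (auto simp: adj_def)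

lemma adj_dim [simp]: "dim_row (adj A) = dim_col A" "dim_col (adj A) = dim_row A"
  by (simp_all add: adj_def)

lemma adj_index [simp]: "i < dim_col A \<Longrightarrow> j < dim_row A \<Longrightarrow> adj A $$ (i,j) = cnj (A $$ (j,i))"
  by (simp add: adj_def)

lemma adj_adj [simp]: "adj (adj A) = A"
  by (rule eq_matI) auto

lemma adj_mult: "dim_col A = dim_row B \<Longrightarrow> adj (A * B) = adj B * adj A"
  by (rule eq_matI) (auto simp: mult_mat_index mult.commute)

lemma adj_add: "A \<in> carrier_mat n m \<Longrightarrow> B \<in> carrier_mat n m \<Longrightarrow> adj (A + B) = adj A + adj B"
  by (rule eq_matI) auto

lemma adj_minus: "A \<in> carrier_mat n m \<Longrightarrow> B \<in> carrier_mat n m \<Longrightarrow> adj (A - B) = adj A - adj B"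
  by (rule eq_matI) auto

lemma adj_smult: "adj (c \<cdot>\<^sub>m A) = cnj c \<cdot>\<^sub>m adj A"
  by (rule eq_matI) auto

lemma adj_one [simp]: "adj (1\<^sub>m n) = 1\<^sub>m n"
  by (rule eq_matI) auto

lemma hermitian_carrier: "hermitian n A \<Longrightarrow> A \<in> carrier_mat n n"
  by (simp add: hermitian_def)

lemma hermitian_iff:
  "hermitian n A \<longleftrightarrow> A \<in> carrier_mat n n \<and> (\<forall>i<n. \<forall>j<n. cnj (A $$ (i,j)) = A $$ (j,i))"
proof (cases "A \<in> carrier_mat n n")
  case True
  then have "adj A = A \<longleftrightarrow> (\<forall>j<n. \<forall>i<n. adj A $$ (j,i) = A $$ (j,i))"
    by (auto simp del: adj_index intro!: eq_matI)
  then show ?thesis using True by (auto simp: hermitian_def)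
qed (simp add: hermitian_def)

lemma hermitian_index: "hermitian n A \<Longrightarrow> i < n \<Longrightarrow> j < n \<Longrightarrow> cnj (A $$ (i,j)) = A $$ (j,i)"
  by (simp add: hermitian_iff)

lemma hermitian_add: "hermitian n A \<Longrightarrow> hermitian n B \<Longrightarrow> hermitian n (A + B)"
  by (auto simp: hermitian_def adj_add)

lemma hermitian_minus: "hermitian n A \<Longrightarrow> hermitian n B \<Longrightarrow> hermitian n (A - B)"
  by (auto simp: hermitian_def adj_minus minus_carrier_mat)

lemma hermitian_smult: "hermitian n A \<Longrightarrow> hermitian n (complex_of_real c \<cdot>\<^sub>m A)"
  by (auto simp: hermitian_def adj_smult)

lemma hermitian_one: "hermitian n (1\<^sub>m n)"
  by (simp add: hermitian_def)

lemma hermitian_decomp: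
  assumes "X \<in> carrier_mat n n"
  obtains A B where "hermitian n A" "hermitian n B" "X = A + \<i> \<cdot>\<^sub>m B"
proof
  show "hermitian n (mat n n (\<lambda>(i,j). (X $$ (i,j) + cnj (X $$ (j,i))) / 2))"
    by (auto simp: hermitian_iff)
  show "hermitian n (mat n n (\<lambda>(i,j). (cnj (X $$ (j,i)) - X $$ (i,j)) * (\<i> / 2)))"
    by (auto simp: hermitian_iff algebra_simps)
  show "X = mat n n (\<lambda>(i,j). (X $$ (i,j) + cnj (X $$ (j,i))) / 2)
      + \<i> \<cdot>\<^sub>m mat n n (\<lambda>(i,j). (cnj (X $$ (j,i)) - X $$ (i,j)) * (\<i> / 2))"
    using assms by (intro eq_matI) (auto simp: field_simps)
qed

lemma hermitian_parts_eq_zero: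
  assumes A: "hermitian n A" and B: "hermitian n B" and zero: "A + \<i> \<cdot>\<^sub>m B = 0\<^sub>m n n"
  shows "A = 0\<^sub>m n n" and "B = 0\<^sub>m n n"
proof -
  note carrier = A[THEN hermitian_carrier] B[THEN hermitian_carrier]
  have "A $$ (i,j) = 0 \<and> B $$ (i,j) = 0" if ij: "i < n" "j < n" for i j
  proof -
    have sum: "A $$ (k,l) + \<i> * B $$ (k,l) = 0" if "k < n" "l < n" for k l
      using arg_cong[OF zero, of "\<lambda>M. M $$ (k,l)"] that carrier by simp
    have "A $$ (i,j) - \<i> * B $$ (i,j) = 0"
      using arg_cong[OF sum[OF ij(2,1)], of cnj] ij
      by (simp add: hermitian_index[OF A] hermitian_index[OF B])
    with sum[OF ij] have "2 * A $$ (i,j) = 0" by (simp add: algebra_simps)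
    then show ?thesis using sum[OF ij] by simp
  qed
  then show "A = 0\<^sub>m n n" "B = 0\<^sub>m n n" using carrier by (auto intro!: eq_matI)
qed

lemma mtrace_eq: "A \<in> carrier_mat n n \<Longrightarrow> mtrace A = (\<Sum>i<n. A $$ (i,i))"
  by (auto simp: mtrace_def)

lemma mtrace_add: "A \<in> carrier_mat n n \<Longrightarrow> B \<in> carrier_mat n n \<Longrightarrow> mtrace (A + B) = mtrace A + mtrace B"
  by (simp add: mtrace_def sum.distrib[symmetric])

lemma mtrace_minus: "A \<in> carrier_mat n n \<Longrightarrow> B \<in> carrier_mat n n \<Longrightarrow> mtrace (A - B) = mtrace A - mtrace B"
  by (simp add: mtrace_def sum_subtractf[symmetric])

lemma mtrace_smult: "A \<in> carrier_mat n n \<Longrightarrow> mtrace (c \<cdot>\<^sub>m A) = c * mtrace A"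
  by (simp add: mtrace_def sum_distrib_left)

lemma mtrace_zero [simp]: "mtrace (0\<^sub>m n n) = 0"
  by (simp add: mtrace_def)

lemma mtrace_one: "mtrace (1\<^sub>m n) = of_nat n"
  by (simp add: mtrace_def)

lemma mtrace_mult:
  assumes "A \<in> carrier_mat n m" "B \<in> carrier_mat m n"
  shows "mtrace (A * B) = (\<Sum>i<n. \<Sum>j<m. A $$ (i,j) * B $$ (j,i))"
  using assms by (auto simp: mtrace_def mult_mat_index)

lemma mtrace_comm:
  assumes "A \<in> carrier_mat n m" "B \<in> carrier_mat m n"
  shows "mtrace (A * B) = mtrace (B * A)"
  unfolding mtrace_mult[OF assms] mtrace_mult[OF assms(2,1)]
  by (subst sum.swap) (simp add: mult.commute)

lemma mtrace_adj: "A \<in> carrier_mat n n \<Longrightarrow> mtrace (adj A) = cnj (mtrace A)"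
  by (simp add: mtrace_def)

lemma Im_mtrace_hermitian: "hermitian n A \<Longrightarrow> Im (mtrace A) = 0"
  using mtrace_adj[of A n] by (simp add: hermitian_def complex_eq_iff)

section \<open>Positive semidefinite matrices\<close>

definition qform :: "nat \<Rightarrow> complex mat \<Rightarrow> (nat \<Rightarrow> complex) \<Rightarrow> complex" where
  "qform n A v = (\<Sum>i<n. \<Sum>j<n. cnj (v i) * A $$ (i,j) * v j)"

lemma psd_iff: "psd n A \<longleftrightarrow> hermitian n A \<and> (\<forall>v. 0 \<le> Re (qform n A v))"
  by (auto simp: psd_def hermitian_def qform_def)

lemma psd_hermitian: "psd n A \<Longrightarrow> hermitian n A"
  by (simp add: psd_iff)

lemma psd_carrier: "psd n A \<Longrightarrow> A \<in> carrier_mat n n"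
  by (simp add: psd_def)

lemma qform_add: "A \<in> carrier_mat n n \<Longrightarrow> B \<in> carrier_mat n n \<Longrightarrow>
    qform n (A + B) v = qform n A v + qform n B v"
  by (simp add: qform_def sum.distrib[symmetric] algebra_simps)

lemma qform_smult: "A \<in> carrier_mat n n \<Longrightarrow> qform n (c \<cdot>\<^sub>m A) v = c * qform n A v"
  by (simp add: qform_def sum_distrib_left algebra_simps)

lemma qform_one: "qform n (1\<^sub>m n) v = of_real (\<Sum>i<n. (cmod (v i))\<^sup>2)"
proof -
  have "qform n (1\<^sub>m n) v = (\<Sum>i<n. \<Sum>j<n. if j = i then cnj (v i) * v i else 0)"
    unfolding qform_def by (intro sum.cong refl) auto
  then show ?thesis by (simp add: complex_norm_square mult.commute del: of_real_power)
qed

lemma qform_column: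
  assumes "A \<in> carrier_mat n n" "V \<in> carrier_mat n 1"
  shows "qform n A (\<lambda>i. V $$ (i,0)) = (adj V * (A * V)) $$ (0,0)"
  using assms by (simp add: qform_def mult_mat_index sum_distrib_left mult.assoc)

lemma qform_congruence:
  assumes D: "D \<in> carrier_mat m n" and A: "A \<in> carrier_mat m m"
  shows "qform n (adj D * A * D) v = qform m A (\<lambda>i. \<Sum>j<n. D $$ (i,j) * v j)"
proof -
  define V where "V = mat n 1 (\<lambda>(i,_). v i)"
  have V: "V \<in> carrier_mat n 1" by (simp add: V_def)
  have "qform n (adj D * A * D) v = qform n (adj D * A * D) (\<lambda>i. V $$ (i,0))"
    by (simp add: qform_def V_def)
  also have "\<dots> = (adj V * ((adj D * A * D) * V)) $$ (0,0)"
    using assms V by (intro qform_column) auto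
  also have "adj V * ((adj D * A * D) * V) = adj (D * V) * (A * (D * V))"
    using assms V by (simp add: adj_mult mult_mat_assoc)
  also have "\<dots> $$ (0,0) = qform m A (\<lambda>i. (D * V) $$ (i,0))"
    using assms V by (intro qform_column[symmetric]) auto
  also have "\<dots> = qform m A (\<lambda>i. \<Sum>j<n. D $$ (i,j) * v j)"
    using D by (simp add: qform_def V_def mult_mat_index)
  finally show ?thesis .
qed

lemma psd_congruence:
  assumes D: "D \<in> carrier_mat m n" and A: "psd m A"
  shows "psd n (adj D * A * D)"
proof -
  have "hermitian n (adj D * A * D)"
    using D psd_hermitian[OF A] by (auto simp: hermitian_def adj_mult mult_mat_assoc)
  then show ?thesis
    using A by (simp add: psd_iff qform_congruence[OF D] hermitian_carrier)
qed

lemma psd_one: "psd n (1\<^sub>m n)"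
  by (auto simp: psd_iff hermitian_one qform_one intro: sum_nonneg)

lemma psd_adj_mult_self: "D \<in> carrier_mat m n \<Longrightarrow> psd n (adj D * D)"
  using psd_congruence[OF _ psd_one, of D m n] by simp

lemma psd_add: "psd n A \<Longrightarrow> psd n B \<Longrightarrow> psd n (A + B)"
  by (simp add: psd_iff qform_add hermitian_add hermitian_carrier)

lemma psd_smult: "psd n A \<Longrightarrow> 0 \<le> c \<Longrightarrow> psd n (complex_of_real c \<cdot>\<^sub>m A)"
  by (simp add: psd_iff qform_smult hermitian_smult hermitian_carrier)

lemma qform_two_points:
  assumes "i < n" "j < n" "i \<noteq> j"
  shows "qform n A (\<lambda>k. if k = i then x else if k = j then y else 0) =
    cnj x * A $$ (i,i) * x + cnj x * A $$ (i,j) * y + cnj y * A $$ (j,i) * x + cnj y * A $$ (j,j) * y"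
    (is "qform n A ?v = _")
proof -
  have supported: "(\<Sum>k<n. f k) = f i + f j" if "\<And>k. k \<noteq> i \<Longrightarrow> k \<noteq> j \<Longrightarrow> f k = 0" for f :: "nat \<Rightarrow> complex"
  proof -
    have "(\<Sum>k<n. f k) = (\<Sum>k\<in>{i,j}. f k)"
      using assms that by (intro sum.mono_neutral_right) auto
    then show ?thesis using assms(3) by simp
  qed
  have "qform n A ?v = (\<Sum>l<n. cnj (?v i) * A $$ (i,l) * ?v l) + (\<Sum>l<n. cnj (?v j) * A $$ (j,l) * ?v l)"
    unfolding qform_def by (rule supported) simp
  also have "\<dots> = (cnj (?v i) * A $$ (i,i) * ?v i + cnj (?v i) * A $$ (i,j) * ?v j)
      + (cnj (?v j) * A $$ (j,i) * ?v i + cnj (?v j) * A $$ (j,j) * ?v j)"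
    by (intro arg_cong2[where f = "(+)"] supported) auto
  finally show ?thesis using assms(3) by simp
qed

lemma qform_unit:
  assumes "i < n"
  shows "qform n A (\<lambda>k. if k = i then 1 else 0) = A $$ (i,i)"
proof -
  have "qform n A (\<lambda>k. if k = i then 1 else 0) =
    (\<Sum>k<n. \<Sum>l<n. if l = i then if k = i then A $$ (i,i) else 0 else 0)"
    unfolding qform_def by (intro sum.cong refl) auto
  then show ?thesis using assms by simp
qed

lemma psd_diag:
  assumes A: "psd n A" and "i < n"
  shows "0 \<le> Re (A $$ (i,i))" and "Im (A $$ (i,i)) = 0"
  using A qform_unit[OF \<open>i < n\<close>, of A] hermitian_index[OF psd_hermitian[OF A] \<open>i < n\<close> \<open>i < n\<close>]
  unfolding psd_iff by (metis, simp add: complex_eq_iff)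

lemma psd_mtrace: "psd n A \<Longrightarrow> 0 \<le> Re (mtrace A)"
  by (auto simp: mtrace_eq[OF psd_carrier] intro!: sum_nonneg psd_diag)

lemma psd_minor_nonneg:
  assumes A: "psd n A" and ij: "i < n" "j < n" "i \<noteq> j"
  shows "(cmod (A $$ (i,j)))\<^sup>2 \<le> Re (A $$ (i,i)) * Re (A $$ (j,j))"
proof -
  define p q r where "p = Re (A $$ (i,i))" and "q = A $$ (i,j)" and "r = Re (A $$ (j,j))"
  have entries: "A $$ (i,i) = of_real p" "A $$ (j,j) = of_real r" "A $$ (j,i) = cnj q"
    using psd_diag[OF A] hermitian_index[OF psd_hermitian[OF A]] ij
    by (simp_all add: p_def q_def r_def complex_eq_iff)
  have form: "0 \<le> p * (cmod x)\<^sup>2 + 2 * Re (cnj x * q * y) + r * (cmod y)\<^sup>2" for x y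
  proof -
    have "0 \<le> Re (qform n A (\<lambda>k. if k = i then x else if k = j then y else 0))"
      using A unfolding psd_iff by blast
    then show ?thesis
      unfolding qform_two_points[OF ij] entries q_def[symmetric]
      by (simp add: cmod_power2) (simp add: power2_eq_square algebra_simps)
  qed
  have qq: "Re (cnj q * q * z) = (cmod q)\<^sup>2 * Re z" for z
    by (simp add: cmod_power2) (simp add: power2_eq_square algebra_simps)
  have "0 \<le> p * (p * r - (cmod q)\<^sup>2)"
    using form[of "- q" "of_real p"] qq[of "of_real p"] by (simp add: power2_eq_square algebra_simps)
  moreover have "0 \<le> r * (p * r - (cmod q)\<^sup>2)"
    using form[of "of_real r" "- cnj q"] qq[of "of_real r"]
    by (simp add: power2_eq_square algebra_simps)
  moreover have "0 \<le> p" "0 \<le> r" using psd_diag[OF A] ij by (simp_all add: p_def r_def)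
  moreover have "q = 0" if "p = 0" "r = 0"
  proof -
    have "Re q * Re q + Im q * Im q \<le> 0" using form[of "- q" 1] that by simp
    then show ?thesis by (simp add: sum_squares_le_zero_iff complex_eq_iff)
  qed
  ultimately have "(cmod q)\<^sup>2 \<le> p * r"
    by (cases "p = 0"; cases "r = 0") (auto simp: zero_le_mult_iff mult_le_0_iff)
  then show ?thesis by (simp add: p_def q_def r_def)
qed

lemma psd_entry_le_mtrace:
  assumes A: "psd n A" and ij: "i < n" "j < n"
  shows "cmod (A $$ (i,j)) \<le> Re (mtrace A)"
proof -
  have diag: "Re (A $$ (k,k)) \<le> Re (mtrace A)" if "k < n" for k
    unfolding mtrace_eq[OF psd_carrier[OF A]] Re_sum
    by (rule member_le_sum) (use that psd_diag[OF A] in auto)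
  show ?thesis
  proof (cases "i = j")
    case True
    then show ?thesis using psd_diag[OF A ij(1)] diag[OF ij(1)] by (simp add: cmod_eq_Re)
  next
    case False
    have "(cmod (A $$ (i,j)))\<^sup>2 \<le> Re (A $$ (i,i)) * Re (A $$ (j,j))"
      by (rule psd_minor_nonneg[OF A ij False])
    also have "\<dots> \<le> (Re (mtrace A))\<^sup>2"
      unfolding power2_eq_square using psd_diag[OF A] psd_mtrace[OF A] diag ij by (intro mult_mono) auto
    finally show ?thesis by (rule power2_le_imp_le) (rule psd_mtrace[OF A])
  qed
qed

lemma psd_eq_zero_if_mtrace_zero: "psd n A \<Longrightarrow> Re (mtrace A) = 0 \<Longrightarrow> A = 0\<^sub>m n n"
  using psd_entry_le_mtrace[of n A] by (intro eq_zero_matI) (auto intro: psd_carrier)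

lemma hermitian_if_qform_real:
  assumes A: "A \<in> carrier_mat n n" and real: "\<And>v. Im (qform n A v) = 0"
  shows "hermitian n A"
proof -
  have diag: "Im (A $$ (i,i)) = 0" if "i < n" for i
    using real qform_unit[OF that, of A] by metis
  have "cnj (A $$ (i,j)) = A $$ (j,i)" if ij: "i < n" "j < n" for i j
  proof (cases "i = j")
    case True
    then show ?thesis using diag[OF ij(1)] by (simp add: complex_eq_iff)
  next
    case False
    have "Im (A $$ (i,j) + A $$ (j,i)) = 0"
      using real[of "\<lambda>k. if k = i then 1 else if k = j then 1 else 0"]
        qform_two_points[OF ij False, of A 1 1] diag[OF ij(1)] diag[OF ij(2)] by simp
    moreover have "Re (A $$ (i,j)) - Re (A $$ (j,i)) = 0"
      using real[of "\<lambda>k. if k = i then 1 else if k = j then \<i> else 0"]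
        qform_two_points[OF ij False, of A 1 \<i>] diag[OF ij(1)] diag[OF ij(2)] by simp
    ultimately show ?thesis by (auto simp: complex_eq_iff)
  qed
  then show ?thesis using A by (simp add: hermitian_iff)
qed

lemma hermitian_square_eq_zero:
  assumes D: "hermitian n D" and zero: "D * D = 0\<^sub>m n n"
  shows "D = 0\<^sub>m n n"
proof (rule eq_zero_matI)
  fix i j assume ij: "i < n" "j < n"
  have "0 = (D * D) $$ (i,i)" using ij zero by simp
  also have "\<dots> = (\<Sum>k<n. D $$ (i,k) * cnj (D $$ (i,k)))"
    using ij hermitian_carrier[OF D] by (simp add: mult_mat_index hermitian_index[OF D])
  also have "\<dots> = of_real (\<Sum>k<n. (cmod (D $$ (i,k)))\<^sup>2)"
    by (simp add: complex_norm_square del: of_real_power)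
  finally have "(\<Sum>k<n. (cmod (D $$ (i,k)))\<^sup>2) = 0" by (metis of_real_eq_0_iff)
  then show "D $$ (i,j) = 0" using ij by (simp add: sum_nonneg_eq_0_iff)
qed (rule hermitian_carrier[OF D])

text \<open>With \<open>D = A - B\<close>, the identity \<open>A\<^sup>2 = B\<^sup>2\<close> reads \<open>A D + D B = 0\<close>, so the nonnegative numbers
  \<open>tr (D A D)\<close> and \<open>tr (D B D)\<close> add up to zero; hence \<open>D A D = D B D = 0\<close> and \<open>D\<^sup>3 = 0\<close>.\<close>

lemma psd_sqrt_unique:
  assumes A: "psd n A" and B: "psd n B" and eq: "A * A = B * B"
  shows "A = B"
proof -
  define D where "D = A - B"
  have D: "hermitian n D" unfolding D_def by (intro hermitian_minus psd_hermitian A B)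
  note carrier = A[THEN psd_carrier] B[THEN psd_carrier] D[THEN hermitian_carrier]
  have adj_D: "adj D = D" using D by (simp add: hermitian_def)
  note distrib = mult_minus_distrib_mat[of _ n n _ n] minus_mult_distrib_mat[of _ n n _ _ n]
  have "A * D + D * B = (A * A - A * B) + (A * B - B * B)"
    using carrier by (simp add: D_def distrib)
  also have "\<dots> = 0\<^sub>m n n" unfolding eq using carrier by (intro eq_zero_matI) (auto simp: minus_carrier_mat)
  finally have zero: "A * D + D * B = 0\<^sub>m n n" .
  have "mtrace (D * A * D) + mtrace (D * B * D) = mtrace (D * (A * D)) + mtrace (D * (D * B))"
    using carrier mtrace_comm[of "D * B" n n D] by (simp add: mult_mat_assoc)
  also have "\<dots> = mtrace (D * (A * D + D * B))"
    using carrier by (simp add: mtrace_add[of _ n] mult_add_distrib_mat[of _ n n _ n])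
  finally have "mtrace (D * A * D) + mtrace (D * B * D) = 0" using carrier by (simp add: zero)
  moreover have psd: "psd n (D * A * D)" "psd n (D * B * D)"
    using psd_congruence[OF carrier(3) A] psd_congruence[OF carrier(3) B] unfolding adj_D .
  ultimately have "Re (mtrace (D * A * D)) = 0" "Re (mtrace (D * B * D)) = 0"
    using psd_mtrace[OF psd(1)] psd_mtrace[OF psd(2)]
    by (simp_all add: complex_eq_iff add_nonneg_eq_0_iff)
  then have "D * A * D = 0\<^sub>m n n" "D * B * D = 0\<^sub>m n n"
    using psd psd_eq_zero_if_mtrace_zero by blast+
  moreover have "D * D * D = D * A * D - D * B * D"
    using carrier by (subst (2) D_def) (simp add: distrib)
  ultimately have cube: "D * (D * D) = 0\<^sub>m n n" using carrier by (simp add: mult_mat_assoc)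
  have "hermitian n (D * D)" using carrier by (simp add: hermitian_def adj_mult adj_D)
  moreover have "(D * D) * (D * D) = 0\<^sub>m n n" using carrier by (simp add: mult_mat_assoc cube)
  ultimately have "D = 0\<^sub>m n n" using D hermitian_square_eq_zero by blast
  then show ?thesis using carrier by (intro eq_if_minus_mat_eq_zero[of A n n]) (simp_all add: D_def)
qed

definition entry_norm :: "nat \<Rightarrow> complex mat \<Rightarrow> real" where
  "entry_norm n A = (\<Sum>i<n. \<Sum>j<n. cmod (A $$ (i,j)))"

lemma entry_norm_nonneg: "0 \<le> entry_norm n A"
  by (simp add: entry_norm_def sum_nonneg)

lemma entry_le_entry_norm:
  assumes "i < n" "j < n"
  shows "cmod (A $$ (i,j)) \<le> entry_norm n A"
proof -
  have "cmod (A $$ (i,j)) \<le> (\<Sum>j<n. cmod (A $$ (i,j)))"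
    using assms by (intro member_le_sum) auto
  also have "\<dots> \<le> entry_norm n A"
    unfolding entry_norm_def using assms by (intro member_le_sum) (auto intro: sum_nonneg)
  finally show ?thesis .
qed

lemma entry_norm_smult: "A \<in> carrier_mat n n \<Longrightarrow> entry_norm n (c \<cdot>\<^sub>m A) = cmod c * entry_norm n A"
  by (simp add: entry_norm_def norm_mult sum_distrib_left)

lemma entry_norm_pos:
  assumes "A \<in> carrier_mat n n" "A \<noteq> 0\<^sub>m n n"
  shows "0 < entry_norm n A"
proof -
  obtain i j where "i < n" "j < n" "A $$ (i,j) \<noteq> 0" using assms eq_zero_matI by blast
  then show ?thesis using entry_le_entry_norm[of i n j A] by (meson less_le_trans zero_less_norm_iff)
qed

lemma norm_mult_le_sum_squares:
  fixes v :: "nat \<Rightarrow> complex"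
  assumes "i < n" "j < n"
  shows "cmod (v i) * cmod (v j) \<le> (\<Sum>k<n. (cmod (v k))\<^sup>2)"
proof -
  have single: "(cmod (v k))\<^sup>2 \<le> (\<Sum>k<n. (cmod (v k))\<^sup>2)" if "k < n" for k
    using that by (intro member_le_sum) auto
  have "2 * cmod (v i) * cmod (v j) \<le> (cmod (v i))\<^sup>2 + (cmod (v j))\<^sup>2"
    by (rule sum_squares_bound)
  then show ?thesis using single[OF assms(1)] single[OF assms(2)] by linarith
qed

lemma norm_qform_le: "cmod (qform n A v) \<le> entry_norm n A * (\<Sum>i<n. (cmod (v i))\<^sup>2)"
proof -
  have "cmod (qform n A v) \<le> (\<Sum>i<n. \<Sum>j<n. cmod (A $$ (i,j)) * (cmod (v i) * cmod (v j)))"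
    unfolding qform_def
    by (intro sum_norm_le order_trans[OF norm_sum]) (simp add: norm_mult sum_mono algebra_simps)
  also have "\<dots> \<le> (\<Sum>i<n. \<Sum>j<n. cmod (A $$ (i,j)) * (\<Sum>i<n. (cmod (v i))\<^sup>2))"
    by (intro sum_mono mult_left_mono norm_mult_le_sum_squares) auto
  finally show ?thesis by (simp add: entry_norm_def sum_distrib_right)
qed

lemma psd_add_smult_one:
  assumes X: "hermitian n X" and c: "entry_norm n X \<le> c"
  shows "psd n (X + complex_of_real c \<cdot>\<^sub>m 1\<^sub>m n)"
proof -
  have "0 \<le> Re (qform n (X + complex_of_real c \<cdot>\<^sub>m 1\<^sub>m n) v)" for v
  proof -
    have "- Re (qform n X v) \<le> cmod (qform n X v)" using abs_Re_le_cmod[of "qform n X v"] by linarith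
    also have "\<dots> \<le> entry_norm n X * (\<Sum>i<n. (cmod (v i))\<^sup>2)" by (rule norm_qform_le)
    also have "\<dots> \<le> c * (\<Sum>i<n. (cmod (v i))\<^sup>2)" using c by (intro mult_right_mono sum_nonneg) auto
    finally show ?thesis
      using hermitian_carrier[OF X] by (simp add: qform_add qform_smult qform_one del: of_real_sum)
  qed
  then show ?thesis
    using X by (simp add: psd_iff hermitian_add hermitian_smult hermitian_one)
qed

section \<open>Entrywise convergence\<close>

definition mat_tendsto :: "nat \<Rightarrow> ('a \<Rightarrow> complex mat) \<Rightarrow> complex mat \<Rightarrow> 'a filter \<Rightarrow> bool" where
  "mat_tendsto n X L F \<longleftrightarrow> (\<forall>i<n. \<forall>j<n. ((\<lambda>x. X x $$ (i,j)) \<longlongrightarrow> L $$ (i,j)) F)"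

lemma mat_tendsto_index: "mat_tendsto n X L F \<Longrightarrow> i < n \<Longrightarrow> j < n \<Longrightarrow> ((\<lambda>x. X x $$ (i,j)) \<longlongrightarrow> L $$ (i,j)) F"
  by (simp add: mat_tendsto_def)

lemma mat_tendsto_const: "mat_tendsto n (\<lambda>_. L) L F"
  by (simp add: mat_tendsto_def)

lemma mat_tendsto_unique:
  assumes "F \<noteq> bot" "L \<in> carrier_mat n n" "M \<in> carrier_mat n n" "mat_tendsto n X L F" "mat_tendsto n X M F"
  shows "L = M"
proof (rule eq_matI)
  fix i j assume "i < dim_row M" "j < dim_col M"
  then show "L $$ (i,j) = M $$ (i,j)"
    using assms tendsto_unique[OF assms(1)] mat_tendsto_index by (metis carrier_matD)
qed (use assms in auto)

lemma mat_tendsto_subseq: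
  "mat_tendsto n X L sequentially \<Longrightarrow> strict_mono r \<Longrightarrow> mat_tendsto n (\<lambda>k. X (r k)) L sequentially"
  unfolding mat_tendsto_def using LIMSEQ_subseq_LIMSEQ by (fastforce simp: o_def)

lemma mat_tendsto_adj:
  assumes "\<And>x. X x \<in> carrier_mat n n" "L \<in> carrier_mat n n" "mat_tendsto n X L F"
  shows "mat_tendsto n (\<lambda>x. adj (X x)) (adj L) F"
  using assms carrier_matD[OF assms(1)] by (auto simp: mat_tendsto_def intro: tendsto_cnj)

lemma mat_tendsto_mult:
  assumes "\<And>x. X x \<in> carrier_mat n n" "L \<in> carrier_mat n n" "\<And>x. Y x \<in> carrier_mat n n" "M \<in> carrier_mat n n"
    and "mat_tendsto n X L F" "mat_tendsto n Y M F"
  shows "mat_tendsto n (\<lambda>x. X x * Y x) (L * M) F"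
  using assms carrier_matD[OF assms(1)] carrier_matD[OF assms(3)]
  by (auto simp: mat_tendsto_def mult_mat_index intro!: tendsto_sum tendsto_mult)

lemma tendsto_mtrace:
  assumes "\<And>x. X x \<in> carrier_mat n n" "L \<in> carrier_mat n n" "mat_tendsto n X L F"
  shows "((\<lambda>x. mtrace (X x)) \<longlongrightarrow> mtrace L) F"
  unfolding mtrace_eq[OF assms(1)] mtrace_eq[OF assms(2)]
  by (intro tendsto_sum mat_tendsto_index[OF assms(3)]) auto

lemma tendsto_entry_norm: "mat_tendsto n X L F \<Longrightarrow> ((\<lambda>x. entry_norm n (X x)) \<longlongrightarrow> entry_norm n L) F"
  unfolding entry_norm_def by (intro tendsto_sum tendsto_norm) (auto intro: mat_tendsto_index)

lemma tendsto_qform: "mat_tendsto n X L F \<Longrightarrow> ((\<lambda>x. qform n (X x) v) \<longlongrightarrow> qform n L v) F"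
  unfolding qform_def by (intro tendsto_sum tendsto_mult tendsto_const) (auto intro: mat_tendsto_index)

lemma hermitian_limit:
  assumes "F \<noteq> bot" "\<And>x. hermitian n (X x)" "L \<in> carrier_mat n n" "mat_tendsto n X L F"
  shows "hermitian n L"
proof -
  have "mat_tendsto n (\<lambda>x. adj (X x)) (adj L) F"
    by (intro mat_tendsto_adj assms hermitian_carrier)
  then have "adj L = L"
    using assms by (intro mat_tendsto_unique[OF assms(1)]) (auto simp: hermitian_def)
  then show ?thesis using assms(3) by (simp add: hermitian_def)
qed

lemma psd_limit:
  assumes "F \<noteq> bot" "\<And>x. psd n (X x)" "L \<in> carrier_mat n n" "mat_tendsto n X L F"
  shows "psd n L"
  unfolding psd_iff
proof (intro conjI allI)
  show "hermitian n L" using assms psd_hermitian by (blast intro: hermitian_limit)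
  show "0 \<le> Re (qform n L v)" for v
    by (rule tendsto_lowerbound[OF tendsto_Re[OF tendsto_qform[OF assms(4)]] _ assms(1)])
      (use assms(2) in \<open>simp add: psd_iff\<close>)
qed

lemma finite_family_convergent_subsequence:
  fixes f :: "nat \<Rightarrow> 'i \<Rightarrow> 'a::heine_borel"
  assumes "finite I" "\<And>i. i \<in> I \<Longrightarrow> bounded (range (\<lambda>n. f n i))"
  shows "\<exists>r l. strict_mono r \<and> (\<forall>i\<in>I. (\<lambda>n. f (r n) i) \<longlonglongrightarrow> l i)"
  using assms
proof (induction I rule: finite_induct)
  case empty
  then show ?case by (auto intro: exI[of _ id] strict_mono_id)
next
  case (insert x I)
  then obtain r l where r: "strict_mono r" "\<forall>i\<in>I. (\<lambda>n. f (r n) i) \<longlonglongrightarrow> l i" by auto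
  have "bounded (range (\<lambda>n. f (r n) x))"
    using insert.prems by (rule bounded_subset) auto
  then obtain q a where q: "strict_mono q" "(\<lambda>n. f (r (q n)) x) \<longlonglongrightarrow> a"
    using bounded_imp_convergent_subsequence by (fastforce simp: o_def)
  have "strict_mono (r \<circ> q)" using r q by (simp add: strict_mono_o)
  moreover have "(\<lambda>n. f ((r \<circ> q) n) i) \<longlonglongrightarrow> (l(x := a)) i" if "i \<in> insert x I" for i
    using that q r(2) LIMSEQ_subseq_LIMSEQ[of "\<lambda>n. f (r n) i" "l i" q] by (auto simp: o_def)
  ultimately show ?case by blast
qed

lemma bounded_mat_convergent_subsequence:
  assumes "\<And>k i j. i < n \<Longrightarrow> j < n \<Longrightarrow> cmod (X k $$ (i,j)) \<le> C"
  obtains r L where "strict_mono (r :: nat \<Rightarrow> nat)" "L \<in> carrier_mat n n"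
    "mat_tendsto n (\<lambda>k. X (r k)) L sequentially"
proof -
  have "bounded (range (\<lambda>k. X k $$ p))" if "p \<in> {..<n} \<times> {..<n}" for p
    using that assms by (intro boundedI[of _ C]) auto
  then obtain r l where r: "strict_mono r" "\<forall>p\<in>{..<n} \<times> {..<n}. (\<lambda>k. X (r k) $$ p) \<longlonglongrightarrow> l p"
    using finite_family_convergent_subsequence[of "{..<n} \<times> {..<n}" "\<lambda>k p. X k $$ p"] by auto
  then have "mat_tendsto n (\<lambda>k. X (r k)) (mat n n l) sequentially" by (simp add: mat_tendsto_def)
  then show ?thesis by (rule that[OF r(1), rotated]) simp
qed

section \<open>The trace norm as a maximum over unitaries\<close>

definition unitary :: "nat \<Rightarrow> complex mat \<Rightarrow> bool" where
  "unitary n U \<longleftrightarrow> U \<in> carrier_mat n n \<and> adj U * U = 1\<^sub>m n"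

lemma unitary_carrier: "unitary n U \<Longrightarrow> U \<in> carrier_mat n n"
  by (simp add: unitary_def)

lemma unitary_mult_adj: "unitary n U \<Longrightarrow> U * adj U = 1\<^sub>m n"
  using mat_mult_left_right_inverse[of "adj U" n U] by (simp add: unitary_def)

lemma unitary_one: "unitary n (1\<^sub>m n)"
  by (simp add: unitary_def)

lemma unitary_mult: "unitary n U \<Longrightarrow> unitary n V \<Longrightarrow> unitary n (U * V)"
  unfolding unitary_def
  by (auto simp: adj_mult mult_mat_assoc) (metis adj_carrier carrier_matD left_mult_one_mat mult_mat_assoc)

lemma norm_unitary_entry_le_one:
  assumes U: "unitary n U" and ij: "i < n" "j < n"
  shows "cmod (U $$ (i,j)) \<le> 1"
proof -
  have "of_real (\<Sum>k<n. (cmod (U $$ (k,j)))\<^sup>2) = (adj U * U) $$ (j,j)"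
    using unitary_carrier[OF U] ij
    by (simp add: mult_mat_index complex_norm_square mult.commute del: of_real_power)
  also have "\<dots> = of_real 1" using U ij by (simp add: unitary_def)
  finally have "(\<Sum>k<n. (cmod (U $$ (k,j)))\<^sup>2) = 1" by (simp only: of_real_eq_iff)
  then have "(cmod (U $$ (i,j)))\<^sup>2 \<le> 1\<^sup>2"
    using member_le_sum[of i "{..<n}" "\<lambda>k. (cmod (U $$ (k,j)))\<^sup>2"] ij by auto
  then show ?thesis by (rule power2_le_imp_le) simp
qed

lemma unitary_limit:
  assumes "F \<noteq> bot" "\<And>x. unitary n (X x)" "L \<in> carrier_mat n n" "mat_tendsto n X L F"
  shows "unitary n L"
proof -
  have "mat_tendsto n (\<lambda>x. adj (X x) * X x) (adj L * L) F"
    by (intro mat_tendsto_mult mat_tendsto_adj) (simp_all add: assms unitary_carrier)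
  then have "adj L * L = 1\<^sub>m n"
    using assms by (intro mat_tendsto_unique[OF assms(1)]) (auto simp: unitary_def mat_tendsto_const)
  then show ?thesis using assms(3) by (simp add: unitary_def)
qed

lemma adj_outer_prod: "adj (outer_prod n v w) = outer_prod n w v"
  by (rule eq_matI) (auto simp: outer_prod_def mult.commute)

lemma outer_prod_mult:
  "outer_prod n u v * outer_prod n w x = (\<Sum>k<n. cnj (v k) * w k) \<cdot>\<^sub>m outer_prod n u x"
  by (rule eq_matI)
    (auto simp: outer_prod_def mult_mat_index sum_distrib_left sum_distrib_right intro!: sum.cong)

lemma mtrace_outer_prod_mult: "S \<in> carrier_mat n n \<Longrightarrow> mtrace (outer_prod n v v * S) = qform n S v"
  unfolding mtrace_mult[OF outer_prod_carrier] qform_def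
  by (subst sum.swap) (auto intro!: sum.cong simp: algebra_simps)

lemma unitary_one_minus_outer_prod:
  assumes c: "cnj c * c * (\<Sum>k<n. cnj (v k) * v k) = c + cnj c"
  shows "unitary n (1\<^sub>m n - c \<cdot>\<^sub>m outer_prod n v v)" (is "unitary n ?U")
proof -
  define P where "P = outer_prod n v v"
  have P: "P \<in> carrier_mat n n" by (simp add: P_def)
  have "adj ?U * ?U = (1\<^sub>m n - cnj c \<cdot>\<^sub>m P) * (1\<^sub>m n - c \<cdot>\<^sub>m P)"
    by (simp add: P_def adj_minus[of _ n n] adj_smult adj_outer_prod)
  also have "\<dots> = (1\<^sub>m n - cnj c \<cdot>\<^sub>m P) - c \<cdot>\<^sub>m (P - cnj c \<cdot>\<^sub>m (P * P))"
    using P by (simp add: minus_mult_distrib_mat[of _ n n _ _ n] mult_minus_distrib_mat[of _ n n _ n]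
        mult_smult_distrib[of _ n n _ n] mult_smult_assoc_mat[of _ n n _ n] minus_carrier_mat)
  also have "P * P = (\<Sum>k<n. cnj (v k) * v k) \<cdot>\<^sub>m P" by (simp add: P_def outer_prod_mult)
  also have "(1\<^sub>m n - cnj c \<cdot>\<^sub>m P) - c \<cdot>\<^sub>m (P - cnj c \<cdot>\<^sub>m ((\<Sum>k<n. cnj (v k) * v k) \<cdot>\<^sub>m P))
      = 1\<^sub>m n - (c + cnj c - cnj c * c * (\<Sum>k<n. cnj (v k) * v k)) \<cdot>\<^sub>m P"
    using P by (intro eq_matI) (auto simp: algebra_simps)
  also have "\<dots> = 1\<^sub>m n" unfolding c using P by (intro eq_matI) auto
  finally show ?thesis by (simp add: unitary_def minus_carrier_mat)
qed

text \<open>It suffices to test with the unitaries \<open>1 - (1 - z) v v\<^sup>* / \<parallel>v\<parallel>\<^sup>2\<close>, where \<open>z\<close> has modulus one.\<close>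

lemma psd_if_mtrace_unitary_mult_le:
  assumes S: "S \<in> carrier_mat n n"
    and le: "\<And>V. unitary n V \<Longrightarrow> Re (mtrace (V * S)) \<le> Re (mtrace S)"
  shows "psd n S"
proof -
  have norm_le: "cmod (qform n S v) \<le> Re (qform n S v)" for v
  proof (cases "qform n S v = 0")
    case False
    define q where "q = qform n S v"
    define N where "N = (\<Sum>i<n. (cmod (v i))\<^sup>2)"
    have "0 \<le> N" by (simp add: N_def sum_nonneg)
    moreover have "N \<noteq> 0" using False norm_qform_le[of n S v] by (auto simp: N_def)
    ultimately have "0 < N" by simp
    have N_eq: "(\<Sum>k<n. cnj (v k) * v k) = of_real N"
      by (simp add: N_def complex_norm_square mult.commute del: of_real_power)
    define z where "z = cnj q / of_real (cmod q)"
    define c where "c = (1 - z) / of_real N"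
    have zz: "cnj z * z = 1" and zq: "z * q = of_real (cmod q)"
      using False complex_norm_square[of q]
      by (simp_all add: z_def q_def field_simps power2_eq_square)
    have "cnj c * c * of_real N = (cnj (1 - z) * (1 - z)) / of_real N"
      using \<open>0 < N\<close> by (simp add: c_def)
    also have "cnj (1 - z) * (1 - z) = (1 - z) + cnj (1 - z)" using zz by (simp add: algebra_simps)
    finally have U: "unitary n (1\<^sub>m n - c \<cdot>\<^sub>m outer_prod n v v)"
      by (intro unitary_one_minus_outer_prod) (simp add: N_eq c_def add_divide_distrib diff_divide_distrib)
    have "(1\<^sub>m n - c \<cdot>\<^sub>m outer_prod n v v) * S = S - c \<cdot>\<^sub>m (outer_prod n v v * S)"
      using S by (simp add: minus_mult_distrib_mat[of _ n n _ _ n] mult_smult_assoc_mat[of _ n n _ n])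
    then have "mtrace ((1\<^sub>m n - c \<cdot>\<^sub>m outer_prod n v v) * S) = mtrace S - c * q"
      using S by (simp add: mtrace_minus[of _ n] mtrace_smult[of _ n] mtrace_outer_prod_mult q_def)
    with le[OF U] have "0 \<le> Re (c * q)" by simp
    moreover have "c * q = (q - of_real (cmod q)) / of_real N"
      by (simp add: c_def zq left_diff_distrib)
    ultimately have "0 \<le> (Re q - cmod q) / N" by (simp add: Re_divide_of_real)
    then show ?thesis using \<open>0 < N\<close> by (simp add: q_def zero_le_divide_iff)
  qed simp
  have "Re (qform n S v) = cmod (qform n S v)" for v
    using norm_le[of v] complex_Re_le_cmod[of "qform n S v"] by simp
  then have "Im (qform n S v) = 0 \<and> 0 \<le> Re (qform n S v)" for v
    using cmod_power2[of "qform n S v"] norm_ge_zero[of "qform n S v"] by simp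
  then show ?thesis using S by (simp add: psd_iff hermitian_if_qform_real)
qed

lemma trace_norm_eqI:
  assumes X: "X \<in> carrier_mat n n" and S: "psd n S" and eq: "S * S = adj X * X"
  shows "trace_norm X = Re (mtrace S)"
proof -
  have "(THE S. psd (dim_col X) S \<and> S * S = adj X * X) = S"
    using X S eq psd_sqrt_unique[of n] by (intro the_equality) auto
  then show ?thesis by (simp add: trace_norm_def)
qed

lemma Re_mtrace_unitary_mult_le:
  assumes U: "unitary n U" and X: "X \<in> carrier_mat n n"
  shows "Re (mtrace (U * X)) \<le> entry_norm n X"
proof -
  have "Re (mtrace (U * X)) \<le> cmod (mtrace (U * X))" by (rule complex_Re_le_cmod)
  also have "\<dots> \<le> (\<Sum>i<n. \<Sum>j<n. cmod (X $$ (j,i)))"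
    unfolding mtrace_mult[OF unitary_carrier[OF U] X]
    using norm_unitary_entry_le_one[OF U]
    by (intro sum_norm_le) (auto simp: norm_mult intro!: mult_left_le_one_le)
  also have "\<dots> = entry_norm n X" unfolding entry_norm_def by (rule sum.swap)
  finally show ?thesis .
qed

lemma mtrace_unitary_mult_attains_max:
  assumes X: "X \<in> carrier_mat n n"
  obtains U where "unitary n U" "\<And>V. unitary n V \<Longrightarrow> Re (mtrace (V * X)) \<le> Re (mtrace (U * X))"
proof -
  define T where "T = (\<lambda>U. Re (mtrace (U * X))) ` {U. unitary n U}"
  have T: "T \<noteq> {}" "bdd_above T"
    using unitary_one Re_mtrace_unitary_mult_le[OF _ X] by (auto simp: T_def bdd_above_def)
  have "\<exists>U. unitary n U \<and> Sup T - inverse (real (Suc k)) < Re (mtrace (U * X))" for k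
    using less_cSup_iff[OF T, of "Sup T - inverse (real (Suc k))"] by (auto simp: T_def)
  then obtain W where W: "\<And>k. unitary n (W k)" "\<And>k. Sup T - inverse (real (Suc k)) < Re (mtrace (W k * X))"
    by metis
  obtain r U where r: "strict_mono r" and U: "U \<in> carrier_mat n n"
    and lim: "mat_tendsto n (\<lambda>k. W (r k)) U sequentially"
    using bounded_mat_convergent_subsequence[of n W 1] norm_unitary_entry_le_one[OF W(1)] by blast
  have "(\<lambda>k. Re (mtrace (W (r k) * X))) \<longlonglongrightarrow> Re (mtrace (U * X))"
    by (intro tendsto_Re tendsto_mtrace[of _ n] mat_tendsto_mult mat_tendsto_const)
      (simp_all add: W(1) U X lim unitary_carrier)
  moreover have "(\<lambda>k. Sup T - inverse (real (Suc (r k)))) \<longlonglongrightarrow> Sup T - 0"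
    using LIMSEQ_subseq_LIMSEQ[OF LIMSEQ_inverse_real_of_nat r]
    by (intro tendsto_diff tendsto_const) (simp add: o_def)
  ultimately have "Sup T \<le> Re (mtrace (U * X))"
    using W(2) LIMSEQ_le[of "\<lambda>k. Sup T - inverse (real (Suc (r k)))" "Sup T"] by (fastforce intro: less_imp_le)
  moreover have "Re (mtrace (V * X)) \<le> Sup T" if "unitary n V" for V
    using that T(2) by (auto simp: T_def intro: cSup_upper)
  moreover have "unitary n U" by (rule unitary_limit[OF _ W(1) U lim]) simp
  ultimately show ?thesis using that order_trans by blast
qed

lemma trace_norm_attained:
  assumes X: "X \<in> carrier_mat n n"
  obtains U where "unitary n U" "psd n (U * X)" "trace_norm X = Re (mtrace (U * X))"
    "(U * X) * (U * X) = adj X * X"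
    "\<And>V. unitary n V \<Longrightarrow> Re (mtrace (V * X)) \<le> trace_norm X"
proof -
  obtain U where U: "unitary n U"
    and max: "\<And>V. unitary n V \<Longrightarrow> Re (mtrace (V * X)) \<le> Re (mtrace (U * X))"
    using mtrace_unitary_mult_attains_max[OF X] by blast
  note carrier = unitary_carrier[OF U] X
  have psd: "psd n (U * X)"
  proof (rule psd_if_mtrace_unitary_mult_le)
    show "Re (mtrace (V * (U * X))) \<le> Re (mtrace (U * X))" if "unitary n V" for V
      using max[OF unitary_mult[OF that U]] unitary_carrier[OF that] carrier
      by (simp add: mult_mat_assoc)
  qed (use carrier in simp)
  have "(U * X) * (U * X) = adj (U * X) * (U * X)" using psd by (simp add: psd_def)
  also have "\<dots> = adj X * (adj U * U) * X" using carrier by (simp add: adj_mult mult_mat_assoc)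
  also have "\<dots> = adj X * X" using U X by (simp add: unitary_def)
  finally have square: "(U * X) * (U * X) = adj X * X" .
  then have "trace_norm X = Re (mtrace (U * X))" by (rule trace_norm_eqI[OF X psd])
  then show ?thesis using that U psd square max by metis
qed

lemma mtrace_unitary_mult_le_trace_norm:
  "X \<in> carrier_mat n n \<Longrightarrow> unitary n V \<Longrightarrow> Re (mtrace (V * X)) \<le> trace_norm X"
  by (metis trace_norm_attained)

lemma trace_norm_nonneg: "X \<in> carrier_mat n n \<Longrightarrow> 0 \<le> trace_norm X"
  by (metis trace_norm_attained psd_mtrace)

lemma trace_norm_le_entry_norm: "X \<in> carrier_mat n n \<Longrightarrow> trace_norm X \<le> entry_norm n X"
  by (metis trace_norm_attained Re_mtrace_unitary_mult_le)

lemma trace_norm_zero_mat: "trace_norm (0\<^sub>m n n) = 0"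
  using trace_norm_le_entry_norm[of "0\<^sub>m n n" n] trace_norm_nonneg[of "0\<^sub>m n n" n]
  by (simp add: entry_norm_def)

lemma eq_zero_if_trace_norm_le_zero:
  assumes X: "X \<in> carrier_mat n n" and le: "trace_norm X \<le> 0"
  shows "X = 0\<^sub>m n n"
proof -
  obtain U where U: "unitary n U" "psd n (U * X)" "trace_norm X = Re (mtrace (U * X))"
    using trace_norm_attained[OF X] by metis
  then have "U * X = 0\<^sub>m n n" using le psd_mtrace psd_eq_zero_if_mtrace_zero by fastforce
  moreover have "X = adj U * U * X" using U(1) X by (simp add: unitary_def)
  moreover have "adj U * U * X = adj U * (U * X)"
    using unitary_carrier[OF U(1)] X by (intro mult_mat_assoc) auto
  ultimately show ?thesis using unitary_carrier[OF U(1)] by simp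
qed

lemma trace_norm_triangle:
  assumes "X \<in> carrier_mat n n" "Y \<in> carrier_mat n n"
  shows "trace_norm (X + Y) \<le> trace_norm X + trace_norm Y"
proof -
  obtain U where U: "unitary n U" and eq: "trace_norm (X + Y) = Re (mtrace (U * (X + Y)))"
    using trace_norm_attained[of "X + Y" n] assms by auto
  note eq
  also have "mtrace (U * (X + Y)) = mtrace (U * X) + mtrace (U * Y)"
    using assms unitary_carrier[OF U] by (simp add: mult_add_distrib_mat[of _ n n _ n] mtrace_add[of _ n])
  finally show ?thesis using assms[THEN mtrace_unitary_mult_le_trace_norm, OF U] by simp
qed

lemma trace_norm_smult:
  assumes X: "X \<in> carrier_mat n n" and c: "0 \<le> c"
  shows "trace_norm (complex_of_real c \<cdot>\<^sub>m X) = c * trace_norm X"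
proof -
  obtain U where U: "unitary n U" "psd n (U * X)" "trace_norm X = Re (mtrace (U * X))"
    "(U * X) * (U * X) = adj X * X"
    using trace_norm_attained[OF X] by metis
  note carrier = unitary_carrier[OF U(1)] X
  have "trace_norm (complex_of_real c \<cdot>\<^sub>m X) = Re (mtrace (complex_of_real c \<cdot>\<^sub>m (U * X)))"
  proof (rule trace_norm_eqI)
    show "complex_of_real c \<cdot>\<^sub>m (U * X) * (complex_of_real c \<cdot>\<^sub>m (U * X)) =
        adj (complex_of_real c \<cdot>\<^sub>m X) * (complex_of_real c \<cdot>\<^sub>m X)"
      using carrier U(4)
      by (simp add: adj_smult mult_smult_distrib[of _ n n _ n] mult_smult_assoc_mat[of _ n n _ n])
  qed (use X U(2) c in \<open>auto intro: psd_smult\<close>)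
  then show ?thesis using carrier U(3) by (simp add: mtrace_smult[of _ n])
qed

lemma trace_norm_diff_le:
  assumes "X \<in> carrier_mat n n" "Y \<in> carrier_mat n n"
  shows "trace_norm X - trace_norm Y \<le> entry_norm n (X - Y)"
proof -
  have "X = Y + (X - Y)" using assms by (intro eq_matI) auto
  then have "trace_norm X \<le> trace_norm Y + trace_norm (X - Y)"
    using assms trace_norm_triangle[of Y n "X - Y"] by (metis minus_carrier_mat)
  then show ?thesis using trace_norm_le_entry_norm[of "X - Y" n] assms by (simp add: minus_carrier_mat)
qed

lemma trace_norm_lipschitz:
  assumes "X \<in> carrier_mat n n" "Y \<in> carrier_mat n n"
  shows "\<bar>trace_norm X - trace_norm Y\<bar> \<le> entry_norm n (X - Y)"
proof -
  have "entry_norm n (Y - X) = entry_norm n (X - Y)"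
    using assms by (simp add: entry_norm_def norm_minus_commute)
  then show ?thesis using trace_norm_diff_le[OF assms] trace_norm_diff_le[OF assms(2,1)] by simp
qed

lemma tendsto_trace_norm:
  assumes "\<And>x. X x \<in> carrier_mat n n" "L \<in> carrier_mat n n" "mat_tendsto n X L F"
  shows "((\<lambda>x. trace_norm (X x)) \<longlongrightarrow> trace_norm L) F"
proof -
  have "mat_tendsto n (\<lambda>x. X x - L) (0\<^sub>m n n) F"
    using assms tendsto_diff[OF mat_tendsto_index[OF assms(3)] tendsto_const]
    by (auto simp: mat_tendsto_def LIM_zero)
  then have "((\<lambda>x. entry_norm n (X x - L)) \<longlongrightarrow> 0) F"
    using tendsto_entry_norm[of n _ "0\<^sub>m n n"] by (simp add: entry_norm_def)
  then have "((\<lambda>x. trace_norm (X x) - trace_norm L) \<longlongrightarrow> 0) F"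
    by (rule Lim_null_comparison[rotated]) (simp add: trace_norm_lipschitz[OF assms(1,2)])
  then show ?thesis by (simp add: LIM_zero_iff)
qed

lemma trace_norm_psd: "psd n X \<Longrightarrow> trace_norm X = Re (mtrace X)"
  by (rule trace_norm_eqI[of X n]) (auto simp: psd_def)

lemma psd_if_trace_norm_le_mtrace:
  assumes X: "X \<in> carrier_mat n n" and le: "trace_norm X \<le> Re (mtrace X)"
  shows "psd n X"
  using mtrace_unitary_mult_le_trace_norm[OF X] le
  by (intro psd_if_mtrace_unitary_mult_le[OF X]) (meson order_trans)

section \<open>Kronecker products\<close>

lemma pair_index_less:
  fixes x k :: nat
  assumes "x < d" "k < m"
  shows "x * m + k < d * m"
proof -
  have "x * m + k < Suc x * m" using assms(2) by simp
  also have "\<dots> \<le> d * m" using assms(1) by (intro mult_le_mono1) simp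
  finally show ?thesis .
qed

lemma div_index_less: "i < d * m \<Longrightarrow> i div m < (d::nat)"
  by (simp add: less_mult_imp_div_less)

lemma mod_index_less: "i < d * m \<Longrightarrow> i mod m < (m::nat)"
  by (cases "m = 0") auto

lemma sum_pair_index: "(\<Sum>i<d*m. f i) = (\<Sum>x<d. \<Sum>k<m. f (x*m + k))"
  for f :: "nat \<Rightarrow> 'a::comm_monoid_add"
proof -
  have "sum f {x*m..<x*m + m} = (\<Sum>k<m. f (x*m + k))" for x
    using sum.shift_bounds_nat_ivl[of f 0 "x*m" m] by (simp add: atLeast0LessThan add.commute)
  then show ?thesis by (simp add: sum.nat_group[symmetric])
qed

definition kron :: "complex mat \<Rightarrow> complex mat \<Rightarrow> complex mat" where
  "kron A B = mat (dim_row A * dim_row B) (dim_col A * dim_col B)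
     (\<lambda>(i,j). A $$ (i div dim_row B, j div dim_col B) * B $$ (i mod dim_row B, j mod dim_col B))"

lemma kron_carrier [simp]:
  "A \<in> carrier_mat a b \<Longrightarrow> B \<in> carrier_mat p q \<Longrightarrow> kron A B \<in> carrier_mat (a*p) (b*q)"
  by (auto simp: kron_def)

lemma kron_dim [simp]:
  "dim_row (kron A B) = dim_row A * dim_row B" "dim_col (kron A B) = dim_col A * dim_col B"
  by (simp_all add: kron_def)

lemma kron_index [simp]:
  "i < dim_row A * dim_row B \<Longrightarrow> j < dim_col A * dim_col B \<Longrightarrow>
    kron A B $$ (i,j) = A $$ (i div dim_row B, j div dim_col B) * B $$ (i mod dim_row B, j mod dim_col B)"
  by (simp add: kron_def)

lemma kron_add_left:
  "A \<in> carrier_mat a b \<Longrightarrow> B \<in> carrier_mat a b \<Longrightarrow> kron (A + B) C = kron A C + kron B C"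
  by (rule eq_matI) (auto simp: div_index_less algebra_simps)

lemma kron_minus_left:
  "A \<in> carrier_mat a b \<Longrightarrow> B \<in> carrier_mat a b \<Longrightarrow> kron (A - B) C = kron A C - kron B C"
  by (rule eq_matI) (auto simp: div_index_less algebra_simps)

lemma kron_add_right:
  "B \<in> carrier_mat p q \<Longrightarrow> C \<in> carrier_mat p q \<Longrightarrow> kron A (B + C) = kron A B + kron A C"
  by (rule eq_matI) (auto simp: mod_index_less algebra_simps)

lemma kron_minus_right:
  "B \<in> carrier_mat p q \<Longrightarrow> C \<in> carrier_mat p q \<Longrightarrow> kron A (B - C) = kron A B - kron A C"
  by (rule eq_matI) (auto simp: mod_index_less algebra_simps)

lemma kron_one_left: "kron (1\<^sub>m 1) A = A"
  by (rule eq_matI) auto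

lemma kron_one_right: "kron A (1\<^sub>m 1) = A"
  by (rule eq_matI) auto

lemma adj_kron: "adj (kron A B) = kron (adj A) (adj B)"
  by (rule eq_matI) (auto simp: div_index_less mod_index_less)

lemma kron_mult:
  assumes "dim_col A = dim_row C" "dim_col B = dim_row D"
  shows "kron A B * kron C D = kron (A * C) (B * D)"
proof (rule eq_matI)
  fix i j assume "i < dim_row (kron (A * C) (B * D))" "j < dim_col (kron (A * C) (B * D))"
  then have ij: "i < dim_row A * dim_row B" "j < dim_col C * dim_col D" by auto
  have "(kron A B * kron C D) $$ (i,j) =
      (\<Sum>x<dim_row C. \<Sum>k<dim_row D. kron A B $$ (i, x * dim_row D + k) * kron C D $$ (x * dim_row D + k, j))"
    using ij assms by (simp only: mult_mat_index kron_dim sum_pair_index)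
  also have "\<dots> = (\<Sum>x<dim_row C. \<Sum>k<dim_row D.
      (A $$ (i div dim_row B, x) * C $$ (x, j div dim_col D)) *
      (B $$ (i mod dim_row B, k) * D $$ (k, j mod dim_col D)))"
    using ij assms by (intro sum.cong refl) (simp add: pair_index_less)
  also have "\<dots> = kron (A * C) (B * D) $$ (i,j)"
    using ij assms by (simp add: mult_mat_index div_index_less mod_index_less sum_product)
  finally show "(kron A B * kron C D) $$ (i,j) = kron (A * C) (B * D) $$ (i,j)" .
qed auto

lemma mtrace_kron:
  "A \<in> carrier_mat m m \<Longrightarrow> B \<in> carrier_mat n n \<Longrightarrow> mtrace (kron A B) = mtrace A * mtrace B"
  by (simp add: mtrace_def sum_pair_index pair_index_less sum_product)

lemma psd_kron_outer_prod:
  assumes A: "psd m A"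
  shows "psd (m*n) (kron A (outer_prod n w w))"
proof -
  note carrier = psd_carrier[OF A]
  define W where "W = kron (1\<^sub>m m) (mat 1 n (\<lambda>(_,p). cnj (w p)))"
  have W: "W \<in> carrier_mat m (m*n)"
    using kron_carrier[of "1\<^sub>m m" m m "mat 1 n (\<lambda>(_,p). cnj (w p))" 1 n] by (simp add: W_def)
  have "adj W * kron A (1\<^sub>m 1) * W =
      kron A (adj (mat 1 n (\<lambda>(_,p). cnj (w p))) * mat 1 n (\<lambda>(_,p). cnj (w p)))"
    using carrier by (simp add: W_def adj_kron kron_mult)
  also have "adj (mat 1 n (\<lambda>(_,p). cnj (w p))) * mat 1 n (\<lambda>(_,p). cnj (w p)) = outer_prod n w w"
    by (rule eq_matI) (auto simp: mult_mat_index outer_prod_def)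
  finally show ?thesis using psd_congruence[OF W A] unfolding kron_one_right by simp
qed

section \<open>Linear maps on matrices and their amplifications\<close>

lemma linear_map_on_carrier: "linear_map_on d \<Phi> \<Longrightarrow> X \<in> carrier_mat d d \<Longrightarrow> \<Phi> X \<in> carrier_mat d d"
  by (simp add: linear_map_on_def)

lemma linear_map_on_add:
  "linear_map_on d \<Phi> \<Longrightarrow> X \<in> carrier_mat d d \<Longrightarrow> Y \<in> carrier_mat d d \<Longrightarrow> \<Phi> (X + Y) = \<Phi> X + \<Phi> Y"
  by (simp add: linear_map_on_def)

lemma linear_map_on_smult: "linear_map_on d \<Phi> \<Longrightarrow> X \<in> carrier_mat d d \<Longrightarrow> \<Phi> (c \<cdot>\<^sub>m X) = c \<cdot>\<^sub>m \<Phi> X"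
  by (simp add: linear_map_on_def)

lemma linear_map_on_add_smult:
  "linear_map_on d \<Phi> \<Longrightarrow> X \<in> carrier_mat d d \<Longrightarrow> Y \<in> carrier_mat d d \<Longrightarrow> \<Phi> (X + c \<cdot>\<^sub>m Y) = \<Phi> X + c \<cdot>\<^sub>m \<Phi> Y"
  by (simp add: linear_map_on_add linear_map_on_smult)

lemma linear_map_on_lincomb:
  "linear_map_on d \<Phi> \<Longrightarrow> X \<in> carrier_mat d d \<Longrightarrow> Y \<in> carrier_mat d d \<Longrightarrow>
    \<Phi> (a \<cdot>\<^sub>m X + b \<cdot>\<^sub>m Y) = a \<cdot>\<^sub>m \<Phi> X + b \<cdot>\<^sub>m \<Phi> Y"
  by (simp add: linear_map_on_add linear_map_on_smult)

lemma linear_map_on_minus: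
  assumes L: "linear_map_on d \<Phi>" and X: "X \<in> carrier_mat d d" and Y: "Y \<in> carrier_mat d d"
  shows "\<Phi> (X - Y) = \<Phi> X - \<Phi> Y"
proof -
  have "X - Y = X + (-1) \<cdot>\<^sub>m Y" using X Y by (intro eq_matI) auto
  then have "\<Phi> (X - Y) = \<Phi> X + (-1) \<cdot>\<^sub>m \<Phi> Y"
    using X Y by (simp add: linear_map_on_add[OF L] linear_map_on_smult[OF L])
  also have "\<dots> = \<Phi> X - \<Phi> Y"
    using linear_map_on_carrier[OF L X] linear_map_on_carrier[OF L Y] by (intro eq_matI) auto
  finally show ?thesis .
qed

lemma linear_map_on_zero:
  assumes L: "linear_map_on d \<Phi>"
  shows "\<Phi> (0\<^sub>m d d) = 0\<^sub>m d d"
  using linear_map_on_minus[OF L zero_carrier_mat zero_carrier_mat]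
    minus_r_inv_mat[OF linear_map_on_carrier[OF L zero_carrier_mat]]
  by (simp add: minus_r_inv_mat[OF zero_carrier_mat])

definition ket :: "nat \<Rightarrow> nat \<Rightarrow> complex" where
  "ket k i = (if i = k then 1 else 0)"

lemma ket_simps [simp]: "ket k k = 1" "i \<noteq> k \<Longrightarrow> ket k i = 0" "cnj (ket k i) = ket k i"
  by (simp_all add: ket_def)

lemma sum_ket:
  assumes "k < n"
  shows "(\<Sum>i<n. ket k i * f i) = f k" and "(\<Sum>i<n. f i * ket k i) = f k"
proof -
  have "ket k i * f i = (if i = k then f i else 0)" for i by simp
  then show "(\<Sum>i<n. ket k i * f i) = f k" using assms by simp
  then show "(\<Sum>i<n. f i * ket k i) = f k" by (simp add: mult.commute)
qed

abbreviation mat_unit :: "nat \<Rightarrow> nat \<Rightarrow> nat \<Rightarrow> complex mat" where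
  "mat_unit d k l \<equiv> outer_prod d (ket k) (ket l)"

lemma linear_map_on_expand:
  assumes L: "linear_map_on d \<Phi>" and X: "X \<in> carrier_mat d d" and ij: "i < d" "j < d"
  shows "\<Phi> X $$ (i,j) = (\<Sum>k<d. \<Sum>l<d. X $$ (k,l) * \<Phi> (mat_unit d k l) $$ (i,j))"
proof -
  define R where "R I = mat d d (\<lambda>p. if p \<in> I then X $$ p else 0)" for I
  have R_carrier: "R I \<in> carrier_mat d d" for I by (simp add: R_def)
  have "\<Phi> (R I) $$ (i,j) = (\<Sum>(k,l)\<in>I. X $$ (k,l) * \<Phi> (mat_unit d k l) $$ (i,j))"
    if "finite I" "I \<subseteq> {..<d} \<times> {..<d}" for I
    using that
  proof (induction I rule: finite_induct)
    case empty
    have "R {} = 0\<^sub>m d d" by (rule eq_matI) (auto simp: R_def)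
    then show ?case using linear_map_on_zero[OF L] ij by simp
  next
    case (insert p I)
    obtain k l where p: "p = (k,l)" by (cases p)
    have "R (insert p I) = R I + X $$ p \<cdot>\<^sub>m mat_unit d k l"
      using insert.hyps p by (intro eq_matI) (auto simp: R_def ket_def)
    then have "\<Phi> (R (insert p I)) = \<Phi> (R I) + X $$ p \<cdot>\<^sub>m \<Phi> (mat_unit d k l)"
      using R_carrier by (simp add: linear_map_on_add[OF L] linear_map_on_smult[OF L])
    then show ?case
      using insert p ij linear_map_on_carrier[OF L R_carrier, of I]
        linear_map_on_carrier[OF L, of "mat_unit d k l"] by simp
  qed
  from this[of "{..<d} \<times> {..<d}"] have "\<Phi> (R ({..<d} \<times> {..<d})) $$ (i,j) =
      (\<Sum>k<d. \<Sum>l<d. X $$ (k,l) * \<Phi> (mat_unit d k l) $$ (i,j))"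
    by (simp add: sum.cartesian_product)
  moreover have "R ({..<d} \<times> {..<d}) = X" using X by (intro eq_matI) (auto simp: R_def)
  ultimately show ?thesis by simp
qed

lemma mat_tendsto_linear_map_on:
  assumes \<Phi>: "\<And>x. linear_map_on d (\<Phi> x)" and \<Psi>: "linear_map_on d \<Psi>"
    and lim: "\<And>X. X \<in> carrier_mat d d \<Longrightarrow> mat_tendsto d (\<lambda>x. \<Phi> x X) (\<Psi> X) F"
    and X: "\<And>x. X x \<in> carrier_mat d d" "Y \<in> carrier_mat d d" "mat_tendsto d X Y F"
  shows "mat_tendsto d (\<lambda>x. \<Phi> x (X x)) (\<Psi> Y) F"
  unfolding mat_tendsto_def
proof (intro allI impI)
  fix i j assume ij: "i < d" "j < d"
  show "((\<lambda>x. \<Phi> x (X x) $$ (i,j)) \<longlongrightarrow> \<Psi> Y $$ (i,j)) F"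
    unfolding linear_map_on_expand[OF \<Phi> X(1) ij] linear_map_on_expand[OF \<Psi> X(2) ij]
    by (intro tendsto_sum tendsto_mult) (auto intro: mat_tendsto_index[OF X(3)] mat_tendsto_index[OF lim] ij)
qed

definition trivial_kernel :: "nat \<Rightarrow> (complex mat \<Rightarrow> complex mat) \<Rightarrow> bool" where
  "trivial_kernel d \<Phi> \<longleftrightarrow> (\<forall>X\<in>carrier_mat d d. \<Phi> X = 0\<^sub>m d d \<longrightarrow> X = 0\<^sub>m d d)"

lemma trivial_kernel_if_inj_on:
  "linear_map_on d \<Phi> \<Longrightarrow> inj_on \<Phi> (carrier_mat d d) \<Longrightarrow> trivial_kernel d \<Phi>"
  unfolding trivial_kernel_def using linear_map_on_zero zero_carrier_mat by (metis inj_onD)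

lemma linear_map_on_inj_if_trivial_kernel:
  assumes L: "linear_map_on d \<Phi>" and ker: "trivial_kernel d \<Phi>"
  shows "inj_on \<Phi> (carrier_mat d d)"
proof (rule inj_onI)
  fix X Y assume XY: "X \<in> carrier_mat d d" "Y \<in> carrier_mat d d" "\<Phi> X = \<Phi> Y"
  then have "\<Phi> (X - Y) = 0\<^sub>m d d"
    using linear_map_on_minus[OF L XY(1,2)] linear_map_on_carrier[OF L XY(2)] by simp
  then have "X - Y = 0\<^sub>m d d" using ker minus_carrier_mat[OF XY(2)] by (simp add: trivial_kernel_def)
  then show "X = Y" by (rule eq_if_minus_mat_eq_zero[OF XY(1,2)])
qed

lemma invertible_mat_inverse:
  fixes G :: "'a::field mat"
  assumes G: "G \<in> carrier_mat d d" "det G \<noteq> 0"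
  obtains H where "H \<in> carrier_mat d d" "G * H = 1\<^sub>m d" "H * G = 1\<^sub>m d"
  using det_non_zero_imp_unit[OF G, of "()"] that by (auto simp: Units_def ring_mat_def)

lemma mult_mat_vec_surj_if_inj:
  fixes A :: "'a::field mat"
  assumes A: "A \<in> carrier_mat n n" and ker: "\<And>v. v \<in> carrier_vec n \<Longrightarrow> A *\<^sub>v v = 0\<^sub>v n \<Longrightarrow> v = 0\<^sub>v n"
    and y: "y \<in> carrier_vec n"
  obtains x where "x \<in> carrier_vec n" "A *\<^sub>v x = y"
proof -
  have "det A \<noteq> 0" using ker det_0_iff_vec_prod_zero[OF A] by blast
  then obtain B where B: "B \<in> carrier_mat n n" "A * B = 1\<^sub>m n" by (rule invertible_mat_inverse[OF A])
  then have "A *\<^sub>v (B *\<^sub>v y) = y" using A y by (simp flip: assoc_mult_mat_vec)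
  then show ?thesis using that[of "B *\<^sub>v y"] B y by simp
qed

lemma linear_map_on_bij_if_trivial_kernel:
  assumes L: "linear_map_on d \<Phi>" and ker: "trivial_kernel d \<Phi>"
  shows "bij_betw \<Phi> (carrier_mat d d) (carrier_mat d d)"
proof -
  define A where "A = mat (d*d) (d*d) (\<lambda>(p,q). \<Phi> (mat_unit d (q div d) (q mod d)) $$ (p div d, p mod d))"
  define unvec where "unvec v = mat d d (\<lambda>(k,l). v $ (k*d + l))" for v :: "complex vec"
  have A: "A \<in> carrier_mat (d*d) (d*d)" and unvec: "unvec v \<in> carrier_mat d d" for v
    by (simp_all add: A_def unvec_def)
  have A_unvec: "\<Phi> (unvec v) $$ (i,j) = (A *\<^sub>v v) $ (i*d + j)"
    if "v \<in> carrier_vec (d*d)" "i < d" "j < d" for v i j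
  proof -
    have "(A *\<^sub>v v) $ (i*d + j) = (\<Sum>k<d. \<Sum>l<d. \<Phi> (mat_unit d k l) $$ (i,j) * v $ (k*d + l))"
      using that A
      by (simp add: A_def pair_index_less scalar_prod_def atLeast0LessThan sum_pair_index)
    then show ?thesis
      unfolding linear_map_on_expand[OF L unvec that(2,3)] by (simp add: unvec_def mult.commute)
  qed
  have A_ker: "v = 0\<^sub>v (d*d)" if v: "v \<in> carrier_vec (d*d)" "A *\<^sub>v v = 0\<^sub>v (d*d)" for v
  proof -
    have "\<Phi> (unvec v) = 0\<^sub>m d d"
      using v linear_map_on_carrier[OF L unvec] by (intro eq_zero_matI) (simp_all add: A_unvec pair_index_less)
    then have "unvec v = 0\<^sub>m d d" using ker unvec by (simp add: trivial_kernel_def)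
    then have "unvec v $$ (p div d, p mod d) = 0" if "p < d*d" for p
      using that by (simp add: div_index_less mod_index_less)
    then show ?thesis
      using v(1) by (intro eq_vecI) (auto simp: unvec_def div_index_less mod_index_less)
  qed
  have "\<exists>Z\<in>carrier_mat d d. \<Phi> Z = Y" if Y: "Y \<in> carrier_mat d d" for Y
  proof -
    obtain x where "x \<in> carrier_vec (d*d)" "A *\<^sub>v x = vec (d*d) (\<lambda>p. Y $$ (p div d, p mod d))"
      using mult_mat_vec_surj_if_inj[OF A A_ker vec_carrier] by blast
    then have "\<Phi> (unvec x) = Y"
      using Y linear_map_on_carrier[OF L unvec, of x]
      by (intro eq_matI) (auto simp: A_unvec pair_index_less)
    then show ?thesis using unvec by blast
  qed
  then show ?thesis
    using linear_map_on_carrier[OF L] linear_map_on_inj_if_trivial_kernel[OF L ker] by (auto simp: bij_betw_def)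
qed

definition block :: "nat \<Rightarrow> nat \<Rightarrow> complex mat \<Rightarrow> nat \<Rightarrow> nat \<Rightarrow> complex mat" where
  "block d m X k l = mat d d (\<lambda>(x,y). X $$ (x*m + k, y*m + l))"

lemma block_carrier [simp]: "block d m X k l \<in> carrier_mat d d"
  by (simp add: block_def)

lemma block_dim [simp]: "dim_row (block d m X k l) = d" "dim_col (block d m X k l) = d"
  by (simp_all add: block_def)

lemma ampl_eq: "ampl \<Phi> d m X = mat (d*m) (d*m)
    (\<lambda>(i,j). \<Phi> (block d m X (i mod m) (j mod m)) $$ (i div m, j div m))"
  by (simp add: ampl_def block_def)

lemma ampl_carrier [simp]: "ampl \<Phi> d m X \<in> carrier_mat (d*m) (d*m)"
  by (simp add: ampl_def)

lemma ampl_index_pair: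
  assumes "x < d" "y < d" "k < m" "l < m"
  shows "ampl \<Phi> d m X $$ (x*m + k, y*m + l) = \<Phi> (block d m X k l) $$ (x,y)"
  using assms by (simp add: ampl_eq pair_index_less)

lemma block_ampl:
  assumes "\<Phi> (block d m X k l) \<in> carrier_mat d d" "k < m" "l < m"
  shows "block d m (ampl \<Phi> d m X) k l = \<Phi> (block d m X k l)"
  using assms by (intro eq_matI) (auto simp: block_def[of _ _ "ampl \<Phi> d m X"] ampl_index_pair)

lemma eq_matI_blocks:
  assumes X: "X \<in> carrier_mat (d*m) (d*m)" and Y: "Y \<in> carrier_mat (d*m) (d*m)"
    and blocks: "\<And>k l. k < m \<Longrightarrow> l < m \<Longrightarrow> block d m X k l = block d m Y k l"
  shows "X = Y"
proof (rule eq_matI)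
  fix i j assume "i < dim_row Y" "j < dim_col Y"
  then have ij: "i < d * m" "j < d * m" using Y by auto
  have entry: "Z $$ (i,j) = block d m Z (i mod m) (j mod m) $$ (i div m, j div m)" for Z
    using ij by (simp add: block_def div_index_less)
  show "X $$ (i,j) = Y $$ (i,j)"
    unfolding entry[of X] entry[of Y] using blocks ij by (simp add: mod_index_less)
qed (use X Y in auto)

lemma block_add:
  assumes "X \<in> carrier_mat (d*m) (d*m)" "Y \<in> carrier_mat (d*m) (d*m)" "k < m" "l < m"
  shows "block d m (X + Y) k l = block d m X k l + block d m Y k l"
  using assms by (intro eq_matI) (auto simp: block_def pair_index_less)

lemma block_smult:
  assumes "X \<in> carrier_mat (d*m) (d*m)" "k < m" "l < m"
  shows "block d m (c \<cdot>\<^sub>m X) k l = c \<cdot>\<^sub>m block d m X k l"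
  using assms by (intro eq_matI) (auto simp: block_def pair_index_less)

lemma mtrace_blocks:
  assumes "X \<in> carrier_mat (d*m) (d*m)"
  shows "mtrace X = (\<Sum>k<m. mtrace (block d m X k k))"
proof -
  have "mtrace X = (\<Sum>x<d. \<Sum>k<m. X $$ (x*m + k, x*m + k))"
    using assms by (simp add: mtrace_eq sum_pair_index)
  also have "\<dots> = (\<Sum>k<m. \<Sum>x<d. X $$ (x*m + k, x*m + k))" by (rule sum.swap)
  also have "\<dots> = (\<Sum>k<m. mtrace (block d m X k k))" by (simp add: mtrace_def block_def)
  finally show ?thesis .
qed

lemma linear_map_on_ampl:
  assumes L: "linear_map_on d \<Phi>"
  shows "linear_map_on (d*m) (ampl \<Phi> d m)"
  unfolding linear_map_on_def
proof (intro conjI ballI allI)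
  note carrier = linear_map_on_carrier[OF L]
  fix X Y :: "complex mat" and c
  assume X: "X \<in> carrier_mat (d*m) (d*m)" and Y: "Y \<in> carrier_mat (d*m) (d*m)"
  show "ampl \<Phi> d m (X + Y) = ampl \<Phi> d m X + ampl \<Phi> d m Y"
    by (rule eq_matI_blocks[of _ d m])
      (use X Y in \<open>simp_all add: block_ampl carrier block_add linear_map_on_add[OF L]\<close>)
  show "ampl \<Phi> d m (c \<cdot>\<^sub>m X) = c \<cdot>\<^sub>m ampl \<Phi> d m X"
    by (rule eq_matI_blocks[of _ d m])
      (use X in \<open>simp_all add: block_ampl carrier block_smult linear_map_on_smult[OF L]\<close>)
qed auto

lemma trivial_kernel_ampl:
  assumes L: "linear_map_on d \<Phi>" and ker: "trivial_kernel d \<Phi>"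
  shows "trivial_kernel (d*m) (ampl \<Phi> d m)"
  unfolding trivial_kernel_def
proof (intro ballI impI)
  fix X assume X: "X \<in> carrier_mat (d*m) (d*m)" and zero: "ampl \<Phi> d m X = 0\<^sub>m (d*m) (d*m)"
  show "X = 0\<^sub>m (d*m) (d*m)"
  proof (rule eq_matI_blocks[OF X zero_carrier_mat])
    fix k l assume kl: "k < m" "l < m"
    have block_zero: "block d m (0\<^sub>m (d*m) (d*m)) k l = 0\<^sub>m d d"
      using kl by (intro eq_matI) (auto simp: block_def pair_index_less)
    have "\<Phi> (block d m X k l) = 0\<^sub>m d d"
      using kl block_ampl[of \<Phi> d m X k l] by (simp add: zero block_zero linear_map_on_carrier[OF L])
    then show "block d m X k l = block d m (0\<^sub>m (d*m) (d*m)) k l"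
      using ker by (simp add: block_zero trivial_kernel_def)
  qed
qed

lemma ampl_comp:
  assumes "\<And>X. X \<in> carrier_mat d d \<Longrightarrow> \<Psi> X \<in> carrier_mat d d"
    and "\<And>X. X \<in> carrier_mat d d \<Longrightarrow> \<Phi> (\<Psi> X) \<in> carrier_mat d d"
  shows "ampl \<Phi> d m (ampl \<Psi> d m X) = ampl (\<lambda>X. \<Phi> (\<Psi> X)) d m X"
  by (rule eq_matI_blocks[of _ d m]) (simp_all add: block_ampl assms)

lemma ampl_id:
  assumes "X \<in> carrier_mat (d*m) (d*m)" "\<And>X. X \<in> carrier_mat d d \<Longrightarrow> \<Phi> X = X"
  shows "ampl \<Phi> d m X = X"
  by (rule eq_matI_blocks[of _ d m]) (use assms in \<open>simp_all add: block_ampl\<close>)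

lemma ampl_one:
  assumes X: "X \<in> carrier_mat d d" and "\<Phi> X \<in> carrier_mat d d"
  shows "ampl \<Phi> d 1 X = \<Phi> X"
proof -
  have "block d 1 X 0 0 = X" using X by (intro eq_matI) (auto simp: block_def)
  then show ?thesis using assms by (intro eq_matI) (auto simp: ampl_eq)
qed

lemma block_kron:
  assumes "P \<in> carrier_mat (d*m) (d*m)" "G \<in> carrier_mat n n" and "k < m*n" "l < m*n"
  shows "block d (m*n) (kron P G) k l = G $$ (k mod n, l mod n) \<cdot>\<^sub>m block d m P (k div n) (l div n)"
proof (rule eq_matI)
  have index: "x * (m*n) + k = (x*m + k div n) * n + k mod n" for x k
    by (simp add: algebra_simps)
  have "0 < n" using assms(3) by (cases n) auto
  fix x y assume "x < dim_row (G $$ (k mod n, l mod n) \<cdot>\<^sub>m block d m P (k div n) (l div n))"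
    "y < dim_col (G $$ (k mod n, l mod n) \<cdot>\<^sub>m block d m P (k div n) (l div n))"
  then have "x < d" "y < d" by (auto simp: block_def)
  then show "block d (m*n) (kron P G) k l $$ (x,y) =
      (G $$ (k mod n, l mod n) \<cdot>\<^sub>m block d m P (k div n) (l div n)) $$ (x,y)"
    using assms \<open>0 < n\<close> unfolding index block_def
    by (simp add: pair_index_less div_index_less)
qed (auto simp: block_def)

lemma ampl_kron:
  assumes L: "linear_map_on d \<Phi>" and P: "P \<in> carrier_mat (d*m) (d*m)" and G: "G \<in> carrier_mat n n"
  shows "ampl \<Phi> d (m*n) (kron P G) = kron (ampl \<Phi> d m P) G"
proof (rule eq_matI_blocks[of _ d "m*n"])
  fix k l assume kl: "k < m*n" "l < m*n"
  show "block d (m*n) (ampl \<Phi> d (m*n) (kron P G)) k l = block d (m*n) (kron (ampl \<Phi> d m P) G) k l"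
    using kl
    by (simp add: block_ampl block_kron[OF _ G] P linear_map_on_smult[OF L] linear_map_on_carrier[OF L]
        div_index_less)
qed (use kron_carrier[OF ampl_carrier G] in \<open>simp_all add: mult.assoc\<close>)

section \<open>Channels\<close>

lemma CPTP_linear: "CPTP d \<Phi> \<Longrightarrow> linear_map_on d \<Phi>"
  by (simp add: CPTP_def)

lemma CPTP_ampl_psd: "CPTP d \<Phi> \<Longrightarrow> 0 < m \<Longrightarrow> psd (d*m) X \<Longrightarrow> psd (d*m) (ampl \<Phi> d m X)"
  by (simp add: CPTP_def)

lemma CPTP_mtrace: "CPTP d \<Phi> \<Longrightarrow> X \<in> carrier_mat d d \<Longrightarrow> mtrace (\<Phi> X) = mtrace X"
  by (simp add: CPTP_def)

lemma CPTP_carrier: "CPTP d \<Phi> \<Longrightarrow> X \<in> carrier_mat d d \<Longrightarrow> \<Phi> X \<in> carrier_mat d d"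
  by (simp add: CPTP_linear linear_map_on_carrier)

lemma CPTP_psd: "CPTP d \<Phi> \<Longrightarrow> psd d X \<Longrightarrow> psd d (\<Phi> X)"
  using CPTP_ampl_psd[of d \<Phi> 1 X] ampl_one[of X d \<Phi>] by (simp add: CPTP_carrier psd_carrier)

lemma CPTP_ampl_mtrace:
  "CPTP d \<Phi> \<Longrightarrow> X \<in> carrier_mat (d*m) (d*m) \<Longrightarrow> mtrace (ampl \<Phi> d m X) = mtrace X"
  by (simp add: mtrace_blocks[of _ d m] block_ampl CPTP_carrier CPTP_mtrace)

lemma positive_map_hermitian:
  assumes L: "linear_map_on n F" and pos: "\<And>X. psd n X \<Longrightarrow> psd n (F X)" and X: "hermitian n X"
  shows "hermitian n (F X)"
proof -
  define I where "I = complex_of_real (entry_norm n X) \<cdot>\<^sub>m 1\<^sub>m n"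
  have "psd n (X + I)" unfolding I_def by (rule psd_add_smult_one[OF X order_refl])
  moreover have "psd n I" unfolding I_def by (rule psd_smult[OF psd_one entry_norm_nonneg])
  ultimately have "hermitian n (F (X + I) - F I)"
    by (intro hermitian_minus psd_hermitian pos)
  also have "F (X + I) - F I = F ((X + I) - I)"
    using hermitian_carrier[OF X] by (simp add: linear_map_on_minus[OF L] I_def)
  also have "(X + I) - I = X"
    using hermitian_carrier[OF X] by (intro eq_matI) (auto simp: I_def)
  finally show ?thesis .
qed

lemma CPTP_hermitian: "CPTP d \<Phi> \<Longrightarrow> hermitian d X \<Longrightarrow> hermitian d (\<Phi> X)"
  using positive_map_hermitian[of d \<Phi> X] by (simp add: CPTP_linear CPTP_psd)

lemma positive_map_imaginary_part_eq_zero: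
  assumes L: "linear_map_on n F" and pos: "\<And>X. psd n X \<Longrightarrow> psd n (F X)"
    and A: "hermitian n A" and B: "hermitian n B" and FAB: "hermitian n (F (A + \<i> \<cdot>\<^sub>m B))"
  shows "F B = 0\<^sub>m n n"
proof -
  have FA: "hermitian n (F A)" and FB: "hermitian n (F B)"
    using positive_map_hermitian[OF L pos] A B by auto
  have "F (A + \<i> \<cdot>\<^sub>m B) = F A + \<i> \<cdot>\<^sub>m F B"
    by (rule linear_map_on_add_smult[OF L hermitian_carrier[OF A] hermitian_carrier[OF B]])
  then have "(F A - F (A + \<i> \<cdot>\<^sub>m B)) + \<i> \<cdot>\<^sub>m F B = 0\<^sub>m n n"
    using hermitian_carrier[OF FA] hermitian_carrier[OF FB] by (intro eq_zero_matI) auto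
  then show ?thesis by (rule hermitian_parts_eq_zero(2)[OF hermitian_minus[OF FA FAB] FB])
qed

lemma CPTP_kernel_hermitian_parts:
  assumes \<Phi>: "CPTP d \<Phi>" and X: "X \<in> carrier_mat d d" "\<Phi> X = 0\<^sub>m d d"
  obtains A B where "hermitian d A" "hermitian d B" "X = A + \<i> \<cdot>\<^sub>m B" "\<Phi> A = 0\<^sub>m d d" "\<Phi> B = 0\<^sub>m d d"
proof -
  note L = CPTP_linear[OF \<Phi>]
  obtain A B where AB: "hermitian d A" "hermitian d B" "X = A + \<i> \<cdot>\<^sub>m B"
    by (rule hermitian_decomp[OF X(1)])
  have "hermitian d (0\<^sub>m d d)" by (auto simp: hermitian_iff)
  then have B0: "\<Phi> B = 0\<^sub>m d d"
    using X(2) AB by (intro positive_map_imaginary_part_eq_zero[OF L CPTP_psd[OF \<Phi>] AB(1,2)]) auto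
  have "\<Phi> X = \<Phi> A + \<i> \<cdot>\<^sub>m \<Phi> B"
    unfolding AB(3) by (rule linear_map_on_add_smult[OF L AB(1,2)[THEN hermitian_carrier]])
  then have "\<Phi> A = 0\<^sub>m d d"
    using X(2) B0 CPTP_carrier[OF \<Phi> hermitian_carrier[OF AB(1)]] by (simp add: smult_zero_mat)
  then show ?thesis using that AB B0 by blast
qed

section \<open>Kraus maps\<close>

definition mat_sum :: "nat \<Rightarrow> nat \<Rightarrow> (nat \<Rightarrow> complex mat) \<Rightarrow> complex mat" where
  "mat_sum d n A = mat d d (\<lambda>p. \<Sum>r<n. A r $$ p)"

lemma mat_sum_carrier [simp]: "mat_sum d n A \<in> carrier_mat d d"
  by (simp add: mat_sum_def)

lemma mat_sum_dim [simp]: "dim_row (mat_sum d n A) = d" "dim_col (mat_sum d n A) = d"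
  by (simp_all add: mat_sum_def)

lemma mat_sum_cong: "(\<And>r. r < n \<Longrightarrow> A r = B r) \<Longrightarrow> mat_sum d n A = mat_sum d n B"
  by (simp add: mat_sum_def)

lemma mult_mat_sum:
  assumes "B \<in> carrier_mat d d" "\<And>r. A r \<in> carrier_mat d d"
  shows "B * mat_sum d n A = mat_sum d n (\<lambda>r. B * A r)"
  using assms carrier_matD[OF assms(2)]
  by (intro eq_matI) (auto simp: mat_sum_def mult_mat_index sum_distrib_left intro: sum.swap)

lemma mat_sum_mult:
  assumes "B \<in> carrier_mat d d" "\<And>r. A r \<in> carrier_mat d d"
  shows "mat_sum d n A * B = mat_sum d n (\<lambda>r. A r * B)"
  using assms carrier_matD[OF assms(2)]
  by (intro eq_matI) (auto simp: mat_sum_def mult_mat_index sum_distrib_right intro: sum.swap)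

lemma mtrace_mat_sum:
  assumes "\<And>r. A r \<in> carrier_mat d d"
  shows "mtrace (mat_sum d n A) = (\<Sum>r<n. mtrace (A r))"
proof -
  have "mtrace (mat_sum d n A) = (\<Sum>i<d. \<Sum>r<n. A r $$ (i,i))" by (simp add: mtrace_def mat_sum_def)
  also have "\<dots> = (\<Sum>r<n. mtrace (A r))" by (subst sum.swap) (simp add: mtrace_eq[OF assms])
  finally show ?thesis .
qed

lemma psd_mat_sum:
  assumes "\<And>r. psd d (A r)"
  shows "psd d (mat_sum d n A)"
proof -
  have "qform d (mat_sum d n A) v = (\<Sum>r<n. qform d (A r) v)" for v
  proof -
    have "qform d (mat_sum d n A) v = (\<Sum>i<d. \<Sum>j<d. \<Sum>r<n. cnj (v i) * A r $$ (i,j) * v j)"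
      by (simp add: qform_def mat_sum_def sum_distrib_left sum_distrib_right)
    also have "\<dots> = (\<Sum>r<n. qform d (A r) v)"
      unfolding qform_def by (subst (2) sum.swap, subst sum.swap) simp
    finally show ?thesis .
  qed
  moreover have "hermitian d (mat_sum d n A)"
    using hermitian_index[OF psd_hermitian[OF assms]] by (simp add: hermitian_iff mat_sum_def)
  ultimately show ?thesis using assms by (simp add: psd_iff sum_nonneg)
qed

definition kraus_map :: "nat \<Rightarrow> nat \<Rightarrow> (nat \<Rightarrow> complex mat) \<Rightarrow> complex mat \<Rightarrow> complex mat" where
  "kraus_map d n K X = mat_sum d n (\<lambda>r. K r * X * adj (K r))"

lemma linear_map_on_kraus_map:
  assumes K: "\<And>r. K r \<in> carrier_mat d d"
  shows "linear_map_on d (kraus_map d n K)"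
proof -
  have conj: "K r * X * adj (K r) \<in> carrier_mat d d" if "X \<in> carrier_mat d d" for r X
    using K[of r] that by simp
  have add: "K r * (X + Y) * adj (K r) = K r * X * adj (K r) + K r * Y * adj (K r)"
    if "X \<in> carrier_mat d d" "Y \<in> carrier_mat d d" for r X Y
    using K[of r] that by (simp add: mult_add_distrib_mat[of _ d d _ d] add_mult_distrib_mat[of _ d d _ _ d])
  have smult: "K r * (c \<cdot>\<^sub>m X) * adj (K r) = c \<cdot>\<^sub>m (K r * X * adj (K r))"
    if "X \<in> carrier_mat d d" for r X c
    using K[of r] that by (simp add: mult_smult_distrib[of _ d d _ d] mult_smult_assoc_mat[of _ d d _ d])
  show ?thesis
    unfolding linear_map_on_def kraus_map_def
    using carrier_matD[OF conj]
    by (auto intro!: eq_matI simp: add smult mat_sum_def sum.distrib sum_distrib_left)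
qed

lemma mtrace_kraus_map:
  assumes K: "\<And>r. K r \<in> carrier_mat d d" and one: "mat_sum d n (\<lambda>r. adj (K r) * K r) = 1\<^sub>m d"
    and X: "X \<in> carrier_mat d d"
  shows "mtrace (kraus_map d n K X) = mtrace X"
proof -
  have carrier: "adj (K r) * K r \<in> carrier_mat d d" "K r * X * adj (K r) \<in> carrier_mat d d"
    "adj (K r) * K r * X \<in> carrier_mat d d" for r
    using K[of r] X by simp_all
  have "mtrace (kraus_map d n K X) = (\<Sum>r<n. mtrace (K r * X * adj (K r)))"
    unfolding kraus_map_def by (rule mtrace_mat_sum[OF carrier(2)])
  also have "\<dots> = (\<Sum>r<n. mtrace (adj (K r) * K r * X))"
  proof (rule sum.cong[OF refl])
    show "mtrace (K r * X * adj (K r)) = mtrace (adj (K r) * K r * X)" for r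
      using mtrace_comm[of "K r * X" d d "adj (K r)"] K[of r] X by (simp add: mult_mat_assoc)
  qed
  also have "\<dots> = mtrace (mat_sum d n (\<lambda>r. adj (K r) * K r) * X)"
    unfolding mat_sum_mult[OF X carrier(1)] by (rule mtrace_mat_sum[OF carrier(3), symmetric])
  finally show ?thesis unfolding one using X by simp
qed

lemma block_kron_one_mult:
  assumes "K \<in> carrier_mat d d" "X \<in> carrier_mat (d*m) (d*m)" "k < m" "l < m"
  shows "block d m (kron K (1\<^sub>m m) * X) k l = K * block d m X k l"
proof (rule eq_matI)
  fix x y assume "x < dim_row (K * block d m X k l)" "y < dim_col (K * block d m X k l)"
  then have xy: "x < d" "y < d" using assms by (auto simp: block_def)
  have "(kron K (1\<^sub>m m) * X) $$ (x*m + k, y*m + l) = (\<Sum>z<d. K $$ (x,z) * X $$ (z*m + k, y*m + l))"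
    using assms xy
    by (simp add: mult_mat_index pair_index_less sum_pair_index
        if_distrib[of "\<lambda>a. _ * a"] if_distrib[of "\<lambda>a. a * _"] cong: if_cong)
  also have "\<dots> = (K * block d m X k l) $$ (x,y)"
    using assms xy by (simp add: mult_mat_index block_def)
  finally show "block d m (kron K (1\<^sub>m m) * X) k l $$ (x,y) = (K * block d m X k l) $$ (x,y)"
    using xy by (simp add: block_def)
qed (use assms in \<open>auto simp: block_def\<close>)

lemma adj_block:
  assumes "X \<in> carrier_mat (d*m) (d*m)" "k < m" "l < m"
  shows "adj (block d m X k l) = block d m (adj X) l k"
  using assms by (intro eq_matI) (auto simp: block_def pair_index_less)

lemma block_mult_kron_one:
  assumes "K \<in> carrier_mat d d" "X \<in> carrier_mat (d*m) (d*m)" "k < m" "l < m"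
  shows "block d m (X * kron K (1\<^sub>m m)) k l = block d m X k l * K"
proof -
  have "adj (block d m (X * kron K (1\<^sub>m m)) k l) = block d m (kron (adj K) (1\<^sub>m m) * adj X) l k"
    using assms kron_carrier[OF assms(1), of "1\<^sub>m m" m m]
    by (simp add: adj_block adj_mult adj_kron)
  also have "\<dots> = adj (block d m X k l * K)"
    using assms by (simp add: block_kron_one_mult adj_mult adj_block)
  finally show ?thesis by (metis adj_adj)
qed

lemma block_mat_sum:
  "k < m \<Longrightarrow> l < m \<Longrightarrow> block d m (mat_sum (d*m) n A) k l = mat_sum d n (\<lambda>r. block d m (A r) k l)"
  by (rule eq_matI) (auto simp: block_def mat_sum_def pair_index_less)

lemma ampl_kraus_map:
  assumes K: "\<And>r. K r \<in> carrier_mat d d" and X: "X \<in> carrier_mat (d*m) (d*m)"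
  shows "ampl (kraus_map d n K) d m X = kraus_map (d*m) n (\<lambda>r. kron (K r) (1\<^sub>m m)) X"
proof (rule eq_matI_blocks[of _ d m])
  fix k l assume kl: "k < m" "l < m"
  have kron_K: "kron (K r) (1\<^sub>m m) \<in> carrier_mat (d*m) (d*m)" for r
    using kron_carrier[OF K one_carrier_mat] .
  have "block d m (kron (K r) (1\<^sub>m m) * X * adj (kron (K r) (1\<^sub>m m))) k l =
      K r * block d m X k l * adj (K r)" for r
    unfolding adj_kron adj_one using K kron_K X kl
    by (simp add: block_mult_kron_one block_kron_one_mult)
  then show "block d m (ampl (kraus_map d n K) d m X) k l =
      block d m (kraus_map (d*m) n (\<lambda>r. kron (K r) (1\<^sub>m m)) X) k l"
    using kl by (simp add: block_ampl kraus_map_def block_mat_sum)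
qed (simp_all add: kraus_map_def)

lemma CPTP_kraus_map:
  assumes K: "\<And>r. K r \<in> carrier_mat d d" and one: "mat_sum d n (\<lambda>r. adj (K r) * K r) = 1\<^sub>m d"
  shows "CPTP d (kraus_map d n K)"
  unfolding CPTP_def
proof (intro conjI allI impI ballI)
  show "linear_map_on d (kraus_map d n K)" by (rule linear_map_on_kraus_map[OF K])
  show "mtrace (kraus_map d n K X) = mtrace X" if "X \<in> carrier_mat d d" for X
    by (rule mtrace_kraus_map[OF K one that])
  fix m X assume X: "psd (d*m) X"
  have "kron (K r) (1\<^sub>m m) \<in> carrier_mat (d*m) (d*m)" for r
    using kron_carrier[OF K one_carrier_mat] .
  then have "psd (d*m) (kron (K r) (1\<^sub>m m) * X * adj (kron (K r) (1\<^sub>m m)))" for r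
    using psd_congruence[OF adj_carrier X] by (metis adj_adj)
  then show "psd (d*m) (ampl (kraus_map d n K) d m X)"
    unfolding ampl_kraus_map[OF K psd_carrier[OF X]] kraus_map_def by (rule psd_mat_sum)
qed

lemma mult_mat_unit_adj:
  assumes "A \<in> carrier_mat d d" "k < d" "l < d"
  shows "A * mat_unit d k l * adj A = outer_prod d (\<lambda>i. A $$ (i,k)) (\<lambda>i. A $$ (i,l))"
proof (rule eq_matI)
  fix i j assume "i < dim_row (outer_prod d (\<lambda>i. A $$ (i,k)) (\<lambda>i. A $$ (i,l)))"
    "j < dim_col (outer_prod d (\<lambda>i. A $$ (i,k)) (\<lambda>i. A $$ (i,l)))"
  then have ij: "i < d" "j < d" by auto
  have "(A * mat_unit d k l) $$ (i,q) = ket l q * A $$ (i,k)" if "q < d" for q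
    using assms ij that sum_ket(2)[OF \<open>k < d\<close>, of "\<lambda>r. A $$ (i,r) * ket l q"]
    by (simp add: mult_mat_index mult_ac)
  then show "(A * mat_unit d k l * adj A) $$ (i,j) =
      outer_prod d (\<lambda>i. A $$ (i,k)) (\<lambda>i. A $$ (i,l)) $$ (i,j)"
    using assms ij by (simp add: mult_mat_index[of i "A * _"] mult.assoc sum_ket)
qed (use assms in auto)

definition kraus_of_columns :: "nat \<Rightarrow> (nat \<Rightarrow> complex mat) \<Rightarrow> nat \<Rightarrow> complex mat" where
  "kraus_of_columns d W r = mat d d (\<lambda>(i,k). W k $$ (i,r))"

lemma kraus_of_columns_carrier [simp]: "kraus_of_columns d W r \<in> carrier_mat d d"
  by (simp add: kraus_of_columns_def)

lemma kraus_of_columns_gram: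
  assumes W: "\<And>k. W k \<in> carrier_mat d n"
  shows "mat_sum d n (\<lambda>r. adj (kraus_of_columns d W r) * kraus_of_columns d W r) =
    mat d d (\<lambda>(k,l). mtrace (adj (W k) * W l))"
  using carrier_matD[OF W]
  by (intro eq_matI) (simp_all add: mat_sum_def kraus_of_columns_def mult_mat_index mtrace_def)

lemma kraus_map_of_columns_mat_unit:
  assumes W: "\<And>k. W k \<in> carrier_mat d n" and kl: "k < d" "l < d"
  shows "kraus_map d n (kraus_of_columns d W) (mat_unit d k l) = W k * adj (W l)"
  using kl carrier_matD[OF W] unfolding kraus_map_def mult_mat_unit_adj[OF kraus_of_columns_carrier kl]
  by (intro eq_matI) (simp_all add: mat_sum_def kraus_of_columns_def mult_mat_index)

lemma kraus_map_comp_conj: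
  assumes S: "\<And>r. S r \<in> carrier_mat d d" and H: "H \<in> carrier_mat d d" and X: "X \<in> carrier_mat d d"
  shows "kraus_map d n (\<lambda>r. S r * H) X = kraus_map d n S (H * X * adj H)"
  using carrier_matD[OF S] H X unfolding kraus_map_def
  by (intro mat_sum_cong) (simp add: adj_mult mult_mat_assoc)

text \<open>An isometry \<open>\<complex>\<^sup>d \<rightarrow> \<complex>\<^sup>d \<otimes> \<complex>\<^sup>n\<close> is determined by the images \<open>W k\<close> of a basis, the columns of \<open>G\<close>, and
  exists if the Gram matrices agree; tracing out \<open>\<complex>\<^sup>n\<close> turns it into a channel.\<close>

lemma CPTP_if_gram_eq:
  assumes G: "G \<in> carrier_mat d d" "det G \<noteq> 0" and W: "\<And>k. W k \<in> carrier_mat d n"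
    and gram: "\<And>k l. k < d \<Longrightarrow> l < d \<Longrightarrow> mtrace (adj (W k) * W l) = (adj G * G) $$ (k,l)"
  obtains V where "CPTP d V" "\<And>k l. k < d \<Longrightarrow> l < d \<Longrightarrow>
      V (outer_prod d (\<lambda>i. G $$ (i,k)) (\<lambda>i. G $$ (i,l))) = W k * adj (W l)"
proof -
  obtain H where H: "H \<in> carrier_mat d d" "G * H = 1\<^sub>m d" "H * G = 1\<^sub>m d"
    by (rule invertible_mat_inverse[OF G])
  define S where "S = kraus_of_columns d W"
  define K where "K r = S r * H" for r
  have S: "S r \<in> carrier_mat d d" for r by (simp add: S_def)
  then have K: "K r \<in> carrier_mat d d" for r using H(1) by (simp add: K_def)
  have "mat_sum d n (\<lambda>r. adj (K r) * K r) = mat_sum d n (\<lambda>r. adj H * (adj (S r) * S r) * H)"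
    using H(1) carrier_matD[OF S] by (intro mat_sum_cong) (simp add: K_def adj_mult mult_mat_assoc)
  also have "\<dots> = adj H * mat_sum d n (\<lambda>r. adj (S r) * S r) * H"
    using S H(1) by (simp add: mat_sum_mult mult_mat_sum)
  also have "mat_sum d n (\<lambda>r. adj (S r) * S r) = adj G * G"
    unfolding S_def kraus_of_columns_gram[OF W] using gram G by (intro eq_matI) auto
  also have "adj H * (adj G * G) * H = adj (G * H) * (G * H)"
    using G H(1) by (simp add: adj_mult mult_mat_assoc)
  also have "\<dots> = 1\<^sub>m d" by (simp add: H(2))
  finally have "CPTP d (kraus_map d n K)" by (rule CPTP_kraus_map[OF K])
  moreover have "kraus_map d n K (outer_prod d (\<lambda>i. G $$ (i,k)) (\<lambda>i. G $$ (i,l))) = W k * adj (W l)"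
    if kl: "k < d" "l < d" for k l
  proof -
    define E where "E = mat_unit d k l"
    have E: "E \<in> carrier_mat d d" by (simp add: E_def)
    have "H * (G * E * adj G) * adj H = (H * G) * E * adj (H * G)"
      using G H(1) E by (simp add: adj_mult mult_mat_assoc)
    also have "\<dots> = E" using E by (simp add: H(3))
    finally have "kraus_map d n K (G * E * adj G) = kraus_map d n S E"
      unfolding K_def using kraus_map_comp_conj[OF S H(1), of "G * E * adj G" n] G E by simp
    then show ?thesis
      unfolding E_def S_def mult_mat_unit_adj[OF G(1) kl] kraus_map_of_columns_mat_unit[OF W kl] .
  qed
  ultimately show ?thesis using that by blast
qed

lemma linear_map_on_eq_mtrace_smult:
  assumes L: "linear_map_on d V" and R: "R \<in> carrier_mat d d"
    and V_unit: "\<And>k l. k < d \<Longrightarrow> l < d \<Longrightarrow> V (mat_unit d k l) = (if k = l then 1 else 0) \<cdot>\<^sub>m R"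
    and X: "X \<in> carrier_mat d d"
  shows "V X = mtrace X \<cdot>\<^sub>m R"
proof (rule eq_matI)
  fix i j assume "i < dim_row (mtrace X \<cdot>\<^sub>m R)" "j < dim_col (mtrace X \<cdot>\<^sub>m R)"
  then have ij: "i < d" "j < d" using R by auto
  have "V X $$ (i,j) = (\<Sum>k<d. \<Sum>l<d. if l = k then X $$ (k,k) * R $$ (i,j) else 0)"
    unfolding linear_map_on_expand[OF L X ij] using ij R by (intro sum.cong refl) (auto simp: V_unit)
  then show "V X $$ (i,j) = (mtrace X \<cdot>\<^sub>m R) $$ (i,j)"
    using ij R X by (simp add: mtrace_eq sum_distrib_right)
qed (use linear_map_on_carrier[OF L X] R in auto)

lemma CPTP_replacer:
  assumes M: "M \<in> carrier_mat d n" and tr: "mtrace (M * adj M) = 1"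
  obtains V where "CPTP d V" "\<And>X. X \<in> carrier_mat d d \<Longrightarrow> V X = mtrace X \<cdot>\<^sub>m (M * adj M)"
proof -
  define row where "row k = mat 1 d (\<lambda>(_,l). ket k l)" for k
  define W where "W k = kron (row k) M" for k
  have row: "row k \<in> carrier_mat 1 d" for k by (simp add: row_def)
  have W: "W k \<in> carrier_mat d (d*n)" for k using kron_carrier[OF row M] by (simp add: W_def)
  have gram: "mtrace (adj (W k) * W l) = (adj (1\<^sub>m d) * 1\<^sub>m d) $$ (k,l)" if kl: "k < d" "l < d" for k l
  proof -
    have "adj (W k) * W l = kron (adj (row k) * row l) (adj M * M)"
      unfolding W_def adj_kron using M by (intro kron_mult) (simp_all add: carrier_matD[OF row])
    then have "mtrace (adj (W k) * W l) = mtrace (adj (row k) * row l) * mtrace (adj M * M)"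
      using mtrace_kron[OF mult_carrier_mat[OF adj_carrier[OF row] row]]
        mult_carrier_mat[OF adj_carrier[OF M] M] by simp
    also have "mtrace (adj M * M) = 1" using mtrace_comm[OF M adj_carrier[OF M]] tr by simp
    also have "mtrace (adj (row k) * row l) = (if k = l then 1 else 0)"
      using kl by (simp add: mtrace_def mult_mat_index row_def sum_ket)
    finally show ?thesis using kl by simp
  qed
  obtain V where V: "CPTP d V"
    "\<And>k l. k < d \<Longrightarrow> l < d \<Longrightarrow> V (outer_prod d (\<lambda>i. 1\<^sub>m d $$ (i,k)) (\<lambda>i. 1\<^sub>m d $$ (i,l))) = W k * adj (W l)"
    using CPTP_if_gram_eq[of "1\<^sub>m d" d W "d*n"] W gram by auto
  have "V (mat_unit d k l) = (if k = l then 1 else 0) \<cdot>\<^sub>m (M * adj M)" if kl: "k < d" "l < d" for k l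
  proof -
    have "outer_prod d (\<lambda>i. 1\<^sub>m d $$ (i,k)) (\<lambda>i. 1\<^sub>m d $$ (i,l)) = mat_unit d k l"
      using kl by (intro eq_matI) (auto simp: ket_def)
    then have "V (mat_unit d k l) = kron (row k * adj (row l)) (M * adj M)"
      using V(2)[OF kl] carrier_matD[OF row] M by (simp add: W_def adj_kron kron_mult)
    also have "row k * adj (row l) = (if k = l then 1 else 0) \<cdot>\<^sub>m 1\<^sub>m 1"
      using kl by (intro eq_matI) (auto simp: mult_mat_index row_def sum_ket)
    also have "kron \<dots> (M * adj M) = (if k = l then 1 else 0) \<cdot>\<^sub>m (M * adj M)"
      using M by (intro eq_matI) auto
    finally show ?thesis .
  qed
  from linear_map_on_eq_mtrace_smult[OF CPTP_linear[OF V(1)] _ this]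
  have "V X = mtrace X \<cdot>\<^sub>m (M * adj M)" if "X \<in> carrier_mat d d" for X using that M by simp
  then show ?thesis using that V(1) by blast
qed

section \<open>Choi matrices and compactness of the set of channels\<close>

definition max_entangled :: "nat \<Rightarrow> complex mat" where
  "max_entangled d = (let w = \<lambda>i. if i div d = i mod d then 1 else 0 in outer_prod (d*d) w w)"

lemma psd_outer_prod: "psd n (outer_prod n w w)"
  using psd_kron_outer_prod[OF psd_one, of 1 n w] unfolding kron_one_left by simp

lemma psd_max_entangled: "psd (d*d) (max_entangled d)"
  by (simp add: max_entangled_def Let_def psd_outer_prod)

lemma ampl_max_entangled:
  assumes "a < d" "b < d" "k < d" "l < d"
  shows "ampl \<Phi> d d (max_entangled d) $$ (a*d + k, b*d + l) = \<Phi> (mat_unit d k l) $$ (a,b)"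
proof -
  have "block d d (max_entangled d) k l = mat_unit d k l"
    using assms
    by (intro eq_matI) (auto simp: block_def max_entangled_def Let_def ket_def pair_index_less)
  then show ?thesis using assms by (simp add: ampl_index_pair)
qed

lemma norm_CPTP_mat_unit_le:
  assumes \<Phi>: "CPTP d \<Phi>" and index: "a < d" "b < d" "k < d" "l < d"
  shows "cmod (\<Phi> (mat_unit d k l) $$ (a,b)) \<le> Re (mtrace (max_entangled d))"
proof -
  have "cmod (ampl \<Phi> d d (max_entangled d) $$ (a*d + k, b*d + l)) \<le> Re (mtrace (ampl \<Phi> d d (max_entangled d)))"
    using index
    by (intro psd_entry_le_mtrace[of "d*d"] CPTP_ampl_psd[OF \<Phi>] psd_max_entangled pair_index_less) auto
  then show ?thesis
    using index by (simp add: ampl_max_entangled CPTP_ampl_mtrace[OF \<Phi> psd_carrier[OF psd_max_entangled]])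
qed

lemma CPTP_choi_nonneg:
  assumes \<Phi>: "CPTP d \<Phi>" and K: "K \<in> carrier_mat d d"
  shows "0 \<le> Re (\<Sum>k<d. \<Sum>l<d. (adj K * \<Phi> (mat_unit d k l) * K) $$ (k,l))"
proof (cases "d = 0")
  case False
  define v where "v i = K $$ (i div d, i mod d)" for i
  have carrier: "\<Phi> (mat_unit d k l) \<in> carrier_mat d d" for k l by (rule CPTP_carrier[OF \<Phi>]) simp
  have "qform (d*d) (ampl \<Phi> d d (max_entangled d)) v =
      (\<Sum>a<d. \<Sum>k<d. \<Sum>b<d. \<Sum>l<d. cnj (K $$ (a,k)) * \<Phi> (mat_unit d k l) $$ (a,b) * K $$ (b,l))"
    unfolding qform_def sum_pair_index
    by (intro sum.cong refl) (simp add: ampl_max_entangled v_def)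
  also have "\<dots> = (\<Sum>k<d. \<Sum>a<d. \<Sum>l<d. \<Sum>b<d. cnj (K $$ (a,k)) * \<Phi> (mat_unit d k l) $$ (a,b) * K $$ (b,l))"
    by (rule trans[OF sum.swap]) (intro sum.cong refl sum.swap)
  also have "\<dots> = (\<Sum>k<d. \<Sum>l<d. \<Sum>b<d. \<Sum>a<d. cnj (K $$ (a,k)) * \<Phi> (mat_unit d k l) $$ (a,b) * K $$ (b,l))"
    by (rule sum.cong[OF refl], rule trans[OF sum.swap]) (intro sum.cong refl sum.swap)
  also have "\<dots> = (\<Sum>k<d. \<Sum>l<d. (adj K * \<Phi> (mat_unit d k l) * K) $$ (k,l))"
    using K carrier_matD[OF carrier] by (simp add: mult_mat_index sum_distrib_right)
  finally show ?thesis
    using CPTP_ampl_psd[OF \<Phi> _ psd_max_entangled] False unfolding psd_iff by (metis neq0_conv)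
qed simp

lemma CPTP_limit:
  assumes "F \<noteq> bot" and \<Phi>: "\<And>x. CPTP d (\<Phi> x)" and L: "linear_map_on d \<Psi>"
    and lim: "\<And>X. X \<in> carrier_mat d d \<Longrightarrow> mat_tendsto d (\<lambda>x. \<Phi> x X) (\<Psi> X) F"
  shows "CPTP d \<Psi>"
  unfolding CPTP_def
proof (intro conjI L allI impI ballI)
  fix m X assume m: "0 < m" and X: "psd (d*m) X"
  have "mat_tendsto (d*m) (\<lambda>x. ampl (\<Phi> x) d m X) (ampl \<Psi> d m X) F"
    using mat_tendsto_index[OF lim] by (simp add: mat_tendsto_def ampl_eq div_index_less)
  then show "psd (d*m) (ampl \<Psi> d m X)"
    by (rule psd_limit[OF assms(1) CPTP_ampl_psd[OF \<Phi> m X] ampl_carrier])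
next
  fix X :: "complex mat" assume X: "X \<in> carrier_mat d d"
  have "((\<lambda>x. mtrace (\<Phi> x X)) \<longlongrightarrow> mtrace (\<Psi> X)) F"
    by (intro tendsto_mtrace[of _ d] CPTP_carrier[OF \<Phi>] linear_map_on_carrier[OF L] X lim)
  then show "mtrace (\<Psi> X) = mtrace X"
    using assms(1) by (simp add: CPTP_mtrace[OF \<Phi> X] tendsto_const_iff)
qed

lemma CPTP_convergent_subsequence:
  assumes \<Phi>: "\<And>n. CPTP d (\<Phi> n)"
  obtains r \<Psi> where "strict_mono (r :: nat \<Rightarrow> nat)" "CPTP d \<Psi>"
    "\<And>X. X \<in> carrier_mat d d \<Longrightarrow> mat_tendsto d (\<lambda>n. \<Phi> (r n) X) (\<Psi> X) sequentially"
proof -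
  let ?I = "({..<d} \<times> {..<d}) \<times> ({..<d} \<times> {..<d})"
  have "bounded (range (\<lambda>n. (\<lambda>((k,l),p). \<Phi> n (mat_unit d k l) $$ p) q))" if "q \<in> ?I" for q
    using that norm_CPTP_mat_unit_le[OF \<Phi>] by (intro boundedI) auto
  then obtain r c where r: "strict_mono r"
    and c: "\<forall>q\<in>?I. (\<lambda>n. (\<lambda>((k,l),p). \<Phi> (r n) (mat_unit d k l) $$ p) q) \<longlonglongrightarrow> c q"
    using finite_family_convergent_subsequence[of ?I "\<lambda>n ((k,l),p). \<Phi> n (mat_unit d k l) $$ p"] by auto
  define \<Psi> where "\<Psi> X = mat d d (\<lambda>p. \<Sum>k<d. \<Sum>l<d. X $$ (k,l) * c ((k,l),p))" for X :: "complex mat"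
  have "mat_tendsto d (\<lambda>n. \<Phi> (r n) X) (\<Psi> X) sequentially" if X: "X \<in> carrier_mat d d" for X
    unfolding mat_tendsto_def
  proof (intro allI impI)
    fix i j assume ij: "i < d" "j < d"
    have "(\<lambda>n. \<Sum>k<d. \<Sum>l<d. X $$ (k,l) * \<Phi> (r n) (mat_unit d k l) $$ (i,j))
        \<longlonglongrightarrow> (\<Sum>k<d. \<Sum>l<d. X $$ (k,l) * c ((k,l),(i,j)))"
      using c ij by (intro tendsto_sum tendsto_mult tendsto_const) force
    then show "(\<lambda>n. \<Phi> (r n) X $$ (i,j)) \<longlonglongrightarrow> \<Psi> X $$ (i,j)"
      using ij by (simp add: linear_map_on_expand[OF CPTP_linear[OF \<Phi>] X ij] \<Psi>_def)
  qed
  moreover have "linear_map_on d \<Psi>"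
    unfolding linear_map_on_def \<Psi>_def
    by (auto intro!: eq_matI simp: sum.distrib sum_distrib_left algebra_simps)
  ultimately show ?thesis using that[OF r CPTP_limit[OF sequentially_bot \<Phi>]] by blast
qed

section \<open>Factorization of channels\<close>

definition factors_through :: "nat \<Rightarrow> (complex mat \<Rightarrow> complex mat) \<Rightarrow> (complex mat \<Rightarrow> complex mat) \<Rightarrow> bool" where
  "factors_through d \<Psi> \<Phi> \<longleftrightarrow> (\<exists>V. CPTP d V \<and> (\<forall>X\<in>carrier_mat d d. \<Psi> X = V (\<Phi> X)))"

definition trace_norm_dominated ::
  "nat \<Rightarrow> (complex mat \<Rightarrow> complex mat) \<Rightarrow> (complex mat \<Rightarrow> complex mat) \<Rightarrow> bool" where
  "trace_norm_dominated d \<Psi> \<Phi> \<longleftrightarrow>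
     (\<forall>m>0. \<forall>X. hermitian (d*m) X \<longrightarrow> trace_norm (ampl \<Psi> d m X) \<le> trace_norm (ampl \<Phi> d m X))"

lemma trace_norm_dominated_one:
  assumes \<Phi>: "CPTP d \<Phi>" and \<Psi>: "CPTP d \<Psi>" and dom: "trace_norm_dominated d \<Psi> \<Phi>" and X: "hermitian d X"
  shows "trace_norm (\<Psi> X) \<le> trace_norm (\<Phi> X)"
proof -
  have one: "ampl \<Theta> d 1 X = \<Theta> X" if "CPTP d \<Theta>" for \<Theta>
    using hermitian_carrier[OF X] CPTP_carrier[OF that] by (intro ampl_one)
  show ?thesis
    using dom[unfolded trace_norm_dominated_def, rule_format, of 1 X] one[OF \<Phi>] one[OF \<Psi>] X by simp
qed

lemma kernel_mono_if_trace_norm_dominated: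
  assumes \<Phi>: "CPTP d \<Phi>" and \<Psi>: "CPTP d \<Psi>" and dom: "trace_norm_dominated d \<Psi> \<Phi>"
    and X: "X \<in> carrier_mat d d" "\<Phi> X = 0\<^sub>m d d"
  shows "\<Psi> X = 0\<^sub>m d d"
proof -
  have zero: "\<Psi> A = 0\<^sub>m d d" if "hermitian d A" "\<Phi> A = 0\<^sub>m d d" for A
  proof (rule eq_zero_if_trace_norm_le_zero)
    show "\<Psi> A \<in> carrier_mat d d" by (rule CPTP_carrier[OF \<Psi> hermitian_carrier[OF that(1)]])
    show "trace_norm (\<Psi> A) \<le> 0"
      using trace_norm_dominated_one[OF \<Phi> \<Psi> dom that(1)] that(2) by (simp add: trace_norm_zero_mat)
  qed
  obtain A B where AB: "hermitian d A" "hermitian d B" "X = A + \<i> \<cdot>\<^sub>m B" "\<Phi> A = 0\<^sub>m d d" "\<Phi> B = 0\<^sub>m d d"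
    by (rule CPTP_kernel_hermitian_parts[OF \<Phi> X])
  have "\<Psi> X = \<Psi> A + \<i> \<cdot>\<^sub>m \<Psi> B"
    unfolding AB(3) by (rule linear_map_on_add_smult[OF CPTP_linear[OF \<Psi>] AB(1,2)[THEN hermitian_carrier]])
  then show ?thesis by (simp add: zero AB)
qed

lemma hermitian_if_image_hermitian:
  assumes L: "linear_map_on n F" and pos: "\<And>X. psd n X \<Longrightarrow> psd n (F X)"
    and ker: "trivial_kernel n F" and X: "X \<in> carrier_mat n n" "hermitian n (F X)"
  shows "hermitian n X"
proof -
  obtain A B where AB: "hermitian n A" "hermitian n B" "X = A + \<i> \<cdot>\<^sub>m B"
    by (rule hermitian_decomp[OF X(1)])
  have "F B = 0\<^sub>m n n"
    using X(2) AB by (intro positive_map_imaginary_part_eq_zero[OF L pos AB(1,2)]) auto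
  then have "B = 0\<^sub>m n n" using ker hermitian_carrier[OF AB(2)] by (simp add: trivial_kernel_def)
  then have "X = A" using AB hermitian_carrier[OF AB(1)] by (simp add: smult_zero_mat)
  then show ?thesis using AB(1) by simp
qed

lemma linear_map_on_inv_into:
  assumes L: "linear_map_on d \<Phi>" and bij: "bij_betw \<Phi> (carrier_mat d d) (carrier_mat d d)"
  shows "linear_map_on d (inv_into (carrier_mat d d) \<Phi>)"
  unfolding linear_map_on_def
proof (intro conjI ballI allI)
  let ?J = "inv_into (carrier_mat d d) \<Phi>"
  note inv = bij_betw_inv_into_left[OF bij]
  have J: "?J X \<in> carrier_mat d d" "\<Phi> (?J X) = X" if "X \<in> carrier_mat d d" for X
    using that bij bij_betw_inv_into_right[OF bij] by (auto simp: bij_betw_def inv_into_into)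
  fix X Y :: "complex mat" and c
  assume X: "X \<in> carrier_mat d d" and Y: "Y \<in> carrier_mat d d"
  show "?J X \<in> carrier_mat d d" by (rule J(1)[OF X])
  show "?J (X + Y) = ?J X + ?J Y"
    using inv[of "?J X + ?J Y"] J[OF X] J[OF Y] by (simp add: linear_map_on_add[OF L])
  show "?J (c \<cdot>\<^sub>m X) = c \<cdot>\<^sub>m ?J X"
    using inv[of "c \<cdot>\<^sub>m ?J X"] J[OF X] by (simp add: linear_map_on_smult[OF L])
qed

lemma factors_through_if_bij:
  assumes \<Phi>: "CPTP d \<Phi>" and \<Psi>: "CPTP d \<Psi>" and bij: "bij_betw \<Phi> (carrier_mat d d) (carrier_mat d d)"
    and dom: "trace_norm_dominated d \<Psi> \<Phi>"
  shows "factors_through d \<Psi> \<Phi>"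
proof -
  define J where "J = inv_into (carrier_mat d d) \<Phi>"
  define V where "V = (\<lambda>Y. \<Psi> (J Y))"
  note L = CPTP_linear[OF \<Phi>]
  have ker: "trivial_kernel d \<Phi>" by (rule trivial_kernel_if_inj_on[OF L bij_betw_imp_inj_on[OF bij]])
  have LJ: "linear_map_on d J" unfolding J_def by (rule linear_map_on_inv_into[OF L bij])
  note J = linear_map_on_carrier[OF LJ]
  have \<Phi>J: "\<Phi> (J Y) = Y" and J\<Phi>: "J (\<Phi> Y) = Y" if "Y \<in> carrier_mat d d" for Y
    using that bij_betw_inv_into_right[OF bij] bij_betw_inv_into_left[OF bij] by (auto simp: J_def)
  have "CPTP d V"
    unfolding CPTP_def
  proof (intro conjI allI impI ballI)
    show "linear_map_on d V"
      using LJ CPTP_linear[OF \<Psi>] by (auto simp: linear_map_on_def V_def)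
    show "mtrace (V Y) = mtrace Y" if "Y \<in> carrier_mat d d" for Y
      using CPTP_mtrace[OF \<Psi> J[OF that]] CPTP_mtrace[OF \<Phi> J[OF that]] \<Phi>J[OF that] by (simp add: V_def)
    fix m Y assume m: "0 < m" and Y: "psd (d*m) Y"
    define X where "X = ampl J d m Y"
    have X: "X \<in> carrier_mat (d*m) (d*m)" by (simp add: X_def)
    have \<Phi>X: "ampl \<Phi> d m X = Y"
      unfolding X_def by (subst ampl_comp) (auto intro!: ampl_id psd_carrier[OF Y] simp: J \<Phi>J)
    have "hermitian (d*m) X"
      using psd_hermitian[OF Y]
      by (intro hermitian_if_image_hermitian[OF linear_map_on_ampl[OF L] CPTP_ampl_psd[OF \<Phi> m] _ X]
          trivial_kernel_ampl[OF L ker]) (simp_all add: \<Phi>X)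
    then have "trace_norm (ampl \<Psi> d m X) \<le> trace_norm Y"
      using dom m \<Phi>X by (metis trace_norm_dominated_def)
    also have "\<dots> = Re (mtrace (ampl \<Psi> d m X))"
      using CPTP_ampl_mtrace[OF \<Phi> X] CPTP_ampl_mtrace[OF \<Psi> X] \<Phi>X by (simp add: trace_norm_psd[OF Y])
    finally have "psd (d*m) (ampl \<Psi> d m X)" by (intro psd_if_trace_norm_le_mtrace) auto
    also have "ampl \<Psi> d m X = ampl V d m Y"
      unfolding X_def V_def by (rule ampl_comp) (auto simp: J CPTP_carrier[OF \<Psi>])
    finally show "psd (d*m) (ampl V d m Y)" .
  qed
  then show ?thesis using J\<Phi> by (auto simp: factors_through_def V_def)
qed

section \<open>Negativity as a trace norm\<close>

lemma trace_norm_add_orthogonal: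
  assumes X: "X \<in> carrier_mat n n" and Y: "Y \<in> carrier_mat n n"
    and orth: "adj X * Y = 0\<^sub>m n n" "X * adj Y = 0\<^sub>m n n"
  shows "trace_norm (X + Y) = trace_norm X + trace_norm Y"
proof -
  obtain U where U: "unitary n U" "psd n (U * X)" "trace_norm X = Re (mtrace (U * X))"
    "(U * X) * (U * X) = adj X * X" using trace_norm_attained[OF X] by metis
  obtain V where V: "unitary n V" "psd n (V * Y)" "trace_norm Y = Re (mtrace (V * Y))"
    "(V * Y) * (V * Y) = adj Y * Y" using trace_norm_attained[OF Y] by metis
  note carrier = X Y U(1)[THEN unitary_carrier] V(1)[THEN unitary_carrier]
  have adj_psd: "adj (U * X) = U * X" "adj (V * Y) = V * Y" using U(2) V(2) by (simp_all add: psd_def)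
  have "(U * X) * adj (V * Y) = U * ((X * adj Y) * adj V)"
    using carrier by (simp add: adj_mult mult_mat_assoc)
  then have UXVY: "(U * X) * (V * Y) = 0\<^sub>m n n" using carrier by (simp add: adj_psd orth)
  have "(V * Y) * (U * X) = adj ((U * X) * (V * Y))"
    using carrier by (simp add: adj_mult[of "U * X"] adj_psd)
  then have VYUX: "(V * Y) * (U * X) = 0\<^sub>m n n" unfolding UXVY by (auto intro!: eq_matI)
  have "adj Y * X = adj (adj X * Y)" using carrier by (simp add: adj_mult)
  then have YX: "adj Y * X = 0\<^sub>m n n" unfolding orth by (auto intro!: eq_matI)
  have square: "(A + B) * (C + D) = A * C + B * D"
    if "A * D = 0\<^sub>m n n" "B * C = 0\<^sub>m n n" "A \<in> carrier_mat n n" "B \<in> carrier_mat n n"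
      "C \<in> carrier_mat n n" "D \<in> carrier_mat n n" for A B C D :: "complex mat"
    using that by (simp add: mult_add_distrib_mat[of _ n n _ n] add_mult_distrib_mat[of _ n n _ _ n]
        left_add_zero_mat[of _ n n] right_add_zero_mat[of _ n n])
  have "trace_norm (X + Y) = Re (mtrace (U * X + V * Y))"
  proof (rule trace_norm_eqI)
    show "psd n (U * X + V * Y)" by (rule psd_add[OF U(2) V(2)])
    show "(U * X + V * Y) * (U * X + V * Y) = adj (X + Y) * (X + Y)"
      using carrier U(4) V(4) square[OF UXVY VYUX] square[OF orth(1) YX] by (simp add: adj_add[of _ n n])
  qed (use X Y in simp)
  then show ?thesis using carrier U(3) V(3) by (simp add: mtrace_add[of _ n])
qed

lemma kron_zero_right: "kron A (0\<^sub>m p q) = 0\<^sub>m (dim_row A * p) (dim_col A * q)"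
  by (rule eq_matI) (auto simp: mod_index_less)

lemma trace_norm_kron_add_orthogonal:
  assumes "A \<in> carrier_mat m m" "B \<in> carrier_mat m m" "G \<in> carrier_mat n n" "H \<in> carrier_mat n n"
    and "adj G * H = 0\<^sub>m n n" "G * adj H = 0\<^sub>m n n"
  shows "trace_norm (kron A G + kron B H) = trace_norm (kron A G) + trace_norm (kron B H)"
  by (rule trace_norm_add_orthogonal[of _ "m*n"])
    (use assms in \<open>simp_all add: adj_kron kron_mult kron_zero_right\<close>)

lemma trace_norm_kron_outer_prod:
  assumes A: "A \<in> carrier_mat m m"
    and unit: "(\<Sum>k<n. cnj (v k) * v k) = 1" "(\<Sum>k<n. cnj (w k) * w k) = 1"
  shows "trace_norm (kron A (outer_prod n v w)) = trace_norm A"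
proof -
  obtain U where U: "unitary m U" "psd m (U * A)" "trace_norm A = Re (mtrace (U * A))"
    "(U * A) * (U * A) = adj A * A" using trace_norm_attained[OF A] by metis
  have UA: "U * A \<in> carrier_mat m m" using U A by (simp add: unitary_carrier)
  have "trace_norm (kron A (outer_prod n v w)) = Re (mtrace (kron (U * A) (outer_prod n w w)))"
  proof (rule trace_norm_eqI)
    have "kron (U * A) (outer_prod n w w) * kron (U * A) (outer_prod n w w)
        = kron ((U * A) * (U * A)) (outer_prod n w w * outer_prod n w w)"
      using UA by (intro kron_mult) (simp_all only: carrier_matD outer_prod_dim)
    also have "\<dots> = adj (kron A (outer_prod n v w)) * kron A (outer_prod n v w)"
      unfolding U(4) using A by (simp add: adj_kron kron_mult adj_outer_prod outer_prod_mult unit)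
    finally show "kron (U * A) (outer_prod n w w) * kron (U * A) (outer_prod n w w) =
        adj (kron A (outer_prod n v w)) * kron A (outer_prod n v w)" .
  qed (use kron_carrier[OF A outer_prod_carrier] psd_kron_outer_prod[OF U(2)] in auto)
  also have "\<dots> = Re (mtrace (U * A) * (\<Sum>k<n. cnj (w k) * w k))"
    unfolding mtrace_kron[OF UA outer_prod_carrier] by (simp add: mtrace_def mult.commute)
  finally show ?thesis unfolding unit U(3) by simp
qed

lemma mat_unit_mult_eq_zero: "q \<noteq> r \<Longrightarrow> r < n \<Longrightarrow> mat_unit n p q * mat_unit n r s = 0\<^sub>m n n"
  by (rule eq_matI) (auto simp: outer_prod_mult sum_ket)

lemma trace_norm_kron_two_mat_units:
  assumes A: "A \<in> carrier_mat m m" and "p < n" "q < n" "r < n" "s < n" "p \<noteq> r" "q \<noteq> s"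
  shows "trace_norm (kron A (mat_unit n p q + mat_unit n r s)) = 2 * trace_norm A"
proof -
  have "trace_norm (kron A (mat_unit n p q) + kron A (mat_unit n r s)) =
      trace_norm (kron A (mat_unit n p q)) + trace_norm (kron A (mat_unit n r s))"
    using assms
    by (intro trace_norm_kron_add_orthogonal[of A m A _ n]) (simp_all add: adj_outer_prod mat_unit_mult_eq_zero)
  then show ?thesis
    using assms by (simp add: kron_add_right[of _ n n] trace_norm_kron_outer_prod[of _ m] sum_ket)
qed

lemma partial_transpose2_dim [simp]:
  "dim_row (partial_transpose2 n1 n2 X) = n1*n2" "dim_col (partial_transpose2 n1 n2 X) = n1*n2"
  by (simp_all add: partial_transpose2_def)

lemma partial_transpose2_index:
  "i < n1*n2 \<Longrightarrow> j < n1*n2 \<Longrightarrow>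
    partial_transpose2 n1 n2 X $$ (i,j) = X $$ (i div n2 * n2 + j mod n2, j div n2 * n2 + i mod n2)"
  by (simp add: partial_transpose2_def)

lemma partial_transpose2_add:
  assumes "X \<in> carrier_mat (n1*n2) (n1*n2)" "Y \<in> carrier_mat (n1*n2) (n1*n2)"
  shows "partial_transpose2 n1 n2 (X + Y) = partial_transpose2 n1 n2 X + partial_transpose2 n1 n2 Y"
  by (rule eq_matI)
    (use assms in \<open>auto simp: partial_transpose2_def pair_index_less div_index_less mod_index_less\<close>)

lemma partial_transpose2_kron:
  assumes P: "P \<in> carrier_mat m m" and G: "G \<in> carrier_mat (n1*n2) (n1*n2)"
  shows "partial_transpose2 (m*n1) n2 (kron P G) = kron P (partial_transpose2 n1 n2 G)"
proof (rule eq_matI)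
  fix i j
  assume "i < dim_row (kron P (partial_transpose2 n1 n2 G))" "j < dim_col (kron P (partial_transpose2 n1 n2 G))"
  then have ij: "i < m*n1*n2" "j < m*n1*n2" using P by (simp_all add: partial_transpose2_def)
  then have n: "0 < n1" "0 < n2" by (cases n1; cases n2; simp)+
  have swap: "(a div n2 * n2 + b mod n2) div (n1*n2) = a div (n1*n2)"
    "(a div n2 * n2 + b mod n2) mod (n1*n2) = a mod (n1*n2) div n2 * n2 + b mod (n1*n2) mod n2" for a b :: nat
    using n by (simp_all add: mult.commute[of n1 n2] div_mult2_eq mod_mult2_eq)
  have less: "a div n2 * n2 + b mod n2 < m*(n1*n2)" if "a < m*n1*n2" for a b :: nat
    using pair_index_less[of "a div n2" "m*n1" "b mod n2" n2] n that by (simp add: div_index_less mult.assoc)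
  show "partial_transpose2 (m*n1) n2 (kron P G) $$ (i,j) = kron P (partial_transpose2 n1 n2 G) $$ (i,j)"
    using ij n P G less[OF ij(1), of j] less[OF ij(2), of i]
    by (simp add: partial_transpose2_index swap mult.assoc)
qed (use P in \<open>simp_all add: mult.assoc\<close>)

text \<open>An index \<open>p < 4\<close> encodes the basis vector \<open>(p div 2, p mod 2)\<close> of two qubits, the first belonging to
  \<open>B\<close> and the second being \<open>C\<close>. The Bell projectors are not normalised.\<close>

definition bell_plus :: "complex mat" where
  "bell_plus = outer_prod 4 (\<lambda>p. ket 0 p + ket 3 p) (\<lambda>p. ket 0 p + ket 3 p)"

definition bell_minus :: "complex mat" where
  "bell_minus = outer_prod 4 (\<lambda>p. ket 0 p - ket 3 p) (\<lambda>p. ket 0 p - ket 3 p)"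

definition outer_diag :: "complex mat" where
  "outer_diag = mat_unit 4 0 0 + mat_unit 4 3 3"

definition inner_swap :: "complex mat" where
  "inner_swap = mat_unit 4 1 2 + mat_unit 4 2 1"

lemma bell_carrier [simp]:
  "bell_plus \<in> carrier_mat 4 4" "bell_minus \<in> carrier_mat 4 4"
  "outer_diag \<in> carrier_mat 4 4" "inner_swap \<in> carrier_mat 4 4"
  by (simp_all add: bell_plus_def bell_minus_def outer_diag_def inner_swap_def)

lemmas bell_dim [simp] = bell_carrier[THEN carrier_matD(1)] bell_carrier[THEN carrier_matD(2)]

lemma partial_transpose2_bell:
  "partial_transpose2 2 2 bell_plus = outer_diag + inner_swap"
  "partial_transpose2 2 2 bell_minus = outer_diag - inner_swap"
proof -
  have entry: "partial_transpose2 2 2 bell_plus $$ (i,j) = (outer_diag + inner_swap) $$ (i,j) \<and>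
      partial_transpose2 2 2 bell_minus $$ (i,j) = (outer_diag - inner_swap) $$ (i,j)"
    if "i < 4" "j < 4" for i j
  proof -
    have "i = 0 \<or> i = 1 \<or> i = 2 \<or> i = 3" "j = 0 \<or> j = 1 \<or> j = 2 \<or> j = 3" using that by auto
    then show ?thesis
      by (elim disjE)
        (simp_all add: partial_transpose2_def bell_plus_def bell_minus_def outer_diag_def inner_swap_def
          ket_def)
  qed
  show "partial_transpose2 2 2 bell_plus = outer_diag + inner_swap"
    "partial_transpose2 2 2 bell_minus = outer_diag - inner_swap"
    by (rule eq_matI; simp add: entry)+
qed

lemma outer_diag_orthogonal_inner_swap:
  "adj outer_diag * inner_swap = 0\<^sub>m 4 4" "outer_diag * adj inner_swap = 0\<^sub>m 4 4"
  by (simp_all add: outer_diag_def inner_swap_def adj_add[of _ 4 4] adj_outer_prod mat_unit_mult_eq_zero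
      mult_add_distrib_mat[of _ 4 4 _ 4] add_mult_distrib_mat[of _ 4 4 _ _ 4])

definition bell_mix :: "complex mat \<Rightarrow> complex mat \<Rightarrow> complex mat" where
  "bell_mix P N = kron P bell_plus + kron N bell_minus"

lemma partial_transpose2_bell_mix:
  assumes P: "P \<in> carrier_mat m m" and N: "N \<in> carrier_mat m m"
  shows "partial_transpose2 (m*2) 2 (bell_mix P N) = kron (P + N) outer_diag + kron (P - N) inner_swap"
proof -
  have "partial_transpose2 (m*2) 2 (bell_mix P N) =
      kron P (outer_diag + inner_swap) + kron N (outer_diag - inner_swap)"
    using partial_transpose2_add[of "kron P bell_plus" "m*2" 2 "kron N bell_minus"]
      kron_carrier[OF P, of _ 4 4] kron_carrier[OF N, of _ 4 4]
    by (simp add: bell_mix_def mult.assoc partial_transpose2_bell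
        partial_transpose2_kron[OF P, of _ 2 2] partial_transpose2_kron[OF N, of _ 2 2])
  also have "\<dots> = kron (P + N) outer_diag + kron (P - N) inner_swap"
    using P N
    by (simp add: kron_add_right[of _ 4 4] kron_minus_right[of _ 4 4]
        kron_add_left[of _ m m] kron_minus_left[of _ m m])
      (rule eq_matI, auto)
  finally show ?thesis .
qed

lemma negativity_bell_mix:
  assumes P: "P \<in> carrier_mat m m" and N: "N \<in> carrier_mat m m"
  shows "negativity (m*2) 2 (bell_mix P N) = trace_norm (P + N) + trace_norm (P - N) - 1 / 2"
proof -
  have "trace_norm (kron (P + N) outer_diag + kron (P - N) inner_swap) =
      trace_norm (kron (P + N) outer_diag) + trace_norm (kron (P - N) inner_swap)"
    using P N outer_diag_orthogonal_inner_swap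
    by (intro trace_norm_kron_add_orthogonal[of _ m _ _ 4]) (simp_all add: minus_carrier_mat)
  also have "\<dots> = 2 * trace_norm (P + N) + 2 * trace_norm (P - N)"
    unfolding outer_diag_def inner_swap_def using P N
    by (simp add: trace_norm_kron_two_mat_units[of _ m] minus_carrier_mat)
  finally show ?thesis
    unfolding negativity_def partial_transpose2_bell_mix[OF P N] by (simp add: field_simps)
qed

lemma density_bell_mix:
  assumes P: "psd m P" and N: "psd m N" and tr: "mtrace (P + N) = 1 / 2"
  shows "density (m*4) (bell_mix P N)"
proof -
  have "psd (m*4) (bell_mix P N)"
    unfolding bell_mix_def bell_plus_def bell_minus_def
    by (intro psd_add psd_kron_outer_prod P N)
  moreover have "mtrace bell_plus = 2" "mtrace bell_minus = 2"
    by (simp_all add: bell_plus_def bell_minus_def mtrace_def eval_nat_numeral)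
  then have "mtrace (bell_mix P N) = 2 * mtrace (P + N)"
    using psd_carrier[OF P] psd_carrier[OF N]
    by (simp add: bell_mix_def mtrace_add[of _ "m*4"] mtrace_add[of _ m] mtrace_kron[of _ m _ 4] algebra_simps)
  ultimately show ?thesis using tr by (simp add: density_def)
qed

lemma negativity_ampl_bell_mix:
  assumes \<Phi>: "CPTP d \<Phi>" and m: "0 < m" and P: "psd (d*m) P" and N: "psd (d*m) N"
    and tr: "mtrace (P + N) = 1 / 2"
  shows "negativity (d*(m*2)) 2 (ampl \<Phi> d (m*2*2) (bell_mix P N)) = trace_norm (ampl \<Phi> d m (P - N))"
proof -
  note L = CPTP_linear[OF \<Phi>] and L' = linear_map_on_ampl[OF CPTP_linear[OF \<Phi>]]
  note carrier = P[THEN psd_carrier] N[THEN psd_carrier]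
  have "ampl \<Phi> d (m*4) (bell_mix P N) = bell_mix (ampl \<Phi> d m P) (ampl \<Phi> d m N)"
    using linear_map_on_add[OF L'[of "m*4"], of "kron P bell_plus" "kron N bell_minus"]
      kron_carrier[OF carrier(1), of _ 4 4] kron_carrier[OF carrier(2), of _ 4 4]
    by (simp add: bell_mix_def ampl_kron[OF L carrier(1)] ampl_kron[OF L carrier(2)] mult.assoc)
  then have "negativity (d*(m*2)) 2 (ampl \<Phi> d (m*2*2) (bell_mix P N)) =
      trace_norm (ampl \<Phi> d m (P + N)) + trace_norm (ampl \<Phi> d m (P - N)) - 1 / 2"
    using negativity_bell_mix[of "ampl \<Phi> d m P" "d*m" "ampl \<Phi> d m N"]
    by (simp add: mult.assoc linear_map_on_add[OF L' carrier] linear_map_on_minus[OF L' carrier])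
  also have "trace_norm (ampl \<Phi> d m (P + N)) = Re (mtrace (ampl \<Phi> d m (P + N)))"
    by (rule trace_norm_psd[OF CPTP_ampl_psd[OF \<Phi> m psd_add[OF P N]]])
  also have "mtrace (ampl \<Phi> d m (P + N)) = 1 / 2"
    using CPTP_ampl_mtrace[OF \<Phi>, of "P + N" m] carrier tr by simp
  finally show ?thesis by simp
qed

lemma hermitian_eq_normalized_psd_difference:
  assumes X: "hermitian n X" and "0 < n"
  obtains k P N where "0 < k" "psd n P" "psd n N" "mtrace (P + N) = 1 / 2" "P - N = complex_of_real k \<cdot>\<^sub>m X"
proof -
  define c where "c = entry_norm n X + 1"
  define A B where "A = X + complex_of_real c \<cdot>\<^sub>m 1\<^sub>m n" and "B = complex_of_real c \<cdot>\<^sub>m (1\<^sub>m n :: complex mat)"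
  define k where "k = 1 / (2 * Re (mtrace (A + B)))"
  have c: "0 < c" using entry_norm_nonneg[of n X] by (simp add: c_def)
  have A: "psd n A" unfolding A_def by (rule psd_add_smult_one[OF X]) (simp add: c_def)
  have B: "psd n B" unfolding B_def using c by (intro psd_smult psd_one) simp
  note carrier = A[THEN psd_carrier] B[THEN psd_carrier] hermitian_carrier[OF X]
  have "Re (mtrace B) = c * real n" by (simp add: B_def mtrace_smult[of _ n] mtrace_one)
  then have "0 < Re (mtrace (A + B))"
    using psd_mtrace[OF A] c \<open>0 < n\<close> carrier by (simp add: mtrace_add[of _ n] add_nonneg_pos)
  then have k: "0 < k" by (simp add: k_def)
  have "Im (mtrace (A + B)) = 0" by (rule Im_mtrace_hermitian[OF psd_hermitian[OF psd_add[OF A B]]])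
  then have "mtrace (A + B) = complex_of_real (1 / (2 * k))" by (simp add: k_def complex_eq_iff)
  then have "mtrace (complex_of_real k \<cdot>\<^sub>m A + complex_of_real k \<cdot>\<^sub>m B) = 1 / 2"
    using carrier k by (simp add: mtrace_add[of _ n] mtrace_smult[of _ n] distrib_left[symmetric])
  moreover have "complex_of_real k \<cdot>\<^sub>m A - complex_of_real k \<cdot>\<^sub>m B = complex_of_real k \<cdot>\<^sub>m X"
    using carrier by (intro eq_matI) (auto simp: A_def B_def algebra_simps)
  ultimately show ?thesis using that k psd_smult[OF A, of k] psd_smult[OF B, of k] by simp
qed

lemma exists_density_negativity_eq_trace_norm:
  assumes "0 < d" "0 < m" and X: "hermitian (d*m) X"
  obtains \<rho> k where "density (d*(m*2)*2) \<rho>" "0 < k"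
    "\<And>\<Phi>. CPTP d \<Phi> \<Longrightarrow> negativity (d*(m*2)) 2 (ampl \<Phi> d (m*2*2) \<rho>) = k * trace_norm (ampl \<Phi> d m X)"
proof -
  obtain k P N where k: "0 < k" and PN: "psd (d*m) P" "psd (d*m) N" "mtrace (P + N) = 1 / 2"
    "P - N = complex_of_real k \<cdot>\<^sub>m X"
    using hermitian_eq_normalized_psd_difference[OF X] assms by auto
  have "density (d*(m*2)*2) (bell_mix P N)" using density_bell_mix[OF PN(1-3)] by (simp add: mult.assoc)
  moreover have "negativity (d*(m*2)) 2 (ampl \<Phi> d (m*2*2) (bell_mix P N)) = k * trace_norm (ampl \<Phi> d m X)"
    if \<Phi>: "CPTP d \<Phi>" for \<Phi>
    using negativity_ampl_bell_mix[OF \<Phi> \<open>0 < m\<close> PN(1-3)] trace_norm_smult[OF ampl_carrier, of k \<Phi> d m X] k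
    by (simp add: PN(4)
        linear_map_on_smult[OF linear_map_on_ampl[OF CPTP_linear[OF \<Phi>]] hermitian_carrier[OF X]])
  ultimately show ?thesis using that k by blast
qed

section \<open>Right derivatives\<close>

lemma le_if_right_derivative_neg:
  fixes f :: "real \<Rightarrow> real"
  assumes "s \<le> t" and cont: "continuous_on {s..t} f"
    and der: "\<And>x. s \<le> x \<Longrightarrow> x < t \<Longrightarrow> \<exists>D<0. (f has_real_derivative D) (at_right x)"
  shows "f t \<le> f s"
proof -
  define Z where "Z = {x\<in>{s..t}. f x \<le> f s}"
  have "Z = {s..t} \<inter> f -` {..f s}" by (auto simp: Z_def)
  then have "closed Z" using cont by (simp add: continuous_closed_preimage)
  moreover have "s \<in> Z" "bdd_above Z" using \<open>s \<le> t\<close> by (auto simp: Z_def bdd_above_def)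
  ultimately have sup: "Sup Z \<in> Z" using closed_contains_Sup[of Z] by auto
  have "Sup Z = t"
  proof (rule ccontr)
    assume "Sup Z \<noteq> t"
    then have less: "Sup Z < t" using sup by (simp add: Z_def)
    then obtain D where "D < 0" "(f has_real_derivative D) (at_right (Sup Z))"
      using der sup by (auto simp: Z_def)
    then obtain e where e: "0 < e" "\<And>h. 0 < h \<Longrightarrow> h < e \<Longrightarrow> f (Sup Z + h) < f (Sup Z)"
      using has_real_derivative_neg_dec_right by (metis greaterThan_iff less_add_same_cancel1)
    define h where "h = min e (t - Sup Z) / 2"
    have h: "0 < h" "h < e" "Sup Z + h \<le> t" using e less by (auto simp: h_def min_def field_simps)
    then have "Sup Z + h \<in> Z" using e(2)[OF h(1,2)] sup by (auto simp: Z_def)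
    then have "Sup Z + h \<le> Sup Z" using \<open>bdd_above Z\<close> by (rule cSup_upper)
    then show False using h by simp
  qed
  then show ?thesis using sup by (simp add: Z_def)
qed

lemma le_if_right_derivative_nonpos:
  fixes f :: "real \<Rightarrow> real"
  assumes "s \<le> t" and cont: "continuous_on {s..t} f"
    and der: "\<And>x. s \<le> x \<Longrightarrow> x < t \<Longrightarrow> \<exists>D\<le>0. (f has_real_derivative D) (at_right x)"
  shows "f t \<le> f s"
proof (rule field_le_epsilon)
  fix e :: real assume "0 < e"
  define c where "c = e / (t - s + 1)"
  have c: "0 < c" "c * (t - s) \<le> e"
    using \<open>0 < e\<close> \<open>s \<le> t\<close> by (auto simp: c_def field_simps)
  have "f t - c * t \<le> f s - c * s"
  proof (rule le_if_right_derivative_neg[OF \<open>s \<le> t\<close>])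
    show "continuous_on {s..t} (\<lambda>x. f x - c * x)" by (intro continuous_intros cont)
    fix x assume "s \<le> x" "x < t"
    then obtain D where "D \<le> 0" "(f has_real_derivative D) (at_right x)" using der by blast
    then have "((\<lambda>x. f x - c * x) has_real_derivative D - c) (at_right x)" "D - c < 0"
      using c by (auto intro!: derivative_eq_intros)
    then show "\<exists>D<0. ((\<lambda>x. f x - c * x) has_real_derivative D) (at_right x)" by blast
  qed
  then show "f t \<le> f s + e" using c(2) by (simp add: algebra_simps)
qed

lemma convex_on_has_right_derivative:
  assumes f: "convex_on UNIV f"
  obtains D where "(f has_real_derivative D) (at_right x)"
proof -
  define slope where "slope = (\<lambda>y. (f y - f x) / (y - x))"
  have mono: "slope a \<le> slope b" if "x < a" "a \<le> b" for a b
  proof (cases "a = b")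
    case False
    have "(f x - f a) / (x - a) \<le> (f x - f b) / (x - b)"
      using f False that by (intro convex_on_slope_le(1)) auto
    then show ?thesis by (metis slope_def minus_diff_eq minus_divide_divide)
  qed simp
  have bound: "f x - f (x - 1) \<le> slope a" if "x < a" for a
  proof -
    have "f x - f (x - 1) = (f (x - 1) - f x) / ((x - 1) - x)" by simp
    also have "\<dots> \<le> (f (x - 1) - f a) / ((x - 1) - a)"
      using f that by (intro convex_on_slope_le(1)) auto
    also have "\<dots> \<le> (f x - f a) / (x - a)"
      using f that by (intro convex_on_slope_le(2)) auto
    also have "\<dots> = slope a" by (metis slope_def minus_diff_eq minus_divide_divide)
    finally show ?thesis .
  qed
  have "(slope \<longlongrightarrow> Inf (slope ` {x<..})) (at_right x)"
    using Lim_right_bound[of UNIV x slope "f x - f (x - 1)"] mono bound by simp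
  then have "(f has_real_derivative Inf (slope ` {x<..})) (at_right x)"
    by (simp add: has_field_derivative_iff slope_def)
  then show ?thesis by (rule that)
qed

lemma convex_on_trace_norm_line:
  assumes A: "A \<in> carrier_mat n n" and Y: "Y \<in> carrier_mat n n"
  shows "convex_on UNIV (\<lambda>h. trace_norm (A + complex_of_real h \<cdot>\<^sub>m Y))"
proof (rule convex_onI)
  fix t h k :: real assume t: "0 < t" "t < 1"
  define L where "L h = A + complex_of_real h \<cdot>\<^sub>m Y" for h
  have L: "L h \<in> carrier_mat n n" for h using A Y by (simp add: L_def)
  have "L ((1 - t) *\<^sub>R h + t *\<^sub>R k) = complex_of_real (1 - t) \<cdot>\<^sub>m L h + complex_of_real t \<cdot>\<^sub>m L k"
    using A Y by (intro eq_matI) (auto simp: L_def algebra_simps)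
  then show "trace_norm (L ((1 - t) *\<^sub>R h + t *\<^sub>R k)) \<le> (1 - t) * trace_norm (L h) + t * trace_norm (L k)"
    using trace_norm_triangle[of "complex_of_real (1 - t) \<cdot>\<^sub>m L h" n "complex_of_real t \<cdot>\<^sub>m L k"] L t
      trace_norm_smult[OF L, of "1 - t" h] trace_norm_smult[OF L, of t k] by simp
qed simp

lemma mat_first_order_expansion:
  fixes X :: "real \<Rightarrow> complex mat"
  assumes X: "\<And>s. X s \<in> carrier_mat n n"
    and diff: "\<And>i j. i < n \<Longrightarrow> j < n \<Longrightarrow> (\<lambda>s. X s $$ (i,j)) differentiable (at_right t)"
  obtains Y where "Y \<in> carrier_mat n n"
    "mat_tendsto n (\<lambda>s. complex_of_real (1 / norm (s - t)) \<cdot>\<^sub>m (X s - (X t + complex_of_real (s - t) \<cdot>\<^sub>m Y)))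
      (0\<^sub>m n n) (at_right t)"
proof
  define Y where "Y = mat n n (\<lambda>(i,j). vector_derivative (\<lambda>s. X s $$ (i,j)) (at_right t))"
  show Y: "Y \<in> carrier_mat n n" by (simp add: Y_def)
  define R where "R s = complex_of_real (1 / norm (s - t)) \<cdot>\<^sub>m (X s - (X t + complex_of_real (s - t) \<cdot>\<^sub>m Y))"
    for s
  show "mat_tendsto n R (0\<^sub>m n n) (at_right t)"
    unfolding mat_tendsto_def
  proof (intro allI impI)
    fix i j assume ij: "i < n" "j < n"
    define x where "x s = X s $$ (i,j)" for s
    have "((\<lambda>s. (1 / norm (s - t)) *\<^sub>R (x s - (x t + (s - t) *\<^sub>R Y $$ (i,j)))) \<longlongrightarrow> 0) (at_right t)"
      using diff[OF ij] ij
      by (simp add: vector_derivative_works has_vector_derivative_def has_derivative_within Y_def x_def)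
    moreover have "R s $$ (i,j) = (1 / norm (s - t)) *\<^sub>R (x s - (x t + (s - t) *\<^sub>R Y $$ (i,j)))" for s
      using ij X Y carrier_matD[OF X] by (simp add: R_def x_def scaleR_conv_of_real)
    ultimately show "((\<lambda>s. R s $$ (i,j)) \<longlongrightarrow> 0\<^sub>m n n $$ (i,j)) (at_right t)" using ij by simp
  qed
qed

lemma trace_norm_difference_quotient_tendsto_zero:
  assumes X: "\<And>s. X s \<in> carrier_mat n n" and T: "\<And>s. T s \<in> carrier_mat n n"
    and lim: "mat_tendsto n (\<lambda>s. complex_of_real (1 / norm (s - t)) \<cdot>\<^sub>m (X s - T s)) (0\<^sub>m n n) F"
  shows "((\<lambda>s. (trace_norm (X s) - trace_norm (T s)) / (s - t)) \<longlongrightarrow> 0) F"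
proof (rule Lim_null_comparison[rotated])
  define R where "R s = complex_of_real (1 / norm (s - t)) \<cdot>\<^sub>m (X s - T s)" for s
  show "((\<lambda>s. entry_norm n (R s)) \<longlongrightarrow> 0) F"
    using tendsto_entry_norm[OF lim] by (simp add: entry_norm_def R_def)
  have "norm ((trace_norm (X s) - trace_norm (T s)) / (s - t)) \<le> entry_norm n (R s)" for s
  proof -
    have "norm ((trace_norm (X s) - trace_norm (T s)) / (s - t)) \<le> entry_norm n (X s - T s) / norm (s - t)"
      using trace_norm_lipschitz[OF X T, of s s] by (simp add: divide_right_mono)
    also have "\<dots> = entry_norm n (R s)"
      using entry_norm_smult[OF minus_carrier_mat[OF T]] by (simp add: R_def norm_divide)
    finally show ?thesis .
  qed
  then show "eventually (\<lambda>s. norm ((trace_norm (X s) - trace_norm (T s)) / (s - t)) \<le> entry_norm n (R s)) F"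
    by simp
qed

text \<open>Along the tangent the trace norm is convex, hence has a right derivative; by the Lipschitz bound
  replacing the path by its tangent does not change it.\<close>

lemma trace_norm_has_right_derivative:
  fixes X :: "real \<Rightarrow> complex mat"
  assumes X: "\<And>s. X s \<in> carrier_mat n n"
    and diff: "\<And>i j. i < n \<Longrightarrow> j < n \<Longrightarrow> (\<lambda>s. X s $$ (i,j)) differentiable (at_right t)"
  obtains D where "((\<lambda>s. trace_norm (X s)) has_real_derivative D) (at_right t)"
proof -
  obtain Y where Y: "Y \<in> carrier_mat n n"
    and expansion: "mat_tendsto n
      (\<lambda>s. complex_of_real (1 / norm (s - t)) \<cdot>\<^sub>m (X s - (X t + complex_of_real (s - t) \<cdot>\<^sub>m Y)))
      (0\<^sub>m n n) (at_right t)"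
    by (rule mat_first_order_expansion[OF X diff])
  define T where "T s = X t + complex_of_real (s - t) \<cdot>\<^sub>m Y" for s
  have T: "T s \<in> carrier_mat n n" for s using X Y by (simp add: T_def)
  have T_t: "T t = X t" using X[of t] Y by (intro eq_matI) (auto simp: T_def)
  have error: "((\<lambda>s. (trace_norm (X s) - trace_norm (T s)) / (s - t)) \<longlongrightarrow> 0) (at_right t)"
    by (rule trace_norm_difference_quotient_tendsto_zero[OF X T expansion[folded T_def]])
  obtain D where "((\<lambda>h. trace_norm (X t + complex_of_real h \<cdot>\<^sub>m Y)) has_real_derivative D) (at_right 0)"
    using convex_on_has_right_derivative[OF convex_on_trace_norm_line[OF X Y]] by blast
  then have "((\<lambda>h. (trace_norm (T (h + t)) - trace_norm (T t)) / h) \<longlongrightarrow> D) (at_right 0)"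
    by (simp add: has_field_derivative_iff T_def)
  then have "((\<lambda>s. (trace_norm (T s) - trace_norm (T t)) / (s - t)) \<longlongrightarrow> D) (at_right t)"
    unfolding filterlim_at_right_to_0[of _ _ t] by simp
  from tendsto_add[OF error this] have "((\<lambda>s. trace_norm (X s)) has_real_derivative D) (at_right t)"
    by (simp add: has_field_derivative_iff T_t flip: add_divide_distrib)
  then show ?thesis by (rule that)
qed

section \<open>Monotonicity of the trace norm along the evolution\<close>

definition negativity_increases :: "nat \<Rightarrow> (real \<Rightarrow> complex mat \<Rightarrow> complex mat) \<Rightarrow> bool" where
  "negativity_increases d \<Lambda> \<longleftrightarrow>
     (\<exists>dB dC \<rho> t D. dB > 0 \<and> dC > 0 \<and> density (d*dB*dC) \<rho> \<and> t > 0 \<and> D > 0 \<and>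
       ((\<lambda>s. negativity (d*dB) dC (ampl (\<Lambda> s) d (dB*dC) \<rho>)) has_real_derivative D) (at_right t))"

lemma negativity_increases_if_trace_norm_increases:
  assumes "0 < d" "0 < m" and \<Lambda>: "\<And>t. t \<ge> 0 \<Longrightarrow> CPTP d (\<Lambda> t)" and X: "hermitian (d*m) X"
    and "0 < t" "0 < D" and der: "((\<lambda>s. trace_norm (ampl (\<Lambda> s) d m X)) has_real_derivative D) (at_right t)"
  shows "negativity_increases d \<Lambda>"
proof -
  obtain \<rho> k where \<rho>: "density (d*(m*2)*2) \<rho>" "0 < k"
    "\<And>\<Phi>. CPTP d \<Phi> \<Longrightarrow> negativity (d*(m*2)) 2 (ampl \<Phi> d (m*2*2) \<rho>) = k * trace_norm (ampl \<Phi> d m X)"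
    using exists_density_negativity_eq_trace_norm[OF \<open>0 < d\<close> \<open>0 < m\<close> X] by blast
  have "eventually (\<lambda>s. negativity (d*(m*2)) 2 (ampl (\<Lambda> s) d (m*2*2) \<rho>) = k * trace_norm (ampl (\<Lambda> s) d m X))
      (at_right t)"
    using eventually_at_right_less[of t] by eventually_elim (use \<open>0 < t\<close> \<rho>(3) \<Lambda> in auto)
  then have "((\<lambda>s. negativity (d*(m*2)) 2 (ampl (\<Lambda> s) d (m*2*2) \<rho>)) has_real_derivative k * D) (at_right t)"
    by (rule has_field_derivative_cong_eventually[THEN iffD2, OF _ _ DERIV_cmult[OF der]])
      (use \<open>0 < t\<close> \<rho>(3)[OF \<Lambda>, of t] in simp)
  then show ?thesis
    unfolding negativity_increases_def
    using \<rho>(1,2) \<open>0 < m\<close> \<open>0 < t\<close> \<open>0 < D\<close>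
    by (intro exI[of _ "m*2"] exI[of _ 2] exI[of _ \<rho>] exI[of _ t] exI[of _ "k * D"]) simp
qed

lemma trace_norm_dominated_if_not_negativity_increases:
  fixes \<Lambda> :: "real \<Rightarrow> complex mat \<Rightarrow> complex mat"
  assumes "0 < d" and \<Lambda>: "\<And>t. t \<ge> 0 \<Longrightarrow> CPTP d (\<Lambda> t)"
    and diff: "\<And>t X i j. t \<ge> 0 \<Longrightarrow> X \<in> carrier_mat d d \<Longrightarrow> i < d \<Longrightarrow> j < d \<Longrightarrow>
           (\<lambda>s. \<Lambda> s X $$ (i,j)) differentiable (at t within {0..})"
    and "\<not> negativity_increases d \<Lambda>" and st: "0 < s" "s \<le> t"
  shows "trace_norm_dominated d (\<Lambda> t) (\<Lambda> s)"
  unfolding trace_norm_dominated_def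
proof (intro allI impI)
  fix m X assume m: "0 < m" and X: "hermitian (d*m) X"
  have entry_diff: "(\<lambda>v. ampl (\<Lambda> v) d m X $$ (i,j)) differentiable (at u within {0..})"
    if "u \<ge> 0" "i < d*m" "j < d*m" for u i j
    using diff[OF \<open>u \<ge> 0\<close> block_carrier, of "i div m" "j div m"] that by (simp add: ampl_eq div_index_less)
  show "trace_norm (ampl (\<Lambda> t) d m X) \<le> trace_norm (ampl (\<Lambda> s) d m X)"
  proof (rule le_if_right_derivative_nonpos[OF st(2)])
    show "continuous_on {s..t} (\<lambda>u. trace_norm (ampl (\<Lambda> u) d m X))"
      unfolding continuous_on_def
    proof
      fix u assume "u \<in> {s..t}"
      then have "((\<lambda>v. ampl (\<Lambda> v) d m X $$ (i,j)) \<longlongrightarrow> ampl (\<Lambda> u) d m X $$ (i,j)) (at u within {s..t})"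
        if "i < d*m" "j < d*m" for i j
        using differentiable_imp_continuous_within[OF entry_diff[of u i j]] that st
        by (auto simp: continuous_within intro: tendsto_within_subset)
      then show "((\<lambda>u. trace_norm (ampl (\<Lambda> u) d m X)) \<longlongrightarrow> trace_norm (ampl (\<Lambda> u) d m X)) (at u within {s..t})"
        by (intro tendsto_trace_norm[of _ "d*m"]) (auto simp: mat_tendsto_def)
    qed
    fix u assume u: "s \<le> u" "u < t"
    have "(\<lambda>v. ampl (\<Lambda> v) d m X $$ (i,j)) differentiable (at_right u)" if "i < d*m" "j < d*m" for i j
      by (rule differentiable_within_subset[OF entry_diff[OF _ that]]) (use u st in auto)
    then obtain D where D: "((\<lambda>v. trace_norm (ampl (\<Lambda> v) d m X)) has_real_derivative D) (at_right u)"
      using trace_norm_has_right_derivative[of "\<lambda>v. ampl (\<Lambda> v) d m X" "d*m" u] by auto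
    have "D \<le> 0"
      using negativity_increases_if_trace_norm_increases[OF \<open>0 < d\<close> m \<Lambda> X _ _ D] assms(4) u st by force
    then show "\<exists>D\<le>0. ((\<lambda>v. trace_norm (ampl (\<Lambda> v) d m X)) has_real_derivative D) (at_right u)"
      using D by blast
  qed
qed

section \<open>Two-by-two matrices\<close>

lemma sum_lessThan_2: "(\<Sum>i<2. f i) = f 0 + f (1::nat)" for f :: "nat \<Rightarrow> 'a::comm_monoid_add"
  by (simp add: numeral_2_eq_2)

lemma eq_mat_2I:
  assumes "A \<in> carrier_mat 2 2" "B \<in> carrier_mat 2 2" "A $$ (0,0) = B $$ (0,0)" "A $$ (0,1) = B $$ (0,1)"
    "A $$ (1,0) = B $$ (1,0)" "A $$ (1,1) = B $$ (1,1)"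
  shows "A = B"
  using assms by (intro eq_matI) (auto simp: less_2_cases_iff)

lemma mtrace_2: "A \<in> carrier_mat 2 2 \<Longrightarrow> mtrace A = A $$ (0,0) + A $$ (1,1)"
  by (simp add: mtrace_eq[of _ 2] sum_lessThan_2)

lemma det_2:
  assumes A: "A \<in> carrier_mat 2 2"
  shows "det A = A $$ (0,0) * A $$ (1,1) - A $$ (0,1) * A $$ (1,0)"
proof -
  have minor: "det (mat_delete A 0 j) = A $$ (1, 1 - j)" if "j < 2" for j
    using A that det_single[of "mat_delete A 0 j"] mat_delete_carrier[of A 1 1 0 j]
    by (auto simp: mat_delete_def less_2_cases_iff numeral_2_eq_2)
  show ?thesis
    using laplace_expansion_row[OF A, of 0] by (simp add: sum_lessThan_2 cofactor_def minor)
qed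

lemma cayley_hamilton_2:
  assumes A: "A \<in> carrier_mat 2 2"
  shows "A * A = mtrace A \<cdot>\<^sub>m A - det A \<cdot>\<^sub>m 1\<^sub>m 2"
  using A by (intro eq_mat_2I) (auto simp: mult_mat_index sum_lessThan_2 mtrace_2 det_2 algebra_simps)

lemma mtrace_square_2:
  assumes A: "A \<in> carrier_mat 2 2"
  shows "mtrace (A * A) = (mtrace A)\<^sup>2 - 2 * det A"
  unfolding cayley_hamilton_2[OF A] using A
  by (simp add: mtrace_minus[of _ 2] mtrace_smult[of _ 2] mtrace_one power2_eq_square)

lemma det_lincomb_2:
  assumes "A \<in> carrier_mat 2 2" "B \<in> carrier_mat 2 2"
  shows "det (x \<cdot>\<^sub>m A + y \<cdot>\<^sub>m B) =
    x\<^sup>2 * det A + x * y * (mtrace A * mtrace B - mtrace (A * B)) + y\<^sup>2 * det B"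
  using assms by (simp add: det_2 mtrace_2 mult_mat_index sum_lessThan_2 power2_eq_square algebra_simps)

lemma det_adj_2: "A \<in> carrier_mat 2 2 \<Longrightarrow> det (adj A) = cnj (det A)"
  by (simp add: det_2)

lemma det_hermitian_2: "hermitian 2 A \<Longrightarrow> det A = of_real (Re (det A))"
  using det_adj_2[of A] by (simp add: hermitian_def complex_eq_iff)

lemma psd_det_2:
  assumes A: "psd 2 A"
  shows "0 \<le> Re (det A)"
proof -
  have "A $$ (1,0) = cnj (A $$ (0,1))" using hermitian_index[OF psd_hermitian[OF A], of 0 1] by simp
  then have "Re (det A) = Re (A $$ (0,0)) * Re (A $$ (1,1)) - (cmod (A $$ (0,1)))\<^sup>2"
    using psd_diag[OF A] psd_carrier[OF A] by (simp add: det_2 cmod_power2) (simp add: power2_eq_square)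
  then show ?thesis using psd_minor_nonneg[OF A, of 0 1] by simp
qed

lemma trace_norm_2:
  assumes X: "X \<in> carrier_mat 2 2"
  shows "(trace_norm X)\<^sup>2 = Re (mtrace (adj X * X)) + 2 * cmod (det X)"
proof -
  obtain U where U: "psd 2 (U * X)" "trace_norm X = Re (mtrace (U * X))" "(U * X) * (U * X) = adj X * X"
    using trace_norm_attained[OF X] by metis
  define S where "S = U * X"
  have S: "psd 2 S" "trace_norm X = Re (mtrace S)" "S * S = adj X * X" using U by (simp_all add: S_def)
  note carrier = psd_carrier[OF S(1)]
  have "complex_of_real ((cmod (det S))\<^sup>2) = det (S * S)"
    using det_hermitian_2[OF psd_hermitian[OF S(1)]] det_mult[OF carrier carrier]
    by (metis norm_of_real of_real_mult power2_abs power2_eq_square)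
  also have "\<dots> = complex_of_real ((cmod (det X))\<^sup>2)"
    unfolding S(3) using X
    by (simp add: det_mult[of _ 2] det_adj_2 complex_norm_square mult.commute del: of_real_power)
  finally have "(cmod (det S))\<^sup>2 = (cmod (det X))\<^sup>2" by (simp only: of_real_eq_iff)
  then have "cmod (det S) = cmod (det X)" by simp
  then have det_S: "Re (det S) = cmod (det X)"
    using det_hermitian_2[OF psd_hermitian[OF S(1)]] psd_det_2[OF S(1)] by (metis norm_of_real abs_of_nonneg)
  have "mtrace S = of_real (Re (mtrace S))"
    using Im_mtrace_hermitian[OF psd_hermitian[OF S(1)]] by (simp add: complex_eq_iff)
  then have "(Re (mtrace S))\<^sup>2 = Re ((mtrace S)\<^sup>2)" by (metis Re_complex_of_real of_real_power)
  then show ?thesis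
    using mtrace_square_2[OF carrier] unfolding S(2,3) det_S[symmetric] by simp
qed

lemma trace_norm_hermitian_2:
  assumes X: "hermitian 2 X"
  shows "(trace_norm X)\<^sup>2 = (Re (mtrace X))\<^sup>2 - 2 * Re (det X) + 2 * \<bar>Re (det X)\<bar>"
proof -
  have "mtrace X = of_real (Re (mtrace X))"
    using Im_mtrace_hermitian[OF X] by (simp add: complex_eq_iff)
  then have "(Re (mtrace X))\<^sup>2 = Re ((mtrace X)\<^sup>2)" by (metis Re_complex_of_real of_real_power)
  moreover have "cmod (det X) = \<bar>Re (det X)\<bar>" using det_hermitian_2[OF X] by (metis norm_of_real)
  moreover have "adj X = X" using X by (simp add: hermitian_def)
  ultimately show ?thesis
    using trace_norm_2[OF hermitian_carrier[OF X]] mtrace_square_2[OF hermitian_carrier[OF X]] by simp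
qed

lemma det_mono_if_trace_norm_le:
  assumes Y: "hermitian 2 Y" and Z: "hermitian 2 Z" and tr: "mtrace Y = mtrace Z"
    and le: "trace_norm Y \<le> trace_norm Z" and det: "Re (det Z) \<le> 0"
  shows "Re (det Z) \<le> Re (det Y)"
proof -
  have "(trace_norm Y)\<^sup>2 \<le> (trace_norm Z)\<^sup>2"
    using le trace_norm_nonneg[OF hermitian_carrier[OF Y]] by (rule power_mono)
  then show ?thesis
    unfolding trace_norm_hermitian_2[OF Y] trace_norm_hermitian_2[OF Z] using tr det by simp
qed

lemma traceless_hermitian_det_neg:
  assumes H: "hermitian 2 H" "mtrace H = 0" "H \<noteq> 0\<^sub>m 2 2"
  shows "Re (det H) < 0"
proof -
  have psd: "psd 2 (H * H)"
    using psd_adj_mult_self[OF hermitian_carrier[OF H(1)]] H(1) by (simp add: hermitian_def)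
  have "H * H \<noteq> 0\<^sub>m 2 2" using hermitian_square_eq_zero[OF H(1)] H(3) by blast
  then have "0 < Re (mtrace (H * H))"
    using psd_mtrace[OF psd] psd_eq_zero_if_mtrace_zero[OF psd] by fastforce
  then show ?thesis using mtrace_square_2[OF hermitian_carrier[OF H(1)]] H(2) by simp
qed

lemma det_density_diff_2:
  assumes A: "hermitian 2 A" "mtrace A = 1" and B: "hermitian 2 B" "mtrace B = 1"
  shows "Re (det (of_real 1 \<cdot>\<^sub>m A + of_real (- x) \<cdot>\<^sub>m B)) =
    Re (det A) - x * (1 - Re (mtrace (A * B))) + x\<^sup>2 * Re (det B)"
  unfolding det_lincomb_2[OF hermitian_carrier[OF A(1)] hermitian_carrier[OF B(1)]] using A(2) B(2)
  by (simp flip: of_real_power)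

definition pure_qubit :: "complex mat \<Rightarrow> bool" where
  "pure_qubit P \<longleftrightarrow> hermitian 2 P \<and> mtrace P = 1 \<and> det P = 0"

lemma pure_qubitD:
  assumes "pure_qubit P"
  shows "hermitian 2 P" "mtrace P = 1" "det P = 0" "P \<in> carrier_mat 2 2"
  using assms by (simp_all add: pure_qubit_def hermitian_carrier)

lemma mtrace_pure_qubit_mult_less_one:
  assumes P: "pure_qubit P" and Q: "pure_qubit Q" and "P \<noteq> Q"
  shows "Re (mtrace (P * Q)) < 1"
proof -
  note P = pure_qubitD[OF P] and Q = pure_qubitD[OF Q]
  have "P - Q \<noteq> 0\<^sub>m 2 2" using \<open>P \<noteq> Q\<close> eq_if_minus_mat_eq_zero[OF P(4) Q(4)] by blast
  then have "Re (det (P - Q)) < 0"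
    using P Q
    by (intro traceless_hermitian_det_neg hermitian_minus P(1) Q(1)) (simp_all add: mtrace_minus[of _ 2])
  also have "P - Q = of_real 1 \<cdot>\<^sub>m P + of_real (- 1) \<cdot>\<^sub>m Q" using P(4) Q(4) by (intro eq_matI) auto
  finally show ?thesis unfolding det_density_diff_2[OF P(1,2) Q(1,2)] using P(3) Q(3) by simp
qed

lemma pure_qubit_outer_prod:
  assumes P: "pure_qubit P"
  obtains a where "P = outer_prod 2 a a"
proof -
  note P = pure_qubitD[OF P]
  have diag: "P $$ (k,k) = of_real (Re (P $$ (k,k)))" if "k < 2" for k
    using hermitian_index[OF P(1) that that] by (simp add: complex_eq_iff)
  have "Re (P $$ (0,0)) + Re (P $$ (1,1)) = 1"
    using P(2,4) by (simp add: mtrace_2 complex_eq_iff)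
  then have "0 < Re (P $$ (0,0)) \<or> 0 < Re (P $$ (1,1))" by linarith
  then obtain k where k: "k < 2" "0 < Re (P $$ (k,k))" by (metis one_less_numeral_iff pos2 semiring_norm(76))
  have minor: "P $$ (i,k) * P $$ (k,j) = P $$ (k,k) * P $$ (i,j)" if "i < 2" "j < 2" for i j
    using that k(1) P(3,4) by (auto simp: less_2_cases_iff det_2 algebra_simps)
  define s where "s = complex_of_real (sqrt (Re (P $$ (k,k))))"
  have s: "s * s = P $$ (k,k)" "cnj s = s" "s \<noteq> 0"
    using k diag[OF k(1)] by (simp_all add: s_def flip: of_real_mult)
  define a where "a i = P $$ (i,k) / s" for i
  have "P = outer_prod 2 a a"
  proof (rule eq_matI)
    fix i j assume "i < dim_row (outer_prod 2 a a)" "j < dim_col (outer_prod 2 a a)"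
    then have ij: "i < 2" "j < 2" by auto
    have "a i * cnj (a j) = P $$ (i,k) * P $$ (k,j) / (s * s)"
      using hermitian_index[OF P(1) ij(2) k(1)] s(2) by (simp add: a_def)
    also have "\<dots> = P $$ (i,j)" using s(1,3) by (simp add: minor[OF ij] flip: s(1))
    finally show "P $$ (i,j) = outer_prod 2 a a $$ (i,j)" using ij by simp
  qed (use P(4) in auto)
  then show ?thesis by (rule that)
qed

lemma add_sqrt_det_square_2:
  assumes A: "A \<in> carrier_mat 2 2" and \<delta>: "det A = \<delta> * \<delta>"
  shows "(A + \<delta> \<cdot>\<^sub>m 1\<^sub>m 2) * (A + \<delta> \<cdot>\<^sub>m 1\<^sub>m 2) = (mtrace A + 2 * \<delta>) \<cdot>\<^sub>m A"
proof -
  have "(A + \<delta> \<cdot>\<^sub>m 1\<^sub>m 2) * (A + \<delta> \<cdot>\<^sub>m 1\<^sub>m 2) = A * A + (2 * \<delta>) \<cdot>\<^sub>m A + (\<delta> * \<delta>) \<cdot>\<^sub>m 1\<^sub>m 2"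
    using A by (intro eq_mat_2I) (auto simp: mult_mat_index sum_lessThan_2 algebra_simps)
  also have "\<dots> = (mtrace A + 2 * \<delta>) \<cdot>\<^sub>m A"
    unfolding cayley_hamilton_2[OF A] \<delta> using A by (intro eq_mat_2I) (auto simp: algebra_simps)
  finally show ?thesis .
qed

lemma psd_factorization_2:
  assumes S: "psd 2 \<sigma>"
  obtains M where "M \<in> carrier_mat 2 2" "M * adj M = \<sigma>"
proof -
  define \<delta> where "\<delta> = sqrt (Re (det \<sigma>))"
  define \<omega> where "\<omega> = Re (mtrace \<sigma>) + 2 * \<delta>"
  note carrier = psd_carrier[OF S]
  have \<delta>: "0 \<le> \<delta>" "det \<sigma> = of_real \<delta> * of_real \<delta>"
    using psd_det_2[OF S] det_hermitian_2[OF psd_hermitian[OF S]] by (auto simp: \<delta>_def simp flip: of_real_mult)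
  have tr: "mtrace \<sigma> + 2 * of_real \<delta> = of_real \<omega>"
    using Im_mtrace_hermitian[OF psd_hermitian[OF S]] by (simp add: \<omega>_def complex_eq_iff)
  define N where "N = \<sigma> + complex_of_real \<delta> \<cdot>\<^sub>m 1\<^sub>m 2"
  have N: "hermitian 2 N"
    unfolding N_def by (intro hermitian_add hermitian_smult hermitian_one psd_hermitian[OF S])
  have square: "N * N = complex_of_real \<omega> \<cdot>\<^sub>m \<sigma>"
    unfolding N_def by (simp only: add_sqrt_det_square_2[OF carrier \<delta>(2)] tr)
  show ?thesis
  proof (cases "\<omega> = 0")
    case True
    then have "\<sigma> = 0\<^sub>m 2 2"
      using psd_mtrace[OF S] \<delta>(1) psd_eq_zero_if_mtrace_zero[OF S] by (simp add: \<omega>_def)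
    then show ?thesis using that[of "0\<^sub>m 2 2"] by simp
  next
    case False
    define r where "r = 1 / sqrt \<omega>"
    define M where "M = complex_of_real r \<cdot>\<^sub>m N"
    have "r * r * \<omega> = 1" using False psd_mtrace[OF S] \<delta>(1) by (simp add: r_def \<omega>_def)
    have "M * adj M = complex_of_real (r * r) \<cdot>\<^sub>m (N * N)"
      using hermitian_carrier[OF N] N
      by (simp add: M_def adj_smult hermitian_def smult_smult_mat
          mult_smult_distrib[of _ 2 2 _ 2] mult_smult_assoc_mat[of _ 2 2 _ 2])
    also have "\<dots> = complex_of_real (r * r * \<omega>) \<cdot>\<^sub>m \<sigma>"
      unfolding square by (simp add: smult_smult_mat)
    also have "\<dots> = \<sigma>" unfolding \<open>r * r * \<omega> = 1\<close> using carrier by (intro eq_matI) auto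
    finally show ?thesis using that[of M] hermitian_carrier[OF N] by (simp add: M_def)
  qed
qed

section \<open>Channels between pairs of qubit states\<close>

lemma factor_with_overlap_trace_norm:
  assumes M0: "M0 \<in> carrier_mat d d" and M1: "M1 \<in> carrier_mat d d"
  obtains N where "N \<in> carrier_mat d d" "N * adj N = M1 * adj M1"
    "mtrace (adj M0 * N) = of_real (trace_norm (adj M0 * M1))"
proof -
  have "adj M0 * M1 \<in> carrier_mat d d" using M0 M1 by simp
  then obtain U where U: "unitary d U" "psd d (U * (adj M0 * M1))"
    "trace_norm (adj M0 * M1) = Re (mtrace (U * (adj M0 * M1)))"
    using trace_norm_attained by metis
  note carrier = M0 M1 unitary_carrier[OF U(1)]
  have "M1 * U * adj (M1 * U) = M1 * ((U * adj U) * adj M1)"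
    using carrier by (simp add: adj_mult mult_mat_assoc)
  then have "M1 * U * adj (M1 * U) = M1 * adj M1" using M1 by (simp add: unitary_mult_adj[OF U(1)])
  moreover have "mtrace (adj M0 * (M1 * U)) = mtrace (U * (adj M0 * M1))"
    using carrier mtrace_comm[of "adj M0 * M1" d d U] by (simp add: mult_mat_assoc)
  then have "mtrace (adj M0 * (M1 * U)) = of_real (trace_norm (adj M0 * M1))"
    using U(3) Im_mtrace_hermitian[OF psd_hermitian[OF U(2)]] by (simp add: complex_eq_iff)
  ultimately show ?thesis using that[of "M1 * U"] carrier by simp
qed

text \<open>By Uhlmann's theorem the overlaps of purifications of \<open>M0 M0\<^sup>*\<close> and \<open>M1 M1\<^sup>*\<close> fill the disc whose radius
  is the fidelity, the trace norm of \<open>M0\<^sup>* M1\<close>. A purification in \<open>\<complex>\<^sup>d \<otimes> \<complex>\<^sup>2\<^sup>d\<close> is a \<open>d \<times> 2d\<close> matrix here.\<close>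

lemma purifications_with_overlap:
  assumes M0: "M0 \<in> carrier_mat d d" and M1: "M1 \<in> carrier_mat d d"
    and c: "cmod c \<le> trace_norm (adj M0 * M1)"
  obtains W0 W1 where "W0 \<in> carrier_mat d (2*d)" "W1 \<in> carrier_mat d (2*d)"
    "W0 * adj W0 = M0 * adj M0" "W1 * adj W1 = M1 * adj M1" "mtrace (adj W0 * W1) = c"
proof -
  define \<nu> where "\<nu> = trace_norm (adj M0 * M1)"
  obtain N where N: "N \<in> carrier_mat d d" "N * adj N = M1 * adj M1" "mtrace (adj M0 * N) = of_real \<nu>"
    unfolding \<nu>_def by (rule factor_with_overlap_trace_norm[OF M0 M1])
  define z where "z = c / of_real \<nu>"
  have z: "cmod z \<le> 1" "z * of_real \<nu> = c"
    using c by (cases "\<nu> = 0"; simp add: \<nu>_def z_def norm_divide divide_le_eq)+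
  define \<zeta> where "\<zeta> = complex_of_real (sqrt (1 - (cmod z)\<^sup>2))"
  define r0 where "r0 = mat 1 2 (\<lambda>(_,j). ket 0 j)"
  define r1 where "r1 = mat 1 2 (\<lambda>(_,j). if j = 0 then z else \<zeta>)"
  have r: "r0 \<in> carrier_mat 1 2" "r1 \<in> carrier_mat 1 2" by (simp_all add: r0_def r1_def)
  have "0 \<le> 1 - (cmod z)\<^sup>2" using z(1) by (simp add: abs_square_le_1)
  then have "z * cnj z + \<zeta> * cnj \<zeta> = 1"
    by (simp add: \<zeta>_def complex_norm_square[symmetric] del: of_real_power flip: of_real_mult of_real_add)
  then have r_norm: "r0 * adj r0 = 1\<^sub>m 1" "r1 * adj r1 = 1\<^sub>m 1"
    using r by (auto intro!: eq_matI simp: mult_mat_index sum_lessThan_2 r0_def r1_def)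
  have "kron r0 M0 * adj (kron r0 M0) = M0 * adj M0" "kron r1 N * adj (kron r1 N) = M1 * adj M1"
    using r M0 N(1,2) r_norm kron_one_left by (simp_all add: adj_kron kron_mult del: One_nat_def)
  moreover have "adj (kron r0 M0) * kron r1 N = kron (adj r0 * r1) (adj M0 * N)"
    using r M0 N(1) by (simp add: adj_kron kron_mult)
  then have "mtrace (adj (kron r0 M0) * kron r1 N) = mtrace (adj r0 * r1) * of_real \<nu>"
    using mtrace_kron[OF mult_carrier_mat[OF adj_carrier[OF r(1)] r(2)], of "adj M0 * N" d] M0 N by simp
  then have "mtrace (adj (kron r0 M0) * kron r1 N) = c"
    using r z(2) by (simp add: mtrace_def sum_lessThan_2 mult_mat_index r0_def r1_def)
  moreover have "kron r0 M0 \<in> carrier_mat d (2*d)" "kron r1 N \<in> carrier_mat d (2*d)"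
    using kron_carrier[OF r(1) M0] kron_carrier[OF r(2) N(1)] by simp_all
  ultimately show ?thesis using that by blast
qed

definition qubit_fidelity :: "complex mat \<Rightarrow> complex mat \<Rightarrow> real" where
  "qubit_fidelity A B = Re (mtrace (A * B)) + 2 * (sqrt (Re (det A)) * sqrt (Re (det B)))"

lemma trace_norm_adj_mult_2:
  assumes M0: "M0 \<in> carrier_mat 2 2" and M1: "M1 \<in> carrier_mat 2 2"
  shows "(trace_norm (adj M0 * M1))\<^sup>2 = qubit_fidelity (M0 * adj M0) (M1 * adj M1)"
proof -
  have det: "cmod (det M) = sqrt (Re (det (M * adj M)))" if "M \<in> carrier_mat 2 2" for M
    using that by (simp add: det_mult[of _ 2] det_adj_2 complex_norm_square[symmetric] del: of_real_power)
  have "adj (adj M0 * M1) * (adj M0 * M1) = adj M1 * (M0 * adj M0 * M1)"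
    using M0 M1 by (simp add: adj_mult mult_mat_assoc)
  then have "mtrace (adj (adj M0 * M1) * (adj M0 * M1)) = mtrace ((M0 * adj M0 * M1) * adj M1)"
    using M0 M1 by (simp add: mtrace_comm[of "adj M1" 2 2])
  also have "\<dots> = mtrace (M0 * adj M0 * (M1 * adj M1))"
    using M0 M1 by (simp add: mult_mat_assoc)
  finally show ?thesis
    using M0 M1 trace_norm_2[of "adj M0 * M1"] det[OF M0] det[OF M1]
    by (simp add: qubit_fidelity_def det_mult[of "adj M0" 2] det_adj_2 norm_mult)
qed

lemma channel_from_unit_vector_pair:
  assumes unit: "(\<Sum>i<2. cnj (a i) * a i) = 1" "(\<Sum>i<2. cnj (b i) * b i) = 1"
    and overlap: "(\<Sum>i<2. cnj (a i) * b i) = c" "cmod c < 1"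
    and W0: "W0 \<in> carrier_mat 2 n" "mtrace (W0 * adj W0) = 1"
    and W1: "W1 \<in> carrier_mat 2 n" "mtrace (W1 * adj W1) = 1"
    and W01: "mtrace (adj W0 * W1) = c"
  obtains V where "CPTP 2 V" "V (outer_prod 2 a a) = W0 * adj W0" "V (outer_prod 2 b b) = W1 * adj W1"
proof -
  define G where "G = mat 2 2 (\<lambda>(i,k). if k = 0 then a i else b i)"
  have G: "G \<in> carrier_mat 2 2" by (simp add: G_def)
  have "cnj c = (\<Sum>i<2. cnj (b i) * a i)"
    unfolding overlap(1)[symmetric] by (simp add: mult.commute)
  then have GG: "(adj G * G) $$ (0,0) = 1" "(adj G * G) $$ (0,1) = c"
    "(adj G * G) $$ (1,0) = cnj c" "(adj G * G) $$ (1,1) = 1"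
    using unit overlap(1) by (simp_all add: G_def mult_mat_index)
  have "det (adj G * G) = of_real (1 - (cmod c)\<^sup>2)"
    using G GG by (simp add: det_2 complex_norm_square del: of_real_power)
  moreover have "(cmod c)\<^sup>2 < 1" using overlap(2) by (simp add: abs_square_less_1)
  ultimately have "det (adj G * G) \<noteq> 0" by (simp only: of_real_eq_0_iff)
  then have det_G: "det G \<noteq> 0" using G by (auto simp: det_mult[of _ 2])
  define W where "W k = (if k = 0 then W0 else W1)" for k :: nat
  have W: "W k \<in> carrier_mat 2 n" for k using W0 W1 by (simp add: W_def)
  have "mtrace (adj W0 * W0) = 1" "mtrace (adj W1 * W1) = 1"
    using W0(2) W1(2) mtrace_comm[OF W0(1) adj_carrier[OF W0(1)]] mtrace_comm[OF W1(1) adj_carrier[OF W1(1)]]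
    by simp_all
  moreover have "mtrace (adj W1 * W0) = cnj c"
    using mtrace_adj[OF mult_carrier_mat[OF adj_carrier[OF W0(1)] W1(1)]] W0(1) W1(1) W01
    by (simp add: adj_mult)
  ultimately have gram: "mtrace (adj (W k) * W l) = (adj G * G) $$ (k,l)" if "k < 2" "l < 2" for k l
    using that W01 GG by (auto simp: W_def less_2_cases_iff)
  obtain V where V: "CPTP 2 V"
    "\<And>k l. k < 2 \<Longrightarrow> l < 2 \<Longrightarrow> V (outer_prod 2 (\<lambda>i. G $$ (i,k)) (\<lambda>i. G $$ (i,l))) = W k * adj (W l)"
    using CPTP_if_gram_eq[OF G det_G W gram] by blast
  have "outer_prod 2 (\<lambda>i. G $$ (i,0)) (\<lambda>i. G $$ (i,0)) = outer_prod 2 a a"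
    "outer_prod 2 (\<lambda>i. G $$ (i,1)) (\<lambda>i. G $$ (i,1)) = outer_prod 2 b b"
    by (auto intro!: eq_matI simp: G_def)
  then show ?thesis using that[OF V(1)] V(2)[of 0 0] V(2)[of 1 1] by (simp add: W_def)
qed

lemma channel_from_pure_pair:
  assumes P: "pure_qubit P" and Q: "pure_qubit Q" and "P \<noteq> Q"
    and \<sigma>0: "psd 2 \<sigma>0" "mtrace \<sigma>0 = 1" and \<sigma>1: "psd 2 \<sigma>1" "mtrace \<sigma>1 = 1"
    and fidelity: "qubit_fidelity P Q \<le> qubit_fidelity \<sigma>0 \<sigma>1"
  obtains V where "CPTP 2 V" "V P = \<sigma>0" "V Q = \<sigma>1"
proof -
  obtain a where a: "P = outer_prod 2 a a" by (rule pure_qubit_outer_prod[OF P])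
  obtain b where b: "Q = outer_prod 2 b b" by (rule pure_qubit_outer_prod[OF Q])
  define c where "c = (\<Sum>i<2. cnj (a i) * b i)"
  have "mtrace (P * Q) = c * mtrace (outer_prod 2 a b)"
    unfolding a b outer_prod_mult by (simp add: c_def mtrace_smult[of _ 2])
  also have "mtrace (outer_prod 2 a b) = cnj c" by (simp add: mtrace_def c_def mult.commute)
  finally have PQ: "mtrace (P * Q) = of_real ((cmod c)\<^sup>2)" by (simp only: complex_norm_square)
  have "cmod c < 1"
    using mtrace_pure_qubit_mult_less_one[OF P Q \<open>P \<noteq> Q\<close>] power2_less_imp_less[of "cmod c" 1] by (simp add: PQ)
  obtain M0 where M0: "M0 \<in> carrier_mat 2 2" "M0 * adj M0 = \<sigma>0" by (rule psd_factorization_2[OF \<sigma>0(1)])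
  obtain M1 where M1: "M1 \<in> carrier_mat 2 2" "M1 * adj M1 = \<sigma>1" by (rule psd_factorization_2[OF \<sigma>1(1)])
  have "(cmod c)\<^sup>2 = qubit_fidelity P Q"
    using pure_qubitD(3)[OF P] by (simp add: qubit_fidelity_def PQ)
  then have "(cmod c)\<^sup>2 \<le> (trace_norm (adj M0 * M1))\<^sup>2"
    using fidelity by (simp add: trace_norm_adj_mult_2[OF M0(1) M1(1)] M0(2) M1(2))
  then have "cmod c \<le> trace_norm (adj M0 * M1)"
    using M0(1) M1(1) by (auto intro!: power2_le_imp_le trace_norm_nonneg[of _ 2])
  then obtain W0 W1 where W: "W0 \<in> carrier_mat 2 (2*2)" "W1 \<in> carrier_mat 2 (2*2)"
    "W0 * adj W0 = \<sigma>0" "W1 * adj W1 = \<sigma>1" "mtrace (adj W0 * W1) = c"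
    using purifications_with_overlap[OF M0(1) M1(1)] M0(2) M1(2) by metis
  have "(\<Sum>i<2. cnj (a i) * a i) = 1" "(\<Sum>i<2. cnj (b i) * b i) = 1"
    using pure_qubitD(2)[OF P] pure_qubitD(2)[OF Q] by (simp_all add: a b mtrace_def mult.commute)
  then show ?thesis
    using channel_from_unit_vector_pair[OF _ _ c_def[symmetric] \<open>cmod c < 1\<close> W(1) _ W(2) _ W(5)]
      \<sigma>0(2) \<sigma>1(2) that by (simp add: W(3,4) a b) blast
qed

lemma le_add_twice_sqrt_if_le_all:
  fixes m u a b :: real
  assumes "0 \<le> a" "0 \<le> b" and le: "\<And>x. 0 < x \<Longrightarrow> m \<le> u + a / x + x * b"
  shows "m \<le> u + 2 * (sqrt a * sqrt b)"
proof (rule field_le_epsilon)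
  fix e' :: real assume "0 < e'"
  define p q where "p = sqrt a" and "q = sqrt b"
  have pq: "0 \<le> p" "0 \<le> q" "p * p = a" "q * q = b" using assms(1,2) by (auto simp: p_def q_def)
  define e where "e = e' / (p + q + 1)"
  have e: "0 < e" "e * (p + q) \<le> e'"
    using \<open>0 < e'\<close> pq by (auto simp: e_def field_simps)
  define x where "x = (p + e) / (q + e)"
  have x: "0 < x" using pq e by (simp add: x_def)
  have "a / x = p * (q + e) * (p / (p + e))"
    using pq(1,2) e unfolding pq(3)[symmetric] by (simp add: x_def field_simps)
  also have "\<dots> \<le> p * (q + e) * 1" using pq e by (intro mult_left_mono) (auto simp: divide_le_eq_1)
  finally have "a / x \<le> p * (q + e)" by simp
  moreover have "x * b = q * (p + e) * (q / (q + e))"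
    using pq(1,2) e unfolding pq(4)[symmetric] by (simp add: x_def field_simps)
  moreover
  have "q * (p + e) * (q / (q + e)) \<le> q * (p + e) * 1"
    using pq e by (intro mult_left_mono) (auto simp: divide_le_eq_1)
  ultimately have "m \<le> u + p * (q + e) + q * (p + e)" using le[OF x] by linarith
  also have "\<dots> = u + 2 * (p * q) + e * (p + q)" by (simp add: algebra_simps)
  also have "\<dots> \<le> u + 2 * (sqrt a * sqrt b) + e'" using e(2) by (simp add: p_def q_def)
  finally show "m \<le> u + 2 * (sqrt a * sqrt b) + e'" .
qed

text \<open>Alberti and Uhlmann's theorem for a pair of pure states: the norm inequalities say that the fidelity
  of the prospective images is at least their own.\<close>

lemma alberti_uhlmann_pure:
  assumes P: "pure_qubit P" and Q: "pure_qubit Q" and "P \<noteq> Q"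
    and \<sigma>0: "hermitian 2 \<sigma>0" "mtrace \<sigma>0 = 1" and \<sigma>1: "hermitian 2 \<sigma>1" "mtrace \<sigma>1 = 1"
    and contr: "\<And>x y :: real. trace_norm (of_real x \<cdot>\<^sub>m \<sigma>0 + of_real y \<cdot>\<^sub>m \<sigma>1) \<le>
      trace_norm (of_real x \<cdot>\<^sub>m P + of_real y \<cdot>\<^sub>m Q)"
  obtains V where "CPTP 2 V" "V P = \<sigma>0" "V Q = \<sigma>1"
proof -
  note PD = pure_qubitD[OF P] and QD = pure_qubitD[OF Q]
  note carrier = PD(4) QD(4) \<sigma>0(1)[THEN hermitian_carrier] \<sigma>1(1)[THEN hermitian_carrier]
  have psd: "psd 2 \<sigma>"
    if R: "pure_qubit R" and \<sigma>: "hermitian 2 \<sigma>" "mtrace \<sigma> = 1" and le: "trace_norm \<sigma> \<le> trace_norm R" for \<sigma> R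
  proof (rule psd_if_trace_norm_le_mtrace[OF hermitian_carrier[OF \<sigma>(1)]])
    have "trace_norm R = Re (mtrace R)"
      by (metis pure_qubit_outer_prod[OF R] psd_outer_prod trace_norm_psd)
    then show "trace_norm \<sigma> \<le> Re (mtrace \<sigma>)" using le \<sigma>(2) pure_qubitD(2)[OF R] by simp
  qed
  have psd0: "psd 2 \<sigma>0"
    using contr[of 1 0] carrier by (intro psd[OF P \<sigma>0]) (simp add: smult_one_add_smult_zero[of _ 2 2])
  have psd1: "psd 2 \<sigma>1"
    using contr[of 0 1] carrier by (intro psd[OF Q \<sigma>1]) (simp add: smult_one_add_smult_zero[of _ 2 2])
  have "Re (mtrace (P * Q)) \<le> qubit_fidelity \<sigma>0 \<sigma>1"
    unfolding qubit_fidelity_def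
  proof (rule le_add_twice_sqrt_if_le_all)
    show "0 \<le> Re (det \<sigma>0)" "0 \<le> Re (det \<sigma>1)" using psd_det_2 psd0 psd1 by auto
    fix x :: real assume x: "0 < x"
    have "Re (det (of_real 1 \<cdot>\<^sub>m P + of_real (- x) \<cdot>\<^sub>m Q)) \<le> Re (det (of_real 1 \<cdot>\<^sub>m \<sigma>0 + of_real (- x) \<cdot>\<^sub>m \<sigma>1))"
    proof (rule det_mono_if_trace_norm_le[OF _ _ _ contr])
      show "Re (det (of_real 1 \<cdot>\<^sub>m P + of_real (- x) \<cdot>\<^sub>m Q)) \<le> 0"
        unfolding det_density_diff_2[OF PD(1,2) QD(1,2)]
        using x mtrace_pure_qubit_mult_less_one[OF P Q \<open>P \<noteq> Q\<close>] PD(3) QD(3) by simp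
      show "mtrace (of_real 1 \<cdot>\<^sub>m \<sigma>0 + of_real (- x) \<cdot>\<^sub>m \<sigma>1) = mtrace (of_real 1 \<cdot>\<^sub>m P + of_real (- x) \<cdot>\<^sub>m Q)"
        using PD(2) QD(2) \<sigma>0(2) \<sigma>1(2) carrier by (simp add: mtrace_add[of _ 2] mtrace_smult[of _ 2])
    qed (intro hermitian_add hermitian_smult PD QD \<sigma>0 \<sigma>1)+
    then have "x * Re (mtrace (P * Q)) \<le> x * (Re (mtrace (\<sigma>0 * \<sigma>1)) + Re (det \<sigma>0) / x + x * Re (det \<sigma>1))"
      unfolding det_density_diff_2[OF PD(1,2) QD(1,2)] det_density_diff_2[OF \<sigma>0 \<sigma>1]
      using x PD(3) QD(3) by (simp add: algebra_simps power2_eq_square)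
    then show "Re (mtrace (P * Q)) \<le> Re (mtrace (\<sigma>0 * \<sigma>1)) + Re (det \<sigma>0) / x + x * Re (det \<sigma>1)"
      using x by (simp only: mult_le_cancel_left_pos)
  qed
  then have "qubit_fidelity P Q \<le> qubit_fidelity \<sigma>0 \<sigma>1" by (simp add: qubit_fidelity_def[of P] PD(3))
  then show ?thesis by (rule channel_from_pure_pair[OF P Q \<open>P \<noteq> Q\<close> psd0 \<sigma>0(2) psd1 \<sigma>1(2) _ that])
qed

lemma pure_qubits_on_line:
  assumes w: "hermitian 2 \<omega>" "mtrace \<omega> = 1" "0 < Re (det \<omega>)"
    and H: "hermitian 2 H" "mtrace H = 0" "H \<noteq> 0\<^sub>m 2 2"
  obtains x y where "x \<noteq> y" "pure_qubit (\<omega> + complex_of_real x \<cdot>\<^sub>m H)"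
    "pure_qubit (\<omega> + complex_of_real y \<cdot>\<^sub>m H)"
proof -
  define b where "b = - Re (mtrace (\<omega> * H))"
  define L where "L x = \<omega> + complex_of_real x \<cdot>\<^sub>m H" for x
  note carrier = w(1)[THEN hermitian_carrier] H(1)[THEN hermitian_carrier]
  have det: "Re (det (L x)) = Re (det H) * x\<^sup>2 + b * x + Re (det \<omega>)" for x
  proof -
    have "L x = 1 \<cdot>\<^sub>m \<omega> + complex_of_real x \<cdot>\<^sub>m H"
      using carrier by (intro eq_matI) (auto simp: L_def)
    then show ?thesis
      using det_lincomb_2[OF carrier, of 1 "of_real x"] H(2) by (simp add: b_def flip: of_real_power)
  qed
  have neg: "Re (det H) < 0" by (rule traceless_hermitian_det_neg[OF H])
  then have "Re (det H) * Re (det \<omega>) < 0" using w(3) by (rule mult_neg_pos)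
  then have "0 < discrim (Re (det H)) b (Re (det \<omega>))"
    unfolding discrim_def mult.assoc using zero_le_power2[of b] by linarith
  then obtain x y where xy: "x \<noteq> y" "Re (det (L x)) = 0" "Re (det (L y)) = 0"
    unfolding det using discriminant_pos_ex[of "Re (det H)"] neg by (metis less_irrefl)
  have herm: "hermitian 2 (L x)" for x unfolding L_def by (intro hermitian_add hermitian_smult w H)
  have "mtrace (L x) = 1" for x
    using carrier w(2) H(2) by (simp add: L_def mtrace_add[of _ 2] mtrace_smult[of _ 2])
  then have "pure_qubit (L x)" if "Re (det (L x)) = 0" for x
    using det_hermitian_2[OF herm, of x] herm that by (simp add: pure_qubit_def)
  then show ?thesis using that[OF xy(1)] xy(2,3) by (simp add: L_def)
qed

lemma linear_map_on_determined_by_line: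
  assumes V: "linear_map_on d V" and carrier: "A \<in> carrier_mat d d" "B \<in> carrier_mat d d"
    "A' \<in> carrier_mat d d" "B' \<in> carrier_mat d d" and "x \<noteq> y"
    and x: "V (A + x \<cdot>\<^sub>m B) = A' + x \<cdot>\<^sub>m B'" and y: "V (A + y \<cdot>\<^sub>m B) = A' + y \<cdot>\<^sub>m B'"
  shows "V A = A'" "V B = B'"
proof -
  note image = carrier(1,2)[THEN linear_map_on_carrier[OF V]]
  have "V A $$ (i,j) = A' $$ (i,j) \<and> V B $$ (i,j) = B' $$ (i,j)" if ij: "i < d" "j < d" for i j
  proof -
    have line: "V A $$ (i,j) + z * V B $$ (i,j) = A' $$ (i,j) + z * B' $$ (i,j)"
      if "V (A + z \<cdot>\<^sub>m B) = A' + z \<cdot>\<^sub>m B'" for z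
      using arg_cong[OF that, of "\<lambda>M. M $$ (i,j)"] ij carrier image
      by (simp add: linear_map_on_add_smult[OF V])
    have "(x - y) * (V B $$ (i,j) - B' $$ (i,j)) =
        (V A $$ (i,j) + x * V B $$ (i,j) - (A' $$ (i,j) + x * B' $$ (i,j)))
        - (V A $$ (i,j) + y * V B $$ (i,j) - (A' $$ (i,j) + y * B' $$ (i,j)))"
      by (simp add: algebra_simps)
    also have "\<dots> = 0" by (simp add: line[OF x] line[OF y])
    finally have "V B $$ (i,j) = B' $$ (i,j)" using \<open>x \<noteq> y\<close> by simp
    then show ?thesis using line[OF x] by simp
  qed
  then show "V A = A'" "V B = B'" using carrier image by (auto intro!: eq_matI)
qed

lemma alberti_uhlmann:
  assumes w: "hermitian 2 \<omega>" "mtrace \<omega> = 1" "0 < Re (det \<omega>)"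
    and H: "hermitian 2 H" "mtrace H = 0" "H \<noteq> 0\<^sub>m 2 2"
    and w': "hermitian 2 \<omega>'" "mtrace \<omega>' = 1" and H': "hermitian 2 H'" "mtrace H' = 0"
    and contr: "\<And>x y :: real. trace_norm (of_real x \<cdot>\<^sub>m \<omega>' + of_real y \<cdot>\<^sub>m H') \<le>
      trace_norm (of_real x \<cdot>\<^sub>m \<omega> + of_real y \<cdot>\<^sub>m H)"
  obtains V where "CPTP 2 V" "V \<omega> = \<omega>'" "V H = H'"
proof -
  define L where "L u = \<omega> + complex_of_real u \<cdot>\<^sub>m H" for u
  define L' where "L' u = \<omega>' + complex_of_real u \<cdot>\<^sub>m H'" for u
  obtain x y where "x \<noteq> y" and pure: "pure_qubit (L x)" "pure_qubit (L y)"
    unfolding L_def by (rule pure_qubits_on_line[OF w H])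
  note carrier = w(1)[THEN hermitian_carrier] H(1)[THEN hermitian_carrier]
    w'(1)[THEN hermitian_carrier] H'(1)[THEN hermitian_carrier]
  have L': "hermitian 2 (L' u)" "mtrace (L' u) = 1" for u
    using carrier w' H'
    by (auto simp: L'_def mtrace_add[of _ 2] mtrace_smult[of _ 2] intro: hermitian_add hermitian_smult)
  have "of_real p \<cdot>\<^sub>m L x + of_real q \<cdot>\<^sub>m L y = of_real (p + q) \<cdot>\<^sub>m \<omega> + of_real (p * x + q * y) \<cdot>\<^sub>m H"
    "of_real p \<cdot>\<^sub>m L' x + of_real q \<cdot>\<^sub>m L' y = of_real (p + q) \<cdot>\<^sub>m \<omega>' + of_real (p * x + q * y) \<cdot>\<^sub>m H'" for p q
    using carrier by (auto simp: L_def L'_def algebra_simps intro!: eq_matI)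
  then have "trace_norm (of_real p \<cdot>\<^sub>m L' x + of_real q \<cdot>\<^sub>m L' y) \<le>
      trace_norm (of_real p \<cdot>\<^sub>m L x + of_real q \<cdot>\<^sub>m L y)" for p q
    by (simp only: contr)
  moreover have "L x \<noteq> L y"
  proof
    assume "L x = L y"
    then have "L y - L x = 0\<^sub>m 2 2" using minus_r_inv_mat[OF pure_qubitD(4)[OF pure(1)]] by simp
    moreover have "L y - L x = complex_of_real (y - x) \<cdot>\<^sub>m H"
      using carrier by (intro eq_matI) (auto simp: L_def algebra_simps)
    ultimately show False using smult_mat_eq_zero_iff[OF carrier(2)] \<open>x \<noteq> y\<close> H(3) by simp
  qed
  ultimately obtain V where V: "CPTP 2 V" "V (L x) = L' x" "V (L y) = L' y"
    using alberti_uhlmann_pure[OF pure _ L' L'] by blast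
  then show ?thesis
    using that[OF V(1)] \<open>x \<noteq> y\<close>
      linear_map_on_determined_by_line[OF CPTP_linear[OF V(1)] carrier, of "of_real x" "of_real y"]
    by (simp add: L_def L'_def)
qed

section \<open>Factorization of singular qubit channels\<close>

definition max_mixed :: "complex mat" where
  "max_mixed = complex_of_real (1 / 2) \<cdot>\<^sub>m 1\<^sub>m 2"

lemma psd_max_mixed: "psd 2 max_mixed"
  unfolding max_mixed_def by (rule psd_smult[OF psd_one]) simp

lemma max_mixed_carrier [simp]: "max_mixed \<in> carrier_mat 2 2"
  by (rule psd_carrier[OF psd_max_mixed])

lemma mtrace_max_mixed: "mtrace max_mixed = 1"
  by (simp add: max_mixed_def mtrace_smult[of _ 2] mtrace_one)

lemma traceless_part:
  assumes X: "X \<in> carrier_mat 2 2"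
  obtains Y where "Y \<in> carrier_mat 2 2" "mtrace Y = 0" "X = mtrace X \<cdot>\<^sub>m max_mixed + Y"
proof
  show "mtrace (X - mtrace X \<cdot>\<^sub>m max_mixed) = 0"
    using X by (simp add: mtrace_minus[of _ 2] mtrace_smult[of _ 2] mtrace_max_mixed)
  show "X = mtrace X \<cdot>\<^sub>m max_mixed + (X - mtrace X \<cdot>\<^sub>m max_mixed)"
    using X carrier_matD[OF max_mixed_carrier] by (intro eq_matI) auto
qed (simp add: minus_carrier_mat)

lemma factors_through_if_constant:
  assumes \<Phi>: "CPTP 2 \<Phi>" and \<Psi>: "CPTP 2 \<Psi>" and dom: "trace_norm_dominated 2 \<Psi> \<Phi>"
    and const: "\<And>X. X \<in> carrier_mat 2 2 \<Longrightarrow> mtrace X = 0 \<Longrightarrow> \<Phi> X = 0\<^sub>m 2 2"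
  shows "factors_through 2 \<Psi> \<Phi>"
proof -
  note L = CPTP_linear[OF \<Psi>]
  have density: "psd 2 (\<Psi> max_mixed)" "mtrace (\<Psi> max_mixed) = 1"
    by (simp_all add: CPTP_psd[OF \<Psi> psd_max_mixed] CPTP_mtrace[OF \<Psi>] mtrace_max_mixed)
  obtain M where M: "M \<in> carrier_mat 2 2" "M * adj M = \<Psi> max_mixed"
    by (rule psd_factorization_2[OF density(1)])
  then obtain V where V: "CPTP 2 V"
    "\<And>X. X \<in> carrier_mat 2 2 \<Longrightarrow> V X = mtrace X \<cdot>\<^sub>m \<Psi> max_mixed"
    using CPTP_replacer[OF M(1)] density(2) by metis
  have "\<Psi> X = V (\<Phi> X)" if X: "X \<in> carrier_mat 2 2" for X
  proof -
    obtain Y where Y: "Y \<in> carrier_mat 2 2" "mtrace Y = 0" "X = mtrace X \<cdot>\<^sub>m max_mixed + Y"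
      by (rule traceless_part[OF X])
    have "\<Psi> Y = 0\<^sub>m 2 2"
      by (rule kernel_mono_if_trace_norm_dominated[OF \<Phi> \<Psi> dom Y(1) const[OF Y(1,2)]])
    then have "\<Psi> X = mtrace X \<cdot>\<^sub>m \<Psi> max_mixed"
      using Y(1) CPTP_carrier[OF \<Psi> max_mixed_carrier]
      by (subst Y(3)) (simp add: linear_map_on_add[OF L] linear_map_on_smult[OF L])
    then show ?thesis using V(2)[OF CPTP_carrier[OF \<Phi> X]] CPTP_mtrace[OF \<Phi> X] by simp
  qed
  then show ?thesis using V(1) by (auto simp: factors_through_def)
qed

lemma det_image_max_mixed_pos:
  assumes \<Phi>: "CPTP 2 \<Phi>" and X: "hermitian 2 X" "mtrace X = 0" "\<Phi> X \<noteq> 0\<^sub>m 2 2"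
  shows "0 < Re (det (\<Phi> max_mixed))"
proof -
  define c where "c = entry_norm 2 X"
  note carrier = hermitian_carrier[OF X(1)]
  have nonneg: "0 \<le> Re (det (of_real (2 * c) \<cdot>\<^sub>m \<Phi> max_mixed + of_real \<epsilon> \<cdot>\<^sub>m \<Phi> X))" if "\<bar>\<epsilon>\<bar> = 1" for \<epsilon>
  proof -
    have "entry_norm 2 (complex_of_real \<epsilon> \<cdot>\<^sub>m X) \<le> c"
      using that carrier by (simp add: entry_norm_smult c_def)
    then have "psd 2 (\<Phi> (complex_of_real \<epsilon> \<cdot>\<^sub>m X + complex_of_real c \<cdot>\<^sub>m 1\<^sub>m 2))"
      by (intro CPTP_psd[OF \<Phi>] psd_add_smult_one hermitian_smult X(1))
    also have "complex_of_real \<epsilon> \<cdot>\<^sub>m X + complex_of_real c \<cdot>\<^sub>m 1\<^sub>m 2 =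
        of_real (2 * c) \<cdot>\<^sub>m max_mixed + of_real \<epsilon> \<cdot>\<^sub>m X"
      using carrier by (intro eq_matI) (auto simp: max_mixed_def)
    finally show ?thesis
      unfolding linear_map_on_lincomb[OF CPTP_linear[OF \<Phi>] max_mixed_carrier carrier] by (rule psd_det_2)
  qed
  have "0 \<le> Re (det (of_real (2 * c) \<cdot>\<^sub>m \<Phi> max_mixed + of_real 1 \<cdot>\<^sub>m \<Phi> X))
      + Re (det (of_real (2 * c) \<cdot>\<^sub>m \<Phi> max_mixed + of_real (- 1) \<cdot>\<^sub>m \<Phi> X))"
    by (intro add_nonneg_nonneg nonneg) simp_all
  also have "\<dots> = 2 * ((2 * c)\<^sup>2 * Re (det (\<Phi> max_mixed)) + Re (det (\<Phi> X)))"
    using CPTP_carrier[OF \<Phi> max_mixed_carrier] CPTP_carrier[OF \<Phi> carrier]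
    by (simp add: det_lincomb_2 flip: of_real_power of_real_mult)
  finally have "0 \<le> (2 * c)\<^sup>2 * Re (det (\<Phi> max_mixed)) + Re (det (\<Phi> X))" by simp
  moreover have "Re (det (\<Phi> X)) < 0"
    by (intro traceless_hermitian_det_neg CPTP_hermitian[OF \<Phi>] X) (simp add: CPTP_mtrace[OF \<Phi> carrier] X(2))
  ultimately have "0 < (2 * c)\<^sup>2 * Re (det (\<Phi> max_mixed))" by linarith
  then show ?thesis by (simp add: zero_less_mult_iff)
qed

lemma factors_through_if_collinear:
  assumes \<Phi>: "CPTP 2 \<Phi>" and \<Psi>: "CPTP 2 \<Psi>" and dom: "trace_norm_dominated 2 \<Psi> \<Phi>"
    and H: "hermitian 2 H" "mtrace H = 0" "\<Phi> H \<noteq> 0\<^sub>m 2 2"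
    and line: "\<And>X. X \<in> carrier_mat 2 2 \<Longrightarrow> mtrace X = 0 \<Longrightarrow> \<exists>\<beta>. \<Phi> (X - \<beta> \<cdot>\<^sub>m H) = 0\<^sub>m 2 2"
  shows "factors_through 2 \<Psi> \<Phi>"
proof -
  note carrier [simp] = hermitian_carrier[OF H(1)]
  have lincomb: "\<Theta> (a \<cdot>\<^sub>m max_mixed + b \<cdot>\<^sub>m H) = a \<cdot>\<^sub>m \<Theta> max_mixed + b \<cdot>\<^sub>m \<Theta> H" if "CPTP 2 \<Theta>" for \<Theta> a b
    by (rule linear_map_on_lincomb[OF CPTP_linear[OF that] max_mixed_carrier carrier])
  have contr: "trace_norm (of_real a \<cdot>\<^sub>m \<Psi> max_mixed + of_real b \<cdot>\<^sub>m \<Psi> H) \<le>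
      trace_norm (of_real a \<cdot>\<^sub>m \<Phi> max_mixed + of_real b \<cdot>\<^sub>m \<Phi> H)" for a b :: real
    unfolding lincomb[OF \<Phi>, symmetric] lincomb[OF \<Psi>, symmetric]
    by (intro trace_norm_dominated_one[OF \<Phi> \<Psi> dom] hermitian_add hermitian_smult H psd_hermitian psd_max_mixed)
  have state: "hermitian 2 (\<Theta> max_mixed)" "mtrace (\<Theta> max_mixed) = 1" "hermitian 2 (\<Theta> H)" "mtrace (\<Theta> H) = 0"
    if "CPTP 2 \<Theta>" for \<Theta>
    using CPTP_hermitian[OF that psd_hermitian[OF psd_max_mixed]] CPTP_hermitian[OF that H(1)]
    by (simp_all add: CPTP_mtrace[OF that] mtrace_max_mixed H(2))
  obtain V where V: "CPTP 2 V" "V (\<Phi> max_mixed) = \<Psi> max_mixed" "V (\<Phi> H) = \<Psi> H"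
    using alberti_uhlmann[OF state(1,2)[OF \<Phi>] det_image_max_mixed_pos[OF \<Phi> H] state(3,4)[OF \<Phi>] H(3)
        state[OF \<Psi>] contr] by blast
  have "\<Psi> X = V (\<Phi> X)" if X: "X \<in> carrier_mat 2 2" for X
  proof -
    obtain Y where Y: "Y \<in> carrier_mat 2 2" "mtrace Y = 0" "X = mtrace X \<cdot>\<^sub>m max_mixed + Y"
      by (rule traceless_part[OF X])
    obtain \<beta> where \<beta>: "\<Phi> (Y - \<beta> \<cdot>\<^sub>m H) = 0\<^sub>m 2 2" using line[OF Y(1,2)] by blast
    define Z where "Z = mtrace X \<cdot>\<^sub>m max_mixed + \<beta> \<cdot>\<^sub>m H"
    have Z: "Z \<in> carrier_mat 2 2" by (simp add: Z_def)
    have "X - Z = Y - \<beta> \<cdot>\<^sub>m H"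
      using Y(1) carrier_matD[OF max_mixed_carrier] carrier_matD[OF carrier]
      by (subst Y(3)) (auto simp: Z_def intro!: eq_matI)
    then have "\<Phi> (X - Z) = 0\<^sub>m 2 2" using \<beta> by simp
    moreover from this have "\<Psi> (X - Z) = 0\<^sub>m 2 2"
      by (rule kernel_mono_if_trace_norm_dominated[OF \<Phi> \<Psi> dom minus_carrier_mat[OF Z]])
    ultimately have "\<Phi> X = \<Phi> Z" "\<Psi> X = \<Psi> Z"
      using eq_if_minus_mat_eq_zero[OF CPTP_carrier CPTP_carrier] X Z \<Phi> \<Psi>
      by (metis CPTP_linear linear_map_on_minus)+
    moreover have "V (\<Phi> Z) = \<Psi> Z"
      unfolding Z_def lincomb[OF \<Phi>] lincomb[OF \<Psi>]
      using CPTP_carrier[OF \<Phi>] by (simp add: linear_map_on_lincomb[OF CPTP_linear[OF V(1)]] V(2,3))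
    ultimately show ?thesis by simp
  qed
  then show ?thesis using V(1) by (auto simp: factors_through_def)
qed

lemma projection_coefficients_sum:
  assumes L: "linear_map_on d V" and K: "K \<in> carrier_mat d d" "K \<noteq> 0\<^sub>m d d" "V K = 0\<^sub>m d d"
    and g: "\<And>k l. V (mat_unit d k l) = mat_unit d k l - g k l \<cdot>\<^sub>m K"
  shows "(\<Sum>k<d. \<Sum>l<d. g k l * K $$ (k,l)) = 1"
proof -
  define S where "S = (\<Sum>k<d. \<Sum>l<d. g k l * K $$ (k,l))"
  have "(1 - S) * K $$ (i,j) = 0" if ij: "i < d" "j < d" for i j
  proof -
    have "0 = (\<Sum>k<d. \<Sum>l<d. K $$ (k,l) * (mat_unit d k l - g k l \<cdot>\<^sub>m K) $$ (i,j))"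
      using linear_map_on_expand[OF L K(1) ij] ij by (simp add: K(3) g)
    also have "\<dots> = (\<Sum>k<d. \<Sum>l<d. (if l = j then if k = i then K $$ (i,j) else 0 else 0)
        - g k l * K $$ (k,l) * K $$ (i,j))"
      using ij K(1) by (intro sum.cong refl) (auto simp: ket_def algebra_simps)
    also have "\<dots> = (1 - S) * K $$ (i,j)"
      using ij by (simp add: S_def sum_subtractf sum_distrib_right left_diff_distrib)
    finally show ?thesis by simp
  qed
  then have "(1 - S) \<cdot>\<^sub>m K = 0\<^sub>m d d" using K(1) by (intro eq_zero_matI) auto
  then have "S = 1" using K(2) by (simp add: smult_mat_eq_zero_iff[OF K(1)])
  then show ?thesis by (simp add: S_def)
qed

text \<open>If \<open>V X = X - g(X) K\<close> with \<open>g(K) = 1\<close>, then the Choi matrix of \<open>V\<close> has the value \<open>det K < 0\<close> at the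
  vector of entries of \<open>K\<close>, because \<open>K\<^sup>2 = - det K\<close> for a traceless \<open>K\<close>.\<close>

lemma no_channel_projecting_along_hermitian:
  assumes V: "CPTP 2 V" and K: "hermitian 2 K" "K \<noteq> 0\<^sub>m 2 2" "V K = 0\<^sub>m 2 2"
    and decomp: "\<And>X. X \<in> carrier_mat 2 2 \<Longrightarrow> \<exists>g Z. Z \<in> carrier_mat 2 2 \<and> V Z = Z \<and> X = Z + g \<cdot>\<^sub>m K"
  shows False
proof -
  note carrier = hermitian_carrier[OF K(1)]
  note L = CPTP_linear[OF V]
  have trK: "mtrace K = 0" using CPTP_mtrace[OF V carrier] K(3) by simp
  have "\<exists>g. V (mat_unit 2 k l) = mat_unit 2 k l - g \<cdot>\<^sub>m K" for k l
  proof -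
    obtain g Z where Z: "Z \<in> carrier_mat 2 2" "V Z = Z" "mat_unit 2 k l = Z + g \<cdot>\<^sub>m K"
      using decomp[OF outer_prod_carrier] by blast
    have "V (mat_unit 2 k l) = Z + g \<cdot>\<^sub>m 0\<^sub>m 2 2"
      unfolding Z(3) using Z carrier by (simp add: linear_map_on_add[OF L] linear_map_on_smult[OF L] K(3))
    also have "\<dots> = mat_unit 2 k l - g \<cdot>\<^sub>m K" unfolding Z(3) using Z(1) carrier by (intro eq_matI) auto
    finally show ?thesis by blast
  qed
  then obtain g where g: "\<And>k l. V (mat_unit 2 k l) = mat_unit 2 k l - g k l \<cdot>\<^sub>m K" by metis
  define S where "S = (\<Sum>k<2. \<Sum>l<2. g k l * K $$ (k,l))"
  have "S = 1" unfolding S_def by (rule projection_coefficients_sum[OF L carrier K(2,3) g])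
  have "K * K = - det K \<cdot>\<^sub>m 1\<^sub>m 2"
    unfolding cayley_hamilton_2[OF carrier] trK using carrier by (intro eq_matI) auto
  then have cube: "K * K * K = - det K \<cdot>\<^sub>m K" using carrier by (simp add: mult_smult_assoc_mat[of _ 2 2 _ 2])
  have "adj K = K" using K(1) by (simp add: hermitian_def)
  have "adj K * V (mat_unit 2 k l) * K = outer_prod 2 (\<lambda>i. K $$ (i,k)) (\<lambda>i. K $$ (i,l)) + (g k l * det K) \<cdot>\<^sub>m K"
    if "k < 2" "l < 2" for k l
  proof -
    have "adj K * V (mat_unit 2 k l) * K = K * mat_unit 2 k l * adj K - g k l \<cdot>\<^sub>m (K * K * K)"
      unfolding g \<open>adj K = K\<close> using carrier
      by (simp add: mult_minus_distrib_mat[of _ 2 2 _ 2] minus_mult_distrib_mat[of _ 2 2 _ _ 2]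
          mult_smult_distrib[of _ 2 2 _ 2] mult_smult_assoc_mat[of _ 2 2 _ 2])
    then show ?thesis
      unfolding cube mult_mat_unit_adj[OF carrier that] using carrier by (auto intro!: eq_matI)
  qed
  then have "(\<Sum>k<2. \<Sum>l<2. (adj K * V (mat_unit 2 k l) * K) $$ (k,l)) =
      mtrace K * cnj (mtrace K) + det K * S"
    using carrier by (simp add: sum_lessThan_2 mtrace_2 S_def algebra_simps)
  then have "0 \<le> Re (det K)" using CPTP_choi_nonneg[OF V carrier] by (simp add: trK \<open>S = 1\<close>)
  then show False using traceless_hermitian_det_neg[OF K(1) trK K(2)] by simp
qed

lemma spanning_if_independent_2:
  fixes B\<^sub>0 B\<^sub>1 B\<^sub>2 B\<^sub>3 :: "complex mat"
  assumes B: "B\<^sub>0 \<in> carrier_mat 2 2" "B\<^sub>1 \<in> carrier_mat 2 2" "B\<^sub>2 \<in> carrier_mat 2 2" "B\<^sub>3 \<in> carrier_mat 2 2"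
    and independent: "\<And>a b c e. a \<cdot>\<^sub>m B\<^sub>0 + (b \<cdot>\<^sub>m B\<^sub>1 + c \<cdot>\<^sub>m B\<^sub>2) + e \<cdot>\<^sub>m B\<^sub>3 = 0\<^sub>m 2 2 \<Longrightarrow>
      a = 0 \<and> b = 0 \<and> c = 0 \<and> e = 0"
    and Y: "Y \<in> carrier_mat 2 2"
  obtains a b c e where "Y = a \<cdot>\<^sub>m B\<^sub>0 + (b \<cdot>\<^sub>m B\<^sub>1 + c \<cdot>\<^sub>m B\<^sub>2) + e \<cdot>\<^sub>m B\<^sub>3"
proof -
  define F where "F Z = Z $$ (0,0) \<cdot>\<^sub>m B\<^sub>0 + (Z $$ (0,1) \<cdot>\<^sub>m B\<^sub>1 + Z $$ (1,0) \<cdot>\<^sub>m B\<^sub>2) + Z $$ (1,1) \<cdot>\<^sub>m B\<^sub>3"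
    for Z :: "complex mat"
  have "linear_map_on 2 F"
    using B by (auto simp: linear_map_on_def F_def algebra_simps intro!: eq_matI)
  moreover have "trivial_kernel 2 F"
    using independent by (auto simp: trivial_kernel_def F_def intro!: eq_mat_2I)
  ultimately have "F ` carrier_mat 2 2 = carrier_mat 2 2"
    using linear_map_on_bij_if_trivial_kernel bij_betw_imp_surj_on by blast
  then show ?thesis using Y that unfolding F_def by blast
qed

lemma traceless_range_collinear_if_fixed:
  assumes \<Phi>: "CPTP 2 \<Phi>" and V: "CPTP 2 V" and K: "hermitian 2 K" "K \<noteq> 0\<^sub>m 2 2" "V K = 0\<^sub>m 2 2"
    and fixed: "\<And>X. X \<in> carrier_mat 2 2 \<Longrightarrow> V (\<Phi> X) = \<Phi> X"
    and H: "H \<in> carrier_mat 2 2" "mtrace H = 0" "\<Phi> H \<noteq> 0\<^sub>m 2 2" and X: "X \<in> carrier_mat 2 2" "mtrace X = 0"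
  shows "\<exists>\<beta>. \<Phi> (X - \<beta> \<cdot>\<^sub>m H) = 0\<^sub>m 2 2"
proof (rule ccontr)
  assume no: "\<nexists>\<beta>. \<Phi> (X - \<beta> \<cdot>\<^sub>m H) = 0\<^sub>m 2 2"
  note L = CPTP_linear[OF \<Phi>] and LV = CPTP_linear[OF V]
  note carrier = hermitian_carrier[OF K(1)] and range = CPTP_carrier[OF \<Phi>]
  define C where "C a b c = a \<cdot>\<^sub>m 1\<^sub>m 2 + (b \<cdot>\<^sub>m H + c \<cdot>\<^sub>m X)" for a b c
  have C: "C a b c \<in> carrier_mat 2 2" for a b c using H(1) X(1) by (simp add: C_def)
  have \<Phi>C: "\<Phi> (C a b c) = a \<cdot>\<^sub>m \<Phi> (1\<^sub>m 2) + (b \<cdot>\<^sub>m \<Phi> H + c \<cdot>\<^sub>m \<Phi> X)" for a b c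
    using H(1) X(1) by (simp add: C_def linear_map_on_add[OF L] linear_map_on_smult[OF L])
  have independent: "a = 0 \<and> b = 0 \<and> c = 0 \<and> e = 0"
    if "a \<cdot>\<^sub>m \<Phi> (1\<^sub>m 2) + (b \<cdot>\<^sub>m \<Phi> H + c \<cdot>\<^sub>m \<Phi> X) + e \<cdot>\<^sub>m K = 0\<^sub>m 2 2" for a b c e
  proof -
    have zero: "\<Phi> (C a b c) + e \<cdot>\<^sub>m K = 0\<^sub>m 2 2" using that by (simp add: \<Phi>C)
    have "V (\<Phi> (C a b c) + e \<cdot>\<^sub>m K) = \<Phi> (C a b c) + e \<cdot>\<^sub>m 0\<^sub>m 2 2"
      by (simp add: linear_map_on_add_smult[OF LV range[OF C] carrier] fixed[OF C] K(3))
    also have "\<dots> = \<Phi> (C a b c)" using range[OF C, of a b c] by (intro eq_matI) auto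
    finally have \<Phi>0: "\<Phi> (C a b c) = 0\<^sub>m 2 2" using linear_map_on_zero[OF LV] by (simp add: zero)
    then have "e = 0" using zero K(2) carrier by (simp add: smult_mat_eq_zero_iff[OF carrier])
    have "mtrace (C a b c) = 0" using CPTP_mtrace[OF \<Phi> C, of a b c] \<Phi>0 by simp
    then have "a = 0"
      using H X by (simp add: C_def mtrace_add[of _ 2] mtrace_smult[of _ 2] mtrace_one)
    have "c = 0"
    proof (rule ccontr)
      assume "c \<noteq> 0"
      then have "X - (- b / c) \<cdot>\<^sub>m H = (1 / c) \<cdot>\<^sub>m C a b c"
        using H(1) X(1) by (intro eq_matI) (auto simp: C_def \<open>a = 0\<close> field_simps)
      then have "\<Phi> (X - (- b / c) \<cdot>\<^sub>m H) = 0\<^sub>m 2 2" using \<Phi>0 by (simp add: linear_map_on_smult[OF L C])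
      then show False using no by blast
    qed
    then have "b \<cdot>\<^sub>m \<Phi> H = \<Phi> (C a b c)"
      using range[OF H(1)] range[OF X(1)] range[OF one_carrier_mat] by (intro eq_matI) (auto simp: \<Phi>C \<open>a = 0\<close>)
    then have "b = 0" using H(3) by (simp add: \<Phi>0 smult_mat_eq_zero_iff[OF range[OF H(1)]])
    then show ?thesis using \<open>a = 0\<close> \<open>c = 0\<close> \<open>e = 0\<close> by simp
  qed
  have "\<exists>g Z. Z \<in> carrier_mat 2 2 \<and> V Z = Z \<and> Y = Z + g \<cdot>\<^sub>m K" if "Y \<in> carrier_mat 2 2" for Y
    using spanning_if_independent_2[OF range[OF one_carrier_mat] range[OF H(1)] range[OF X(1)] carrier
        independent that] range[OF C] fixed[OF C] unfolding \<Phi>C by metis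
  then show False by (rule no_channel_projecting_along_hermitian[OF V K])
qed

section \<open>The first singular time of a contractive evolution\<close>

definition normalized :: "nat \<Rightarrow> complex mat \<Rightarrow> complex mat" where
  "normalized n X = complex_of_real (1 / entry_norm n X) \<cdot>\<^sub>m X"

lemma normalized_carrier [simp]: "X \<in> carrier_mat n n \<Longrightarrow> normalized n X \<in> carrier_mat n n"
  by (simp add: normalized_def)

lemma entry_norm_normalized: "X \<in> carrier_mat n n \<Longrightarrow> X \<noteq> 0\<^sub>m n n \<Longrightarrow> entry_norm n (normalized n X) = 1"
  using entry_norm_pos[of X n] by (simp add: normalized_def entry_norm_smult norm_divide)

lemma linear_map_on_normalized_eq_zero:
  "linear_map_on n \<Phi> \<Longrightarrow> X \<in> carrier_mat n n \<Longrightarrow> \<Phi> X = 0\<^sub>m n n \<Longrightarrow> \<Phi> (normalized n X) = 0\<^sub>m n n"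
  by (simp add: normalized_def linear_map_on_smult)

lemma normalized_convergent_subsequence:
  assumes "\<And>k. entry_norm n (X k) = 1"
  obtains r L where "strict_mono (r :: nat \<Rightarrow> nat)" "L \<in> carrier_mat n n" "L \<noteq> 0\<^sub>m n n"
    "mat_tendsto n (\<lambda>k. X (r k)) L sequentially"
proof -
  have "cmod (X k $$ (i,j)) \<le> 1" if "i < n" "j < n" for k i j
    using entry_le_entry_norm[OF that, of "X k"] assms by simp
  then obtain r L where r: "strict_mono r" "L \<in> carrier_mat n n" "mat_tendsto n (\<lambda>k. X (r k)) L sequentially"
    using bounded_mat_convergent_subsequence by metis
  have "entry_norm n L = 1"
    using tendsto_entry_norm[OF r(3)] assms by (simp add: LIMSEQ_const_iff)
  then have "L \<noteq> 0\<^sub>m n n" by (auto simp: entry_norm_def)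
  then show ?thesis using that r by blast
qed

text \<open>The \<open>V n\<close> accumulate at a channel which fixes the range of \<open>\<Phi>'\<close>. It is singular, since it annihilates
  a limit of the normalized images \<open>\<Phi> n K\<close> of an element \<open>K\<close> of the kernel of \<open>\<Phi>'\<close>.\<close>

lemma singular_channel_fixing_range:
  assumes \<Phi>: "\<And>n. CPTP d (\<Phi> n)" and \<Phi>': "CPTP d \<Phi>'" and V: "\<And>n. CPTP d (V n)"
    and lim: "\<And>X. X \<in> carrier_mat d d \<Longrightarrow> mat_tendsto d (\<lambda>n. \<Phi> n X) (\<Phi>' X) sequentially"
    and factor: "\<And>n X. X \<in> carrier_mat d d \<Longrightarrow> \<Phi>' X = V n (\<Phi> n X)"
    and K: "hermitian d K" "\<Phi>' K = 0\<^sub>m d d" "\<And>n. \<Phi> n K \<noteq> 0\<^sub>m d d"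
  obtains W Z where "CPTP d W" "hermitian d Z" "Z \<noteq> 0\<^sub>m d d" "W Z = 0\<^sub>m d d"
    "\<And>X. X \<in> carrier_mat d d \<Longrightarrow> W (\<Phi>' X) = \<Phi>' X"
proof -
  define Y where "Y n = normalized d (\<Phi> n K)" for n
  have \<Phi>K: "\<Phi> n K \<in> carrier_mat d d" for n by (rule CPTP_carrier[OF \<Phi> hermitian_carrier[OF K(1)]])
  have Y: "hermitian d (Y n)" "V n (Y n) = 0\<^sub>m d d" for n
    unfolding Y_def
    using linear_map_on_normalized_eq_zero[OF CPTP_linear[OF V] \<Phi>K] factor[OF hermitian_carrier[OF K(1)]] K(2)
    by (auto simp: normalized_def intro!: hermitian_smult CPTP_hermitian[OF \<Phi> K(1)] simp del: of_real_divide)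
  obtain r Z where r: "strict_mono r" and Z: "Z \<in> carrier_mat d d" "Z \<noteq> 0\<^sub>m d d"
    and Y_lim: "mat_tendsto d (\<lambda>n. Y (r n)) Z sequentially"
    using normalized_convergent_subsequence[of d Y] entry_norm_normalized[OF \<Phi>K K(3)] unfolding Y_def by blast
  obtain q W where q: "strict_mono q" and W: "CPTP d W"
    and V_lim: "\<And>X. X \<in> carrier_mat d d \<Longrightarrow> mat_tendsto d (\<lambda>n. V (r (q n)) X) (W X) sequentially"
    using CPTP_convergent_subsequence[of d "\<lambda>n. V (r n)"] V by blast
  note V_lim_joint = mat_tendsto_linear_map_on[OF CPTP_linear[OF V] CPTP_linear[OF W] V_lim]
  have "mat_tendsto d (\<lambda>n. V (r (q n)) (Y (r (q n)))) (W Z) sequentially"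
    by (rule V_lim_joint[OF _ hermitian_carrier[OF Y(1)] Z(1) mat_tendsto_subseq[OF Y_lim q]])
  then have "W Z = 0\<^sub>m d d"
    using CPTP_carrier[OF W Z(1)]
    by (intro mat_tendsto_unique[OF sequentially_bot]) (auto simp: Y(2) mat_tendsto_const)
  moreover have "W (\<Phi>' X) = \<Phi>' X" if X: "X \<in> carrier_mat d d" for X
  proof -
    have "mat_tendsto d (\<lambda>n. V (r (q n)) (\<Phi> (r (q n)) X)) (W (\<Phi>' X)) sequentially"
      by (rule V_lim_joint[OF _ CPTP_carrier[OF \<Phi> X] CPTP_carrier[OF \<Phi>' X]
            mat_tendsto_subseq[OF mat_tendsto_subseq[OF lim[OF X] r] q]])
    then have "mat_tendsto d (\<lambda>n. \<Phi>' X) (W (\<Phi>' X)) sequentially"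
      unfolding factor[OF X, symmetric] .
    then show ?thesis
      by (rule mat_tendsto_unique[OF sequentially_bot CPTP_carrier[OF W CPTP_carrier[OF \<Phi>' X]]
            CPTP_carrier[OF \<Phi>' X] _ mat_tendsto_const])
  qed
  moreover have "hermitian d Z"
    by (rule hermitian_limit[OF sequentially_bot Y(1) Z(1) Y_lim])
  ultimately show ?thesis using that[OF W _ Z(2)] by blast
qed

lemma linear_map_on_traceless_eq_zero:
  assumes L: "linear_map_on d \<Phi>" and zero: "\<And>H. hermitian d H \<Longrightarrow> mtrace H = 0 \<Longrightarrow> \<Phi> H = 0\<^sub>m d d"
    and X: "X \<in> carrier_mat d d" "mtrace X = 0"
  shows "\<Phi> X = 0\<^sub>m d d"
proof -
  obtain A B where AB: "hermitian d A" "hermitian d B" "X = A + \<i> \<cdot>\<^sub>m B" by (rule hermitian_decomp[OF X(1)])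
  note carrier = AB(1,2)[THEN hermitian_carrier]
  have "mtrace A + \<i> * mtrace B = 0"
    using X(2) carrier by (simp add: AB(3) mtrace_add[of _ d] mtrace_smult[of _ d])
  then have "mtrace A = 0" "mtrace B = 0"
    using Im_mtrace_hermitian[OF AB(1)] Im_mtrace_hermitian[OF AB(2)] by (auto simp: complex_eq_iff)
  then show ?thesis
    using zero AB(1,2) unfolding AB(3) linear_map_on_add_smult[OF L carrier] by simp
qed

locale contractive_evolution =
  fixes d :: nat and \<Lambda> :: "real \<Rightarrow> complex mat \<Rightarrow> complex mat"
  assumes channel: "\<And>t. 0 \<le> t \<Longrightarrow> CPTP d (\<Lambda> t)"
    and initial: "\<And>X. X \<in> carrier_mat d d \<Longrightarrow> \<Lambda> 0 X = X"
    and continuous: "\<And>t X i j. 0 \<le> t \<Longrightarrow> X \<in> carrier_mat d d \<Longrightarrow> i < d \<Longrightarrow> j < d \<Longrightarrow>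
      continuous (at t within {0..}) (\<lambda>s. \<Lambda> s X $$ (i,j))"
    and dominated: "\<And>s t. 0 < s \<Longrightarrow> s \<le> t \<Longrightarrow> trace_norm_dominated d (\<Lambda> t) (\<Lambda> s)"
begin

lemma kernel_mono:
  "0 < s \<Longrightarrow> s \<le> t \<Longrightarrow> X \<in> carrier_mat d d \<Longrightarrow> \<Lambda> s X = 0\<^sub>m d d \<Longrightarrow> \<Lambda> t X = 0\<^sub>m d d"
  by (rule kernel_mono_if_trace_norm_dominated[OF channel channel dominated]) auto

lemma mat_tendsto_evolution:
  assumes "0 \<le> s" "\<And>n. 0 \<le> u n" "u \<longlonglongrightarrow> s" "X \<in> carrier_mat d d"
  shows "mat_tendsto d (\<lambda>n. \<Lambda> (u n) X) (\<Lambda> s X) sequentially"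
  unfolding mat_tendsto_def
  using continuous_within_tendsto_compose'[OF continuous[OF assms(1,4)], of _ _ u sequentially] assms by auto

lemma factors_through_initial: "0 \<le> t \<Longrightarrow> factors_through d (\<Lambda> t) (\<Lambda> 0)"
  using channel initial by (auto simp: factors_through_def)

lemma factors_through_if_trivial_kernel:
  assumes "0 \<le> s" "s \<le> t" and inj: "trivial_kernel d (\<Lambda> s)"
  shows "factors_through d (\<Lambda> t) (\<Lambda> s)"
proof (cases "s = 0")
  case False
  have "bij_betw (\<Lambda> s) (carrier_mat d d) (carrier_mat d d)"
    using inj channel[OF assms(1)]
    by (intro linear_map_on_bij_if_trivial_kernel CPTP_linear) auto
  then show ?thesis using assms False by (intro factors_through_if_bij channel dominated) auto
qed (use assms factors_through_initial in simp)

lemma not_trivial_kernel_limit: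
  assumes s: "0 \<le> s" and u: "\<And>n. 0 \<le> u n" "u \<longlonglongrightarrow> s" and not_inj: "\<And>n. \<not> trivial_kernel d (\<Lambda> (u n))"
  shows "\<not> trivial_kernel d (\<Lambda> s)"
proof -
  obtain X where X: "\<And>n. X n \<in> carrier_mat d d" "\<And>n. \<Lambda> (u n) (X n) = 0\<^sub>m d d" "\<And>n. X n \<noteq> 0\<^sub>m d d"
    using not_inj unfolding trivial_kernel_def by metis
  define Z where "Z n = normalized d (X n)" for n
  have Z: "Z n \<in> carrier_mat d d" "\<Lambda> (u n) (Z n) = 0\<^sub>m d d" for n
    using X linear_map_on_normalized_eq_zero[OF CPTP_linear[OF channel[OF u(1)]] X(1)] by (simp_all add: Z_def)
  obtain r L where r: "strict_mono r" and L: "L \<in> carrier_mat d d" "L \<noteq> 0\<^sub>m d d"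
    and lim: "mat_tendsto d (\<lambda>k. Z (r k)) L sequentially"
    using normalized_convergent_subsequence[of d Z] entry_norm_normalized[OF X(1,3)] unfolding Z_def by blast
  have "(\<lambda>k. u (r k)) \<longlonglongrightarrow> s" using LIMSEQ_subseq_LIMSEQ[OF u(2) r] by (simp add: o_def)
  from mat_tendsto_evolution[OF s u(1) this]
  have "mat_tendsto d (\<lambda>k. \<Lambda> (u (r k)) (Z (r k))) (\<Lambda> s L) sequentially"
    by (rule mat_tendsto_linear_map_on[OF CPTP_linear[OF channel[OF u(1)]] CPTP_linear[OF channel[OF s]]
          _ Z(1) L(1) lim])
  then have "\<Lambda> s L = 0\<^sub>m d d"
    using CPTP_carrier[OF channel[OF s] L(1)]
    by (intro mat_tendsto_unique[OF sequentially_bot]) (auto simp: Z(2) mat_tendsto_const)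
  then show ?thesis using L by (auto simp: trivial_kernel_def)
qed

lemma first_singular_time:
  assumes "0 \<le> s" "\<not> trivial_kernel d (\<Lambda> s)"
  obtains t where "0 < t" "t \<le> s" "\<not> trivial_kernel d (\<Lambda> t)" "\<And>r. 0 \<le> r \<Longrightarrow> r < t \<Longrightarrow> trivial_kernel d (\<Lambda> r)"
proof -
  define N where "N = {r. 0 \<le> r \<and> \<not> trivial_kernel d (\<Lambda> r)}"
  have N: "N \<noteq> {}" "bdd_below N" using assms by (auto simp: N_def bdd_below_def)
  define t where "t = Inf N"
  have "\<exists>r\<in>N. r < t + inverse (real (Suc n))" for n
    using cInf_less_iff[OF N, of "t + inverse (real (Suc n))"] by (simp add: t_def)
  then obtain u where u: "\<And>n. u n \<in> N" "\<And>n. u n < t + inverse (real (Suc n))" by metis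
  have "u \<longlonglongrightarrow> t"
  proof (rule tendsto_sandwich[OF _ _ tendsto_const])
    show "(\<lambda>n. t + inverse (real (Suc n))) \<longlonglongrightarrow> t"
      using tendsto_add[OF tendsto_const LIMSEQ_inverse_real_of_nat, of t] by simp
    show "eventually (\<lambda>n. t \<le> u n) sequentially"
      unfolding t_def by (intro always_eventually allI cInf_lower u(1) N(2))
  qed (use u(2) in \<open>auto intro!: always_eventually less_imp_le\<close>)
  moreover have "0 \<le> t" unfolding t_def using N(1) by (intro cInf_greatest) (auto simp: N_def)
  ultimately have not_inj: "\<not> trivial_kernel d (\<Lambda> t)"
    using u(1) by (intro not_trivial_kernel_limit[of t u]) (auto simp: N_def)
  moreover have "t \<noteq> 0" using not_inj initial by (auto simp: trivial_kernel_def)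
  moreover have "t \<le> s" unfolding t_def using assms N(2) by (intro cInf_lower) (auto simp: N_def)
  moreover have "trivial_kernel d (\<Lambda> r)" if "0 \<le> r" "r < t" for r
    using that cInf_lower[OF _ N(2), of r] by (auto simp: N_def t_def)
  ultimately show ?thesis using that[of t] \<open>0 \<le> t\<close> by simp
qed

lemma singular_channel_fixing_range_at_first_singular_time:
  assumes t: "0 < t" "\<not> trivial_kernel d (\<Lambda> t)" and inj: "\<And>s. 0 \<le> s \<Longrightarrow> s < t \<Longrightarrow> trivial_kernel d (\<Lambda> s)"
  obtains V K where "CPTP d V" "hermitian d K" "K \<noteq> 0\<^sub>m d d" "V K = 0\<^sub>m d d"
    "\<And>X. X \<in> carrier_mat d d \<Longrightarrow> V (\<Lambda> t X) = \<Lambda> t X"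
proof -
  obtain X where X: "X \<in> carrier_mat d d" "\<Lambda> t X = 0\<^sub>m d d" "X \<noteq> 0\<^sub>m d d"
    using t(2) by (auto simp: trivial_kernel_def)
  obtain A B where AB: "hermitian d A" "hermitian d B" "X = A + \<i> \<cdot>\<^sub>m B" "\<Lambda> t A = 0\<^sub>m d d" "\<Lambda> t B = 0\<^sub>m d d"
    using CPTP_kernel_hermitian_parts[OF channel X(1,2)] t(1) by auto
  moreover have "A \<noteq> 0\<^sub>m d d \<or> B \<noteq> 0\<^sub>m d d" using X(3) AB(3) by (auto intro!: eq_matI)
  ultimately obtain K where K: "hermitian d K" "K \<noteq> 0\<^sub>m d d" "\<Lambda> t K = 0\<^sub>m d d" by blast
  define u where "u n = t * (1 - inverse (real (Suc n)))" for n
  have u: "0 \<le> u n" "u n < t" for n using t(1) by (auto simp: u_def field_simps)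
  have "u \<longlonglongrightarrow> t * (1 - 0)"
    unfolding u_def by (intro tendsto_mult tendsto_diff tendsto_const LIMSEQ_inverse_real_of_nat)
  then have u_lim: "u \<longlonglongrightarrow> t" by simp
  have "factors_through d (\<Lambda> t) (\<Lambda> (u n))" for n
    using factors_through_if_trivial_kernel[OF u(1) _ inj[OF u]] u(2)[of n] by simp
  then obtain V where V: "\<And>n. CPTP d (V n)" "\<And>n X. X \<in> carrier_mat d d \<Longrightarrow> \<Lambda> t X = V n (\<Lambda> (u n) X)"
    unfolding factors_through_def by metis
  have nonzero: "\<Lambda> (u n) K \<noteq> 0\<^sub>m d d" for n
    using inj[OF u] K(1,2) by (auto simp: trivial_kernel_def hermitian_carrier)
  show ?thesis
    by (rule singular_channel_fixing_range[OF channel[OF u(1)] channel[OF less_imp_le[OF t(1)]] V(1)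
          mat_tendsto_evolution[OF less_imp_le[OF t(1)] u(1) u_lim] V(2) K(1,3) nonzero that])
qed

end

locale contractive_qubit_evolution = contractive_evolution 2 \<Lambda> for \<Lambda>
begin

lemma collinear_after_first_singular_time:
  assumes t: "0 < t" "t \<le> s" "\<not> trivial_kernel 2 (\<Lambda> t)" and inj: "\<And>r. 0 \<le> r \<Longrightarrow> r < t \<Longrightarrow> trivial_kernel 2 (\<Lambda> r)"
    and H: "H \<in> carrier_mat 2 2" "mtrace H = 0" "\<Lambda> s H \<noteq> 0\<^sub>m 2 2" and X: "X \<in> carrier_mat 2 2" "mtrace X = 0"
  shows "\<exists>\<beta>. \<Lambda> s (X - \<beta> \<cdot>\<^sub>m H) = 0\<^sub>m 2 2"
proof -
  obtain V K where V: "CPTP 2 V" "hermitian 2 K" "K \<noteq> 0\<^sub>m 2 2" "V K = 0\<^sub>m 2 2"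
    "\<And>X. X \<in> carrier_mat 2 2 \<Longrightarrow> V (\<Lambda> t X) = \<Lambda> t X"
    using singular_channel_fixing_range_at_first_singular_time[OF t(1,3) inj] by blast
  have "\<Lambda> t H \<noteq> 0\<^sub>m 2 2" using kernel_mono[OF t(1,2) H(1)] H(3) by blast
  then obtain \<beta> where "\<Lambda> t (X - \<beta> \<cdot>\<^sub>m H) = 0\<^sub>m 2 2"
    using traceless_range_collinear_if_fixed[OF channel V H(1,2) _ X] t(1) by auto
  then have "\<Lambda> s (X - \<beta> \<cdot>\<^sub>m H) = 0\<^sub>m 2 2"
    using H(1) by (intro kernel_mono[OF t(1,2)]) (simp_all add: minus_carrier_mat)
  then show ?thesis by blast
qed

lemma divisible:
  assumes st: "0 \<le> s" "s \<le> t"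
  shows "factors_through 2 (\<Lambda> t) (\<Lambda> s)"
proof (cases "trivial_kernel 2 (\<Lambda> s)")
  case True
  then show ?thesis by (rule factors_through_if_trivial_kernel[OF st])
next
  case False
  then obtain u where u: "0 < u" "u \<le> s" "\<not> trivial_kernel 2 (\<Lambda> u)" "\<And>r. 0 \<le> r \<Longrightarrow> r < u \<Longrightarrow> trivial_kernel 2 (\<Lambda> r)"
    using first_singular_time[OF st(1)] by blast
  have channels: "CPTP 2 (\<Lambda> s)" "CPTP 2 (\<Lambda> t)" and dom: "trace_norm_dominated 2 (\<Lambda> t) (\<Lambda> s)"
    using channel dominated st u by auto
  show ?thesis
  proof (cases "\<exists>H. hermitian 2 H \<and> mtrace H = 0 \<and> \<Lambda> s H \<noteq> 0\<^sub>m 2 2")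
    case True
    then obtain H where H: "hermitian 2 H" "mtrace H = 0" "\<Lambda> s H \<noteq> 0\<^sub>m 2 2" by blast
    show ?thesis
      using factors_through_if_collinear[OF channels dom H]
        collinear_after_first_singular_time[OF u hermitian_carrier[OF H(1)] H(2,3)] by blast
  next
    case False
    then have "\<Lambda> s X = 0\<^sub>m 2 2" if "X \<in> carrier_mat 2 2" "mtrace X = 0" for X
      using linear_map_on_traceless_eq_zero[OF CPTP_linear[OF channels(1)] _ that] by blast
    then show ?thesis by (rule factors_through_if_constant[OF channels dom])
  qed
qed

end

lemma contractive_evolution_if_not_negativity_increases:
  assumes "0 < d" and "\<And>t. t \<ge> 0 \<Longrightarrow> CPTP d (\<Lambda> t)" and "\<And>X. X \<in> carrier_mat d d \<Longrightarrow> \<Lambda> 0 X = X"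
    and diff: "\<And>t X i j. t \<ge> 0 \<Longrightarrow> X \<in> carrier_mat d d \<Longrightarrow> i < d \<Longrightarrow> j < d \<Longrightarrow>
           (\<lambda>s. \<Lambda> s X $$ (i,j)) differentiable (at t within {0..})"
    and "\<not> negativity_increases d \<Lambda>"
  shows "contractive_evolution d \<Lambda>"
proof
  show "continuous (at t within {0..}) (\<lambda>s. \<Lambda> s X $$ (i,j))"
    if "0 \<le> t" "X \<in> carrier_mat d d" "i < d" "j < d" for t X i j
    using diff[OF that] by (rule differentiable_imp_continuous_within)
  show "trace_norm_dominated d (\<Lambda> t) (\<Lambda> s)" if "0 < s" "s \<le> t" for s t
    by (rule trace_norm_dominated_if_not_negativity_increases[OF assms(1,2) diff assms(5) that])
qed (fact assms)+

theorem theorem2: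
  fixes d :: nat and \<Lambda> :: "real \<Rightarrow> complex mat \<Rightarrow> complex mat"
  assumes "d \<ge> 2"
    and "\<And>t. t \<ge> 0 \<Longrightarrow> CPTP d (\<Lambda> t)"
    and "\<And>X. X \<in> carrier_mat d d \<Longrightarrow> \<Lambda> 0 X = X"
    and "\<And>t X i j. t \<ge> 0 \<Longrightarrow> X \<in> carrier_mat d d \<Longrightarrow> i < d \<Longrightarrow> j < d \<Longrightarrow>
           (\<lambda>s. \<Lambda> s X $$ (i,j)) differentiable (at t within {0..})"
    and "\<not> markovian d \<Lambda>"
    and "(\<forall>t\<ge>0. bij_betw (\<Lambda> t) (carrier_mat d d) (carrier_mat d d)) \<or> d = 2"
  shows "\<exists>dB dC \<rho> t D. dB > 0 \<and> dC > 0 \<and> density (d*dB*dC) \<rho> \<and> t > 0 \<and> D > 0 \<and>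
           ((\<lambda>s. negativity (d*dB) dC (ampl (\<Lambda> s) d (dB*dC) \<rho>))
              has_real_derivative D) (at_right t)"
proof -
  have "negativity_increases d \<Lambda>"
  proof (rule ccontr)
    assume "\<not> negativity_increases d \<Lambda>"
    then interpret contractive_evolution d \<Lambda>
      using assms(1) by (intro contractive_evolution_if_not_negativity_increases assms(2-4)) simp_all
    have "factors_through d (\<Lambda> t) (\<Lambda> s)" if st: "0 \<le> s" "s \<le> t" for s t
      using assms(6)
    proof
      assume "\<forall>t\<ge>0. bij_betw (\<Lambda> t) (carrier_mat d d) (carrier_mat d d)"
      then have "trivial_kernel d (\<Lambda> s)"
        using st(1) by (intro trivial_kernel_if_inj_on CPTP_linear channel bij_betw_imp_inj_on) auto
      then show ?thesis by (rule factors_through_if_trivial_kernel[OF st])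
    next
      assume "d = 2"
      have "contractive_evolution 2 \<Lambda>" using contractive_evolution_axioms unfolding \<open>d = 2\<close> .
      then interpret contractive_qubit_evolution \<Lambda> by (rule contractive_qubit_evolution.intro)
      show ?thesis using divisible[OF st] unfolding \<open>d = 2\<close> .
    qed
    then show False using assms(5) by (simp add: markovian_def factors_through_def)
  qed
  then show ?thesis unfolding negativity_increases_def .
qed

end
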